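(* Let $\pi$ be an irreducible cuspidal $\psi$-generic representation of $\mathrm{SO}_{2l}$. Then $\gamma(\pi\times\tau,\psi)=\gamma(c\cdot\pi\times\tau,\psi)$ for all irreducible generic representations $\tau$ of $\mathrm{GL}_n$, for any $1\le n\leq l-1$.
   Context: **Groups.** $l$ is a positive integer, $q=p^r$ with $p$ an odd prime, $\psi$ is a fixed nontrivial additive character of $\mathbb{F}_q$; representations are finite-dimensional over $\mathbb{C}$. $\mathrm{GL}_n=\mathrm{GL}_n(\mathbb{F}_q)$; $J_n$ is the $n\times n$ matrix with $1$'s on the antidiagonal and $0$ elsewhere; $\mathrm{SO}_m=\{g\in\mathrm{GL}_m:\det g=1,\ {}^tgJ_mg=J_m\}$ (over $\mathbb{F}_q$). $U_{\mathrm{GL}_n}$, $U_{\mathrm{SO}_m}$ are the upper triangular unipotent subgroups. For $a\in\mathrm{GL}_n$, $a^*=J_n\,{}^ta^{-1}J_n$. **Characters, genericity.** Define $\psi(u)=\psi(\sum_{i=1}^{n-1}u_{i,i+1})$ on $U_{\mathrm{GL}_n}$ and $\psi(u)=\psi\big(\sum_{i=1}^{l-2}u_{i,i+1}+\tfrac14u_{l-1,l}-\tfrac12u_{l-1,l+1}\big)$ on $U_{\mathrm{SO}_{2l}}$. An irreducible representation $\pi$ of $\mathrm{SO}_{2l}$ (resp. $\tau$ of $\mathrm{GL}_n$) is $\psi$-generic if $\mathrm{Hom}_{U_{\mathrm{SO}_{2l}}}(\pi,\psi)\ne0$ (resp. $\mathrm{Hom}_{U_{\mathrm{GL}_n}}(\tau,\psi)\ne0$).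 Fixing a nonzero $\Gamma\in\mathrm{Hom}_{U_{\mathrm{SO}_{2l}}}(\pi,\psi)$ (unique up to scalar), $\mathcal{W}(\pi,\psi)=\{g\mapsto\Gamma(\pi(g)v): v\in\pi\}$. **Outer conjugation.** $c=\mathrm{diag}(I_{l-1},\begin{pmatrix}0&1\\1&0\end{pmatrix},I_{l-1})$ and $(c\cdot\pi)(g)=\pi(cgc)$; $c\cdot\pi$ is again irreducible, cuspidal and $\psi$-generic. **Embedding ($n<l$).** $\mathrm{SO}_{2n+1}$ embeds in $\mathrm{SO}_{2l}$ by $$\begin{pmatrix}A&B&C\\ D&E&K\\ L&P&Q\end{pmatrix}\mapsto\mathrm{diag}\Big(I_{l-n-1},\,M_n^{-1}\begin{pmatrix}A&&B&C\\ &1&&\\ D&&E&K\\ L&&P&Q\end{pmatrix}M_n,\,I_{l-n-1}\Big),\quad M_n=\mathrm{diag}\Big(I_n,\begin{pmatrix}2&-1\\ 1&\frac12\end{pmatrix},I_n\Big),$$ with $A,Q$ of size $n\times n$. **Induced spaces.** $Q_n=L_nV_n$ is the standard (block upper triangular) Siegel parabolic of $\mathrm{SO}_{2n+1}$, with Levi $L_n=\{l_n(a)=\mathrm{diag}(a,1,a^* ):a\in\mathrm{GL}_n\}$ and unipotent radical $V_n$. For $\tau$ irreducible generic, $I(\tau)=\mathrm{Ind}_{Q_n}^{\mathrm{SO}_{2n+1}}\tau$ is the space of $\xi:\mathrm{SO}_{2n+1}\to\tau$ with $\xi(l_n(a)ug)=\tau(a)\xi(g)$ for $a\in \mathrm{GL}_n$,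 $u\in V_n$. Fix $0\ne\Lambda_\tau\in\mathrm{Hom}_{U_{\mathrm{GL}_n}}(\tau,\psi^{-1})$, put $f_\xi(g,a)=\Lambda_\tau(\tau(a)\xi(g))$, and let $I(\tau,\psi^{-1})$ be the span of the $f_\xi$. Let $\tau^*(a)=\tau(a^* )$. The intertwining operator $M(\tau,\psi^{-1}):I(\tau,\psi^{-1})\to I(\tau^*,\psi^{-1})$ is $$M(\tau,\psi^{-1})f(h,a)=\sum_{u\in V_n}f(w_nuh,d_na^* ),\quad w_n=\begin{pmatrix}&&I_n\\ &(-1)^n&\\ I_n&&\end{pmatrix},\quad d_n=\mathrm{diag}(-1,1,-1,\dots,(-1)^n).$$ **Zeta sums ($n<l$).** For $W\in\mathcal{W}(\pi,\psi)$ and $f\in I(\tau,\psi^{-1})$ or $I(\tau^*,\psi^{-1})$: $\Psi(W,f)=\sum_{g\in U_{\mathrm{SO}_{2n+1}}\backslash\mathrm{SO}_{2n+1}}\big(\sum_{r\in R^{l,n}}W(rw^{l,n}g(w^{l,n})^{-1})\big)f(g,I_n)$, where $$w^{l,n}=\begin{pmatrix}&I_n&&&\\ I_{l-n-1}&&&&\\ &&I_2&&\\ &&&&I_{l-n-1}\\ &&&I_n&\end{pmatrix},\quad R^{l,n}=\left\{\begin{pmatrix}I_n&&&&\\ x&I_{l-n-1}&&&\\ &&I_2&&\\ &&&I_{l-n-1}&\\ &&&x'&I_n\end{pmatrix}\in\mathrm{SO}_{2l}\right\}.$$ **Gamma factor.** $\gamma(\pi\times\tau,\psi)\in\mathbb{C}$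 is the constant such that $\gamma(\pi\times\tau,\psi)\Psi(W,f)=\Psi(W,M(\tau,\psi^{-1})f)$ for all $W\in\mathcal{W}(\pi,\psi)$, $f\in I(\tau,\psi^{-1})$. *)

theory Defs
  imports
    Complex_Main
    "HOL-Algebra.Coset"
    "Jordan_Normal_Form.Determinant"
    "Jordan_Normal_Form.VS_Connect"
begin

text \<open>
  Matrices are those of \<^theory>\<open>Jordan_Normal_Form.Matrix\<close>, so rows and columns are numbered from 0.
  The finite field is a type of sort \<open>{field, finite}\<close>.  Functions on a group are represented by
  functions on the ambient type of matrices; their values outside the group are never used.
\<close>

section \<open>The groups\<close>

definition GL :: "nat \<Rightarrow> 'a::field mat monoid" where
  "GL n = \<lparr>carrier = {A \<in> carrier_mat n n. invertible_mat A}, mult = (*), one = 1\<^sub>m n\<rparr>"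

definition antidiag :: "nat \<Rightarrow> 'a::field mat" where
  "antidiag n = mat n n (\<lambda>(i, j). if i + j + 1 = n then 1 else 0)"

definition SO :: "nat \<Rightarrow> 'a::field mat monoid" where
  "SO m = (GL m)\<lparr>carrier := {g \<in> carrier (GL m).
             det g = 1 \<and> transpose_mat g * antidiag m * g = antidiag m}\<rparr>"

definition star :: "nat \<Rightarrow> 'a::field mat \<Rightarrow> 'a mat" where
  "star n a = antidiag n * transpose_mat (inv\<^bsub>GL n\<^esub> a) * antidiag n"

definition upper_unipotent :: "nat \<Rightarrow> 'a::field mat set" where
  "upper_unipotent n = {u \<in> carrier_mat n n. upper_triangular u \<and> (\<forall>i<n. u $$ (i, i) = 1)}"

definition U_GL :: "nat \<Rightarrow> 'a::field mat set" where
  "U_GL n = carrier (GL n) \<inter> upper_unipotent n"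

definition U_SO :: "nat \<Rightarrow> 'a::field mat set" where
  "U_SO m = carrier (SO m) \<inter> upper_unipotent m"

lemma carrier_GL_iff:
  "A \<in> carrier (GL n) \<longleftrightarrow>
     A \<in> carrier_mat n n \<and> (\<exists>B \<in> carrier_mat n n. A * B = 1\<^sub>m n \<and> B * A = 1\<^sub>m n)"
proof
  assume "A \<in> carrier (GL n)"
  then have A: "A \<in> carrier_mat n n" and "invertible_mat A" by (auto simp: GL_def)
  then obtain B where B: "A * B = 1\<^sub>m n" "B * A = 1\<^sub>m (dim_row B)"
    by (auto simp: invertible_mat_def inverts_mat_def)
  have "dim_col B = n" using arg_cong[OF B(1), of dim_col] by simp
  moreover have "dim_row B = n" using arg_cong[OF B(2), of dim_col] A by simp
  ultimately have "B \<in> carrier_mat n n" by blast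
  then show "A \<in> carrier_mat n n \<and> (\<exists>B \<in> carrier_mat n n. A * B = 1\<^sub>m n \<and> B * A = 1\<^sub>m n)"
    using A B by auto
qed (auto simp: GL_def invertible_mat_def inverts_mat_def)

lemma group_GL: "group (GL n :: 'a::field mat monoid)"
proof (rule groupI)
  fix x y :: "'a mat" assume "x \<in> carrier (GL n)" "y \<in> carrier (GL n)"
  then obtain x' y' where c: "x \<in> carrier_mat n n" "x' \<in> carrier_mat n n"
      "y \<in> carrier_mat n n" "y' \<in> carrier_mat n n"
    and inv: "x * x' = 1\<^sub>m n" "x' * x = 1\<^sub>m n" "y * y' = 1\<^sub>m n" "y' * y = 1\<^sub>m n"
    by (auto simp: carrier_GL_iff)
  have "(x * y) * (y' * x') = x * ((y * y') * x')" "(y' * x') * (x * y) = y' * ((x' * x) * y)"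
    using c by (simp_all add: assoc_mult_mat[of _ n n _ n _ n])
  then have "(x * y) * (y' * x') = 1\<^sub>m n" "(y' * x') * (x * y) = 1\<^sub>m n"
    using c inv by (simp_all only: left_mult_one_mat)
  then have "\<exists>B \<in> carrier_mat n n. x * y * B = 1\<^sub>m n \<and> B * (x * y) = 1\<^sub>m n"
    using c by (intro bexI[of _ "y' * x'"] conjI) (assumption | rule mult_carrier_mat)+
  then show "x \<otimes>\<^bsub>GL n\<^esub> y \<in> carrier (GL n)"
    using c unfolding carrier_GL_iff by (auto simp: GL_def)
next
  fix x :: "'a mat" assume "x \<in> carrier (GL n)"
  then show "\<exists>y \<in> carrier (GL n). y \<otimes>\<^bsub>GL n\<^esub> x = \<one>\<^bsub>GL n\<^esub>"
    unfolding carrier_GL_iff Bex_def by (auto simp: GL_def)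
next
  show "\<one>\<^bsub>GL n\<^esub> \<in> carrier (GL n :: 'a mat monoid)"
    unfolding carrier_GL_iff by (auto simp: GL_def intro!: bexI[of _ "1\<^sub>m n"])
qed (auto simp: GL_def)

lemma group_SO: "group (SO m :: 'a::field mat monoid)"
proof -
  let ?G = "GL m :: 'a mat monoid" and ?J = "antidiag m :: 'a mat"
  let ?H = "{g \<in> carrier ?G. det g = 1 \<and> transpose_mat g * ?J * g = ?J}"
  interpret group ?G by (rule group_GL)
  have J: "?J \<in> carrier_mat m m" by (simp add: antidiag_def)
  have car: "x \<in> carrier ?G \<Longrightarrow> x \<in> carrier_mat m m" for x by (simp add: GL_def)
  have "subgroup ?H ?G"
  proof (rule subgroupI)
    have "\<one>\<^bsub>?G\<^esub> \<in> ?H" using one_closed J by (simp add: GL_def)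
    then show "?H \<noteq> {}" by blast
  next
    fix a assume a: "a \<in> ?H"
    define b where "b = inv\<^bsub>?G\<^esub> a"
    have bG: "b \<in> carrier ?G" using a by (simp add: b_def)
    have ac: "a \<in> carrier_mat m m" and bc: "b \<in> carrier_mat m m" using a bG car by auto
    have ab: "a * b = 1\<^sub>m m" using r_inv[of a] a by (simp add: b_def GL_def)
    have "det a * det b = 1" using det_mult[OF ac bc] ab by simp
    then have "det b = 1" using a by simp
    moreover have "transpose_mat b * ?J * b = ?J"
    proof -
      have t: "transpose_mat b * transpose_mat a = 1\<^sub>m m"
        using transpose_mult[OF ac bc] ab by simp
      have "transpose_mat b * ?J * b = transpose_mat b * (transpose_mat a * ?J * a) * b"
        using a by simp
      also have "\<dots> = (transpose_mat b * transpose_mat a) * ?J * (a * b)"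
        using ac bc J by (simp add: assoc_mult_mat[of _ m m _ m _ m])
      finally show ?thesis using t ab J by simp
    qed
    ultimately show "inv\<^bsub>?G\<^esub> a \<in> ?H" using bG by (simp add: b_def)
  next
    fix a b assume a: "a \<in> ?H" and b: "b \<in> ?H"
    have ac: "a \<in> carrier_mat m m" and bc: "b \<in> carrier_mat m m" using a b car by auto
    have "transpose_mat (a * b) * ?J * (a * b) = transpose_mat b * (transpose_mat a * ?J * a) * b"
      using ac bc J by (simp add: transpose_mult[OF ac bc] assoc_mult_mat[of _ m m _ m _ m])
    then have "transpose_mat (a * b) * ?J * (a * b) = ?J" using a b by simp
    moreover have "a * b \<in> carrier ?G" using m_closed[of a b] a b by (simp add: GL_def)
    ultimately show "a \<otimes>\<^bsub>?G\<^esub> b \<in> ?H" using a b det_mult[OF ac bc] by (simp add: GL_def)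
  qed auto
  then show ?thesis unfolding SO_def by (rule subgroup.subgroup_is_group) (rule group_GL)
qed

section \<open>Representations\<close>

locale fd_representation = group G + vector_space scale
  for G :: "('g, 'm) monoid_scheme" (structure)
    and scale :: "complex \<Rightarrow> 'v::ab_group_add \<Rightarrow> 'v" +
  fixes \<rho> :: "'g \<Rightarrow> 'v \<Rightarrow> 'v"
  assumes finite_dim: "\<exists>B. finite B \<and> span B = UNIV"
    and rep_linear: "x \<in> carrier G \<Longrightarrow> Vector_Spaces.linear scale scale (\<rho> x)"
    and rep_mult: "x \<in> carrier G \<Longrightarrow> y \<in> carrier G \<Longrightarrow> \<rho> (x \<otimes> y) v = \<rho> x (\<rho> y v)"
    and rep_one: "\<rho> \<one> v = v"

locale irreducible_representation = fd_representation G scale \<rho>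
  for G :: "('g, 'm) monoid_scheme" (structure)
    and scale :: "complex \<Rightarrow> 'v::ab_group_add \<Rightarrow> 'v" and \<rho> +
  assumes nonzero: "\<exists>v::'v. v \<noteq> 0"
    and irreducible:
      "Modules.module.subspace scale W \<Longrightarrow> (\<And>x. x \<in> carrier G \<Longrightarrow> \<rho> x ` W \<subseteq> W) \<Longrightarrow> W = {0} \<or> W = UNIV"

definition additive_character :: "('a::field \<Rightarrow> complex) \<Rightarrow> bool" where
  "additive_character \<psi> \<longleftrightarrow> \<psi> 0 = 1 \<and> (\<forall>x y. \<psi> (x + y) = \<psi> x * \<psi> y)"

definition psi_GL :: "('a::field \<Rightarrow> complex) \<Rightarrow> nat \<Rightarrow> 'a mat \<Rightarrow> complex" where
  "psi_GL \<psi> n u = \<psi> (\<Sum>i<n-1. u $$ (i, i+1))"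

text \<open>Meaningful for \<open>l \<ge> 2\<close> only.\<close>
definition psi_SO :: "('a::field \<Rightarrow> complex) \<Rightarrow> nat \<Rightarrow> 'a mat \<Rightarrow> complex" where
  "psi_SO \<psi> l u = \<psi> ((\<Sum>i<l-2. u $$ (i, i+1)) + 1/4 * u $$ (l-2, l-1) - 1/2 * u $$ (l-2, l))"

definition Hom_char :: "(complex \<Rightarrow> 'v::ab_group_add \<Rightarrow> 'v) \<Rightarrow> ('g \<Rightarrow> 'v \<Rightarrow> 'v) \<Rightarrow> 'g set
    \<Rightarrow> ('g \<Rightarrow> complex) \<Rightarrow> ('v \<Rightarrow> complex) set" where
  "Hom_char scale \<rho> U \<chi> = {L. Vector_Spaces.linear scale (*) L \<and> (\<forall>u\<in>U. \<forall>v. L (\<rho> u v) = \<chi> u * L v)}"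

definition generic_SO where
  "generic_SO \<psi> l scale \<pi> \<longleftrightarrow> (\<exists>\<Gamma> \<in> Hom_char scale \<pi> (U_SO (2*l)) (psi_SO \<psi> l). \<Gamma> \<noteq> (\<lambda>_. 0))"

definition generic_GL where
  "generic_GL \<psi> n scale \<tau> \<longleftrightarrow> (\<exists>\<Lambda> \<in> Hom_char scale \<tau> (U_GL n) (psi_GL \<psi> n). \<Lambda> \<noteq> (\<lambda>_. 0))"

definition whittaker :: "('g \<Rightarrow> 'v \<Rightarrow> 'v) \<Rightarrow> ('v \<Rightarrow> complex) \<Rightarrow> ('g \<Rightarrow> complex) set" where
  "whittaker \<pi> \<Gamma> = {(\<lambda>g. \<Gamma> (\<pi> g v)) | v. True}"

subsection \<open>Cuspidality\<close>

text \<open>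
  The parabolic subgroups of a special orthogonal group are the stabilisers of flags
  \<open>0 \<subset> W\<^sub>1 \<subset> \<dots> \<subset> W\<^sub>k\<close> of totally isotropic subspaces.  The unipotent radical consists of the elements
  acting trivially on the successive quotients of
  \<open>0 \<subset> W\<^sub>1 \<subset> \<dots> \<subset> W\<^sub>k \<subseteq> W\<^sub>k\<^sup>\<bottom> \<subset> \<dots> \<subset> W\<^sub>1\<^sup>\<bottom> \<subset> V\<close>.
  Some nontrivial flags are stabilised by the whole group (an isotropic line for \<open>SO 2\<close>), so
  properness is a condition on the stabiliser and not on the flag.
\<close>

definition perp :: "nat \<Rightarrow> 'a::field vec set \<Rightarrow> 'a vec set" where
  "perp m W = {v \<in> carrier_vec m. \<forall>w\<in>W. v \<bullet> (antidiag m *\<^sub>v w) = 0}"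

definition isotropic_flag :: "nat \<Rightarrow> 'a::field vec set list \<Rightarrow> bool" where
  "isotropic_flag m Ws \<longleftrightarrow>
     (\<forall>W\<in>set Ws. VectorSpace.subspace class_ring W (module_vec TYPE('a) m) \<and> W \<subseteq> perp m W) \<and>
     sorted_wrt (\<subset>) ({0\<^sub>v m} # Ws)"

definition parabolic :: "nat \<Rightarrow> 'a::field vec set list \<Rightarrow> 'a mat set" where
  "parabolic m Ws = {g \<in> carrier (SO m). \<forall>W\<in>set Ws. (\<lambda>v. g *\<^sub>v v) ` W = W}"

definition unipotent_radical :: "nat \<Rightarrow> 'a::field vec set list \<Rightarrow> 'a mat set" where
  "unipotent_radical m Ws =
     (let F = {0\<^sub>v m} # Ws @ rev (map (perp m) Ws) @ [carrier_vec m]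
      in {g \<in> carrier (SO m). \<forall>i < length F - 1. \<forall>v \<in> F ! (i+1). g *\<^sub>v v - v \<in> F ! i})"

definition cuspidal :: "nat \<Rightarrow> ('a::field mat \<Rightarrow> 'v::ab_group_add \<Rightarrow> 'v) \<Rightarrow> bool" where
  "cuspidal m \<pi> \<longleftrightarrow>
     (\<forall>Ws. isotropic_flag m Ws \<and> parabolic m Ws \<noteq> carrier (SO m) \<longrightarrow>
        (\<forall>v. (\<forall>u \<in> unipotent_radical m Ws. \<pi> u v = v) \<longrightarrow> v = 0))"

subsection \<open>Outer conjugation\<close>

definition outer_elt :: "nat \<Rightarrow> 'a::field mat" where
  "outer_elt l = diag_block_mat [1\<^sub>m (l-1), mat_of_rows_list 2 [[0, 1], [1, 0]], 1\<^sub>m (l-1)]"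

definition outer_conj :: "nat \<Rightarrow> ('a::field mat \<Rightarrow> 'v \<Rightarrow> 'v) \<Rightarrow> 'a mat \<Rightarrow> 'v \<Rightarrow> 'v" where
  "outer_conj l \<pi> g = \<pi> (outer_elt l * g * outer_elt l)"

section \<open>The embedding of SO(2n+1) into SO(2l)\<close>

definition M_mat :: "nat \<Rightarrow> 'a::field mat" where
  "M_mat n = diag_block_mat [1\<^sub>m n, mat_of_rows_list 2 [[2, -1], [1, 1/2]], 1\<^sub>m n]"

text \<open>A row and a column of the identity matrix inserted at position \<open>n\<close>, between the blocks
  \<open>A\<close> and \<open>B\<close>.\<close>
definition insert_one :: "nat \<Rightarrow> 'a::field mat \<Rightarrow> 'a mat" where
  "insert_one n g = mat (2*n+2) (2*n+2) (\<lambda>(i, j).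
     if i = n \<or> j = n then (if i = j then 1 else 0) else g $$ (delete_index n i, delete_index n j))"

definition embed :: "nat \<Rightarrow> nat \<Rightarrow> 'a::field mat \<Rightarrow> 'a mat" where
  "embed l n g = diag_block_mat
     [1\<^sub>m (l-n-1), inv\<^bsub>GL (2*n+2)\<^esub> (M_mat n) * insert_one n g * M_mat n, 1\<^sub>m (l-n-1)]"

section \<open>Induced spaces and the intertwining operator\<close>

definition levi :: "nat \<Rightarrow> 'a::field mat \<Rightarrow> 'a mat" where
  "levi n a = diag_block_mat [a, 1\<^sub>m 1, star n a]"

definition V_rad :: "nat \<Rightarrow> 'a::field mat set" where
  "V_rad n = {u \<in> carrier (SO (2*n+1)). \<exists>X \<in> carrier_mat n (n+1). \<exists>y \<in> carrier_mat 1 n.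
     u = four_block_mat (1\<^sub>m n) X
           (0\<^sub>m (n+1) n) (four_block_mat (1\<^sub>m 1) y (0\<^sub>m n 1) (1\<^sub>m n))}"

definition Ind :: "nat \<Rightarrow> ('a::field mat \<Rightarrow> 'w \<Rightarrow> 'w) \<Rightarrow> ('a mat \<Rightarrow> 'w) set" where
  "Ind n \<tau> = {\<xi>. \<forall>a \<in> carrier (GL n). \<forall>u \<in> V_rad n. \<forall>g \<in> carrier (SO (2*n+1)).
                 \<xi> (levi n a * u * g) = \<tau> a (\<xi> g)}"

definition f_xi :: "('a mat \<Rightarrow> 'w \<Rightarrow> 'w) \<Rightarrow> ('w \<Rightarrow> complex) \<Rightarrow> ('a mat \<Rightarrow> 'w)
    \<Rightarrow> 'a mat \<Rightarrow> 'a mat \<Rightarrow> complex" where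
  "f_xi \<tau> \<Lambda> \<xi> g a = \<Lambda> (\<tau> a (\<xi> g))"

definition Ind_whittaker :: "nat \<Rightarrow> ('a::field mat \<Rightarrow> 'w \<Rightarrow> 'w) \<Rightarrow> ('w \<Rightarrow> complex)
    \<Rightarrow> ('a mat \<Rightarrow> 'a mat \<Rightarrow> complex) set" where
  "Ind_whittaker n \<tau> \<Lambda> =
     {(\<lambda>g a. \<Sum>\<xi>\<in>S. k \<xi> * f_xi \<tau> \<Lambda> \<xi> g a) | S k. finite S \<and> S \<subseteq> Ind n \<tau>}"

definition w_n :: "nat \<Rightarrow> 'a::field mat" where
  "w_n n = four_block_mat
     (0\<^sub>m n (n+1)) (1\<^sub>m n)
     (four_block_mat (0\<^sub>m 1 n) ((-1)^n \<cdot>\<^sub>m 1\<^sub>m 1) (1\<^sub>m n) (0\<^sub>m n 1)) (0\<^sub>m (n+1) n)"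

definition d_n :: "nat \<Rightarrow> 'a::field mat" where
  "d_n n = mat_diag n (\<lambda>i. (-1)^(i+1))"

definition intertwine :: "nat \<Rightarrow> ('a::field mat \<Rightarrow> 'a mat \<Rightarrow> complex)
    \<Rightarrow> 'a mat \<Rightarrow> 'a mat \<Rightarrow> complex" where
  "intertwine n f h a = (\<Sum>u\<in>V_rad n. f (w_n n * u * h) (d_n n * star n a))"

section \<open>Zeta sums and the gamma factor\<close>

definition w_ln :: "nat \<Rightarrow> nat \<Rightarrow> 'a::field mat" where
  "w_ln l n = (let m = l-n-1 in diag_block_mat
     [four_block_mat (0\<^sub>m n m) (1\<^sub>m n) (1\<^sub>m m) (0\<^sub>m m n),
      1\<^sub>m 2,
      four_block_mat (0\<^sub>m m n) (1\<^sub>m m) (1\<^sub>m n) (0\<^sub>m n m)])"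

definition R_ln :: "nat \<Rightarrow> nat \<Rightarrow> 'a::field mat set" where
  "R_ln l n = (let m = l-n-1 in
     {r \<in> carrier (SO (2*l)). \<exists>x \<in> carrier_mat m n. \<exists>x' \<in> carrier_mat n m.
        r = diag_block_mat
          [four_block_mat (1\<^sub>m n) (0\<^sub>m n m) x (1\<^sub>m m),
           1\<^sub>m 2,
           four_block_mat (1\<^sub>m m) (0\<^sub>m m n) x' (1\<^sub>m n)]})"

text \<open>The summand of the outer sum is left \<open>U_SO (2*n+1)\<close>-invariant for Whittaker functions \<open>W\<close> and
  \<open>f\<close> in one of the induced spaces, hence the choice of a representative of each coset.\<close>
definition zeta :: "nat \<Rightarrow> nat \<Rightarrow> ('a::field mat \<Rightarrow> complex) \<Rightarrow> ('a mat \<Rightarrow> 'a mat \<Rightarrow> complex)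
    \<Rightarrow> complex" where
  "zeta l n W f = (\<Sum>C \<in> rcosets\<^bsub>SO (2*n+1)\<^esub> (U_SO (2*n+1)).
     let g = (SOME g. g \<in> C) in
       (\<Sum>r\<in>R_ln l n. W (r * w_ln l n * embed l n g * inv\<^bsub>SO (2*l)\<^esub> (w_ln l n))) * f g (1\<^sub>m n))"

text \<open>The defining property of the gamma factor.  It is imposed for every choice of the Whittaker
  functionals \<open>\<Gamma>\<close> and \<open>\<Lambda>\<close>; these are unique up to scalars, and neither the Whittaker
  model nor the induced space changes when they are rescaled.\<close>
definition is_gamma where
  "is_gamma \<psi> l n scale\<^sub>\<pi> \<pi> scale\<^sub>\<tau> \<tau> \<gamma> \<longleftrightarrow>
     (\<forall>\<Gamma> \<in> Hom_char scale\<^sub>\<pi> \<pi> (U_SO (2*l)) (psi_SO \<psi> l).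
      \<forall>\<Lambda> \<in> Hom_char scale\<^sub>\<tau> \<tau> (U_GL n) (\<lambda>u. inverse (psi_GL \<psi> n u)).
        \<Gamma> \<noteq> (\<lambda>_. 0) \<longrightarrow> \<Lambda> \<noteq> (\<lambda>_. 0) \<longrightarrow>
        (\<forall>W \<in> whittaker \<pi> \<Gamma>. \<forall>f \<in> Ind_whittaker n \<tau> \<Lambda>.
           \<gamma> * zeta l n W f = zeta l n W (intertwine n f)))"

definition gamma :: "('a::field \<Rightarrow> complex) \<Rightarrow> nat \<Rightarrow> nat
    \<Rightarrow> (complex \<Rightarrow> 'v::ab_group_add \<Rightarrow> 'v) \<Rightarrow> ('a mat \<Rightarrow> 'v \<Rightarrow> 'v)
    \<Rightarrow> (complex \<Rightarrow> 'w::ab_group_add \<Rightarrow> 'w) \<Rightarrow> ('a mat \<Rightarrow> 'w \<Rightarrow> 'w) \<Rightarrow> complex" where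
  "gamma \<psi> l n scale\<^sub>\<pi> \<pi> scale\<^sub>\<tau> \<tau> = (THE \<gamma>. is_gamma \<psi> l n scale\<^sub>\<pi> \<pi> scale\<^sub>\<tau> \<tau> \<gamma>)"

end

theory Submission
  imports Defs
begin

text \<open>
  The gamma factor is the constant in a family of functional equations, one for each Whittaker
  function \<open>W\<close> of the representation and each \<open>f\<close> in the induced space.  The families for \<open>\<pi>\<close> and for
  \<open>outer_conj l \<pi>\<close> turn out to be the same equations in a different order, so they have the same
  solutions \<open>\<gamma>\<close> and the two gamma factors agree.

  The matching of the two families comes from a reflection.  The embedded \<open>SO (2*n+1)\<close> is the
  stabiliser of an anisotropic vector of the middle plane in the special orthogonal group of the
  middle \<open>2*n+2\<close> coordinates.  Let \<open>\<kappa>\<close> be the reflection that fixes this vector and all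
  coordinates outside the plane and negates the orthogonal complement of the vector in the middle plane
  (\<open>outer_twist\<close>).  It differs from \<open>outer_elt\<close> by an element of the torus, and it has four properties:

  \<^item> conjugation by \<open>\<kappa>\<close> preserves \<open>U_SO (2*l)\<close> and its character (\<open>outer_twist_conj_U_SO\<close>), so that
    \<open>W \<mapsto> W'\<close> with \<open>W' g = W (\<kappa> g \<kappa>)\<close> maps Whittaker functions of \<open>\<pi>\<close> onto those of \<open>outer_conj l \<pi>\<close>;
  \<^item> \<open>\<kappa>\<close> commutes with \<open>w_ln\<close> and with \<open>R_ln\<close> (\<open>outer_twist_commute\<close>);
  \<^item> \<open>\<kappa>\<close> conjugates the image of \<open>g\<close> in \<open>SO (2*l)\<close> to the image of \<open>e g e\<close> with
    \<open>e = diag(1, \<dots>, 1, -1, 1, \<dots>, 1)\<close> (\<open>outer_twist_conj_embed\<close>);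
  \<^item> conjugation by \<open>e\<close> fixes \<open>w_n\<close> and every \<open>levi n a\<close> and preserves \<open>V_rad\<close>, hence acts on the induced
    space and commutes with the intertwining operator (\<open>Ind_whittaker_refl_conj\<close>,
    \<open>intertwine_refl_conj\<close>).

  The substitution \<open>g \<mapsto> e g e\<close> in the outer sum therefore turns the zeta sum of \<open>(W', f)\<close> into that of
  \<open>(W, f')\<close>, where \<open>f' (g, a) = f (e g e, a)\<close>, and does the same with the intertwining operator applied.

  The substitution does not respect the choice of coset representatives in \<open>zeta\<close>, so most of the
  work goes into the invariance of the summand under \<open>U_SO (2*n+1)\<close>.  Every element of this group is
  the product of some \<open>levi n a\<close>, with \<open>a\<close> in \<open>U_GL n\<close>, and an element of \<open>V_rad n\<close>.  For the function \<open>f\<close> and its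
  image under the intertwining operator, equivariance follows from the definitions and from the
  way \<open>w_n\<close> and \<open>d_n\<close> act on \<open>U_GL\<close>.  For the inner sum over \<open>R_ln\<close>, the Levi part normalises \<open>R_ln\<close>
  and contributes the character of \<open>U_GL\<close>, while the radical part is conjugated into
  the kernel of the character of \<open>U_SO (2*l)\<close>: this uses that the embedded group fixes a vector whose middle
  coordinates are exactly the last coefficients of that character.
\<close>

section \<open>Entries of products and membership in the groups\<close>

lemma times_mat_entry:
  assumes "A \<in> carrier_mat m k" "B \<in> carrier_mat k n" "i < m" "j < n"
  shows "(A * B) $$ (i, j) = (\<Sum>c<k. A $$ (i, c) * B $$ (c, j))"
  using assms by (auto simp: scalar_prod_def lessThan_atLeast0 intro!: sum.cong)

lemma sum_single:
  fixes f :: "nat \<Rightarrow> 'a::comm_monoid_add"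
  assumes "k < m" and "\<And>i. i < m \<Longrightarrow> i \<noteq> k \<Longrightarrow> f i = 0"
  shows "(\<Sum>i<m. f i) = f k"
  using assms by (subst sum.mono_neutral_right[of _ "{k}"]) auto

lemma antidiag_carrier [simp]: "antidiag m \<in> carrier_mat m m"
  by (simp add: antidiag_def)

lemma antidiag_dim [simp]: "dim_row (antidiag m) = m" "dim_col (antidiag m) = m"
  by (simp_all add: antidiag_def)

lemma antidiag_entry: "i < m \<Longrightarrow> j < m \<Longrightarrow> antidiag m $$ (i, j) = (if i + j + 1 = m then 1 else 0)"
  by (simp add: antidiag_def)

lemma transpose_antidiag [simp]: "transpose_mat (antidiag m) = antidiag m"
  by (rule eq_matI) (auto simp: antidiag_entry add.commute)

lemma antidiag_mult_left_entry:
  assumes "A \<in> carrier_mat m k" "i < m" "j < k"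
  shows "(antidiag m * A) $$ (i, j) = A $$ (m - 1 - i, j)"
proof -
  have "(antidiag m * A) $$ (i, j) = (\<Sum>c<m. antidiag m $$ (i, c) * A $$ (c, j))"
    using assms by (intro times_mat_entry) auto
  also have "\<dots> = antidiag m $$ (i, m - 1 - i) * A $$ (m - 1 - i, j)"
    using assms by (intro sum_single) (auto simp: antidiag_entry)
  finally show ?thesis using assms by (simp add: antidiag_entry)
qed

lemma antidiag_mult_right_entry:
  assumes "A \<in> carrier_mat k m" "i < k" "j < m"
  shows "(A * antidiag m) $$ (i, j) = A $$ (i, m - 1 - j)"
proof -
  have "(A * antidiag m) $$ (i, j) = (\<Sum>c<m. A $$ (i, c) * antidiag m $$ (c, j))"
    using assms by (intro times_mat_entry) auto
  also have "\<dots> = A $$ (i, m - 1 - j) * antidiag m $$ (m - 1 - j, j)"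
    using assms by (intro sum_single) (auto simp: antidiag_entry)
  finally show ?thesis using assms by (simp add: antidiag_entry)
qed

lemma antidiag_square: "antidiag m * antidiag m = 1\<^sub>m m"
  by (rule eq_matI) (auto simp: antidiag_mult_left_entry[OF antidiag_carrier] antidiag_entry
      simp del: index_mult_mat(1))

lemma orthogonal_entry:
  assumes "A \<in> carrier_mat m m" "i < m" "j < m"
  shows "(transpose_mat A * antidiag m * A) $$ (i, j) = (\<Sum>c<m. A $$ (c, i) * A $$ (m - 1 - c, j))"
proof -
  have "transpose_mat A * antidiag m * A = transpose_mat A * (antidiag m * A)"
    using assms by (intro assoc_mult_mat[of _ m m _ m _ m]) auto
  moreover have "(transpose_mat A * (antidiag m * A)) $$ (i, j)
      = (\<Sum>c<m. transpose_mat A $$ (i, c) * (antidiag m * A) $$ (c, j))"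
    using assms by (intro times_mat_entry mult_carrier_mat[of _ m m]) auto
  ultimately show ?thesis
    using assms by (auto simp: antidiag_mult_left_entry[OF assms(1)] simp del: index_mult_mat(1)
        intro!: sum.cong)
qed

lemma carrier_GL_det: "A \<in> carrier (GL n) \<longleftrightarrow> A \<in> carrier_mat n n \<and> det A \<noteq> 0"
  for A :: "'a::field mat"
proof
  assume "A \<in> carrier (GL n)"
  then obtain B where AB: "A \<in> carrier_mat n n" "B \<in> carrier_mat n n" "A * B = 1\<^sub>m n"
    by (auto simp: carrier_GL_iff)
  then have "det A * det B = 1" using det_mult[OF AB(1,2)] by simp
  then show "A \<in> carrier_mat n n \<and> det A \<noteq> 0" using AB(1) by auto
next
  assume A: "A \<in> carrier_mat n n \<and> det A \<noteq> 0"
  then have "A \<in> Units (ring_mat TYPE('a) n n)" by (intro det_non_zero_imp_unit) auto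
  then show "A \<in> carrier (GL n)" using A by (auto simp: carrier_GL_iff Units_def ring_mat_def)
qed

lemma carrier_SO_iff: "A \<in> carrier (SO m) \<longleftrightarrow>
    A \<in> carrier_mat m m \<and> det A = 1 \<and> transpose_mat A * antidiag m * A = antidiag m"
  by (auto simp: SO_def carrier_GL_det)

lemma mult_GL [simp]: "x \<otimes>\<^bsub>GL n\<^esub> y = x * y" and one_GL [simp]: "\<one>\<^bsub>GL n\<^esub> = 1\<^sub>m n"
  by (simp_all add: GL_def)

lemma mult_SO [simp]: "x \<otimes>\<^bsub>SO n\<^esub> y = x * y" and one_SO [simp]: "\<one>\<^bsub>SO n\<^esub> = 1\<^sub>m n"
  by (simp_all add: SO_def GL_def)

lemma GL_carrier: "A \<in> carrier (GL n) \<Longrightarrow> A \<in> carrier_mat n n"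
  by (simp add: GL_def)

lemma SO_carrier: "A \<in> carrier (SO n) \<Longrightarrow> A \<in> carrier_mat n n"
  by (simp add: carrier_SO_iff)

lemma SO_mult: "A \<in> carrier (SO m) \<Longrightarrow> B \<in> carrier (SO m) \<Longrightarrow> A * B \<in> carrier (SO m)"
  using group.subgroup_self[OF group_SO] monoid.m_closed[OF group.is_monoid[OF group_SO]] by fastforce

lemma SO_one: "1\<^sub>m m \<in> carrier (SO m)"
  using monoid.one_closed[OF group.is_monoid[OF group_SO]] by fastforce

lemma SO_inv:
  assumes "A \<in> carrier (SO m)"
  shows "inv\<^bsub>SO m\<^esub> A \<in> carrier (SO m)" "inv\<^bsub>SO m\<^esub> A * A = 1\<^sub>m m" "A * inv\<^bsub>SO m\<^esub> A = 1\<^sub>m m"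
  using group.inv_closed[OF group_SO assms] group.l_inv[OF group_SO assms]
    group.r_inv[OF group_SO assms] by simp_all

lemma GL_mult: "A \<in> carrier (GL m) \<Longrightarrow> B \<in> carrier (GL m) \<Longrightarrow> A * B \<in> carrier (GL m)"
  using monoid.m_closed[OF group.is_monoid[OF group_GL]] by fastforce

lemma GL_one: "1\<^sub>m m \<in> carrier (GL m)"
  using monoid.one_closed[OF group.is_monoid[OF group_GL]] by fastforce

lemma GL_inv:
  assumes "A \<in> carrier (GL m)"
  shows "inv\<^bsub>GL m\<^esub> A \<in> carrier (GL m)" "inv\<^bsub>GL m\<^esub> A * A = 1\<^sub>m m" "A * inv\<^bsub>GL m\<^esub> A = 1\<^sub>m m"
  using group.inv_closed[OF group_GL assms] group.l_inv[OF group_GL assms]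
    group.r_inv[OF group_GL assms] by simp_all

text \<open>Applied to reflections, whose determinant is \<open>-1\<close>.\<close>

lemma conj_involution_SO:
  assumes g: "g \<in> carrier (SO m)" and k: "k \<in> carrier_mat m m"
    and kk: "k * k = 1\<^sub>m m" and kJ: "transpose_mat k * antidiag m * k = antidiag m"
  shows "k * g * k \<in> carrier (SO m)"
proof -
  have gc: "g \<in> carrier_mat m m" using g by (rule SO_carrier)
  note [simp] = assoc_mult_mat[of _ m m _ m _ m] mult_carrier_mat[of _ m m _ m]
  have "det (k * g * k) = det (k * k) * det g"
    using gc k by (simp add: det_mult[of _ m] del: assoc_mult_mat)
  then have det: "det (k * g * k) = 1" using kk g by (simp add: carrier_SO_iff)
  have "transpose_mat (k * g * k) * antidiag m * (k * g * k)
      = transpose_mat k * (transpose_mat g * (transpose_mat k * antidiag m * k) * g) * k"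
    using gc k by (simp add: transpose_mult[of _ m m _ m])
  also have "\<dots> = antidiag m" using g kJ by (simp only: carrier_SO_iff)
  finally show ?thesis using det gc k by (simp add: carrier_SO_iff)
qed

section \<open>Unipotent groups\<close>

lemma finite_carrier_mat: "finite (carrier_mat n m :: 'a::finite mat set)"
proof (rule finite_surj)
  show "finite (({..<n} \<times> {..<m}) \<rightarrow>\<^sub>E (UNIV :: 'a set))" by (simp add: finite_PiE)
  show "carrier_mat n m \<subseteq> mat n m ` (({..<n} \<times> {..<m}) \<rightarrow>\<^sub>E (UNIV :: 'a set))"
  proof
    fix A :: "'a mat" assume A: "A \<in> carrier_mat n m"
    then have "A = mat n m (restrict (\<lambda>p. A $$ p) ({..<n} \<times> {..<m}))"
      by (intro eq_matI) auto
    moreover have "restrict (\<lambda>p. A $$ p) ({..<n} \<times> {..<m}) \<in> ({..<n} \<times> {..<m}) \<rightarrow>\<^sub>E (UNIV :: 'a set)"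
      by auto
    ultimately show "A \<in> mat n m ` (({..<n} \<times> {..<m}) \<rightarrow>\<^sub>E (UNIV :: 'a set))"
      by (rule image_eqI)
  qed
qed

text \<open>Finiteness of the field replaces a computation of inverses of triangular matrices.\<close>

lemma finite_closed_imp_subgroup:
  assumes "group G" "H \<subseteq> carrier G" "finite H" "\<one>\<^bsub>G\<^esub> \<in> H"
    and mult: "\<And>x y. x \<in> H \<Longrightarrow> y \<in> H \<Longrightarrow> x \<otimes>\<^bsub>G\<^esub> y \<in> H"
  shows "subgroup H G"
proof -
  interpret group G by fact
  show ?thesis
  proof (rule subgroupI)
    fix a assume a: "a \<in> H"
    have "inj_on (\<lambda>x. a \<otimes>\<^bsub>G\<^esub> x) H" using a assms(2) by (intro inj_onI) (metis Units_eq Units_l_cancel subsetD)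
    moreover have "(\<lambda>x. a \<otimes>\<^bsub>G\<^esub> x) ` H \<subseteq> H" using a mult by auto
    ultimately have "(\<lambda>x. a \<otimes>\<^bsub>G\<^esub> x) ` H = H" using assms(3) by (simp add: endo_inj_surj)
    then obtain b where "b \<in> H" "a \<otimes>\<^bsub>G\<^esub> b = \<one>\<^bsub>G\<^esub>" using assms(4) by (metis imageE)
    then show "inv\<^bsub>G\<^esub> a \<in> H"
      using a assms(2) inv_equality inv_comm by (metis subsetD)
  qed (use assms in auto)
qed

lemma upper_unipotent_entry:
  assumes "u \<in> upper_unipotent m" "i < m" "j < m" "j \<le> i"
  shows "u $$ (i, j) = (if i = j then 1 else 0)"
  using assms by (auto simp: upper_unipotent_def)

lemma upper_unipotentI:
  assumes "u \<in> carrier_mat m m"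
    and "\<And>i j. i < m \<Longrightarrow> j \<le> i \<Longrightarrow> u $$ (i, j) = (if i = j then 1 else 0)"
  shows "u \<in> upper_unipotent m"
  using assms by (auto simp: upper_unipotent_def)

lemma upper_unipotent_one: "1\<^sub>m m \<in> upper_unipotent m"
  by (rule upper_unipotentI) auto

lemma upper_unipotent_mult_entry:
  assumes u: "u \<in> upper_unipotent m" and v: "v \<in> upper_unipotent m" and "i < m" "j < m"
  shows "(u * v) $$ (i, j) = (\<Sum>c\<in>{i..j}. u $$ (i, c) * v $$ (c, j))"
proof -
  have "(u * v) $$ (i, j) = (\<Sum>c<m. u $$ (i, c) * v $$ (c, j))"
    using assms by (intro times_mat_entry) (auto simp: upper_unipotent_def)
  also have "\<dots> = (\<Sum>c\<in>{i..j}. u $$ (i, c) * v $$ (c, j))"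
    using assms upper_unipotent_entry[OF u] upper_unipotent_entry[OF v]
    by (intro sum.mono_neutral_right) (auto simp: not_le)
  finally show ?thesis .
qed

lemma upper_unipotent_mult:
  assumes u: "u \<in> upper_unipotent m" and v: "v \<in> upper_unipotent m"
  shows "u * v \<in> upper_unipotent m"
proof (rule upper_unipotentI)
  show "u * v \<in> carrier_mat m m" using assms by (auto simp: upper_unipotent_def)
  fix i j assume ij: "i < m" "j \<le> i"
  have "{i..j} = (if i = j then {i} else {})" using ij by auto
  then show "(u * v) $$ (i, j) = (if i = j then 1 else 0)"
    using ij upper_unipotent_entry[OF u, of i i] upper_unipotent_entry[OF v, of i i]
    by (subst upper_unipotent_mult_entry[OF u v]) auto
qed

lemma superdiag_mult:
  assumes u: "u \<in> upper_unipotent m" and v: "v \<in> upper_unipotent m" and "i + 1 < m"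
  shows "(u * v) $$ (i, i + 1) = u $$ (i, i + 1) + v $$ (i, i + 1)"
proof -
  have "{i..i + 1} = {i, i + 1}" by auto
  then show ?thesis
    using assms upper_unipotent_entry[OF u, of i i] upper_unipotent_entry[OF v, of "i+1" "i+1"]
    by (subst upper_unipotent_mult_entry[OF u v]) auto
qed

lemma det_upper_unipotent: "u \<in> upper_unipotent m \<Longrightarrow> det u = 1"
  by (subst det_upper_triangular[of u m])
    (auto simp: upper_unipotent_def prod_list_diag_prod)

lemma U_GL_eq: "(U_GL n :: 'a::field mat set) = upper_unipotent n"
  using det_upper_unipotent[where 'a='a] by (force simp: U_GL_def carrier_GL_det upper_unipotent_def)

lemma subgroup_U_GL: "subgroup (U_GL n) (GL n :: 'a::{field,finite} mat monoid)"
proof (rule finite_closed_imp_subgroup[OF group_GL])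
  show "finite (U_GL n :: 'a mat set)"
    by (rule finite_subset[OF _ finite_carrier_mat[of n n]]) (auto simp: U_GL_def GL_carrier)
qed (auto simp: U_GL_def upper_unipotent_one upper_unipotent_mult GL_mult GL_one)

lemma subgroup_U_SO: "subgroup (U_SO n) (SO n :: 'a::{field,finite} mat monoid)"
proof (rule finite_closed_imp_subgroup[OF group_SO])
  show "finite (U_SO n :: 'a mat set)"
    by (rule finite_subset[OF _ finite_carrier_mat[of n n]]) (auto simp: U_SO_def SO_carrier)
qed (auto simp: U_SO_def upper_unipotent_one upper_unipotent_mult SO_mult SO_one)

lemma U_SO_mult: "u \<in> U_SO m \<Longrightarrow> v \<in> U_SO m \<Longrightarrow> u * v \<in> U_SO m"
  by (auto simp: U_SO_def upper_unipotent_mult SO_mult)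

lemma U_SO_carrier: "u \<in> U_SO m \<Longrightarrow> u \<in> carrier_mat m m"
  by (auto simp: U_SO_def SO_carrier)

lemma superdiag_inv:
  fixes u :: "'a::{field,finite} mat"
  assumes "u \<in> U_GL n" "i + 1 < n"
  shows "(inv\<^bsub>GL n\<^esub> u) $$ (i, i + 1) = - u $$ (i, i + 1)"
proof -
  have v: "inv\<^bsub>GL n\<^esub> u \<in> U_GL n" using subgroup.m_inv_closed[OF subgroup_U_GL assms(1)] .
  have "u * inv\<^bsub>GL n\<^esub> u = 1\<^sub>m n" using assms(1) GL_inv(3)[of u n] by (auto simp: U_GL_def)
  then have "u $$ (i, i + 1) + (inv\<^bsub>GL n\<^esub> u) $$ (i, i + 1) = 0"
    using superdiag_mult[of u n "inv\<^bsub>GL n\<^esub> u" i] assms v by (simp add: U_GL_eq)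
  then show ?thesis by (simp add: eq_neg_iff_add_eq_0 add.commute)
qed

declare diag_block_mat.simps [simp del]

section \<open>Block diagonal and block antidiagonal matrices\<close>

text \<open>
  The given matrices are block diagonal or block antidiagonal for a partition
  \<open>p + k + p\<close>: the Levi subgroups, \<open>outer_elt\<close>, \<open>M_mat\<close> and \<open>w_ln\<close> are of the first kind, \<open>w_n\<close> and the
  form \<open>antidiag\<close> itself are of the second.  Identities between them reduce to identities of blocks.
\<close>

abbreviation bdiag :: "'a::zero mat \<Rightarrow> 'a mat \<Rightarrow> 'a mat \<Rightarrow> 'a mat" where
  "bdiag A C B \<equiv> diag_block_mat [A, C, B]"

definition bantidiag :: "nat \<Rightarrow> nat \<Rightarrow> 'a::zero mat \<Rightarrow> 'a mat \<Rightarrow> 'a mat \<Rightarrow> 'a mat" where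
  "bantidiag p k X K Y = four_block_mat (0\<^sub>m p (p+k)) X
     (four_block_mat (0\<^sub>m k p) K Y (0\<^sub>m p k)) (0\<^sub>m (p+k) p)"

lemma bdiag_unfold_right:
  assumes "A \<in> carrier_mat p p" "C \<in> carrier_mat k k" "B \<in> carrier_mat q q"
  shows "bdiag A C B = four_block_mat A (0\<^sub>m p (k+q)) (0\<^sub>m (k+q) p)
           (four_block_mat C (0\<^sub>m k q) (0\<^sub>m q k) B)"
proof -
  have "diag_block_mat [C, B] = four_block_mat C (0\<^sub>m k q) (0\<^sub>m q k) B"
    using assms unfolding diag_block_mat.simps(2)[of C] diag_block_mat_singleton Let_def by simp
  then show ?thesis
    using assms unfolding diag_block_mat.simps(2)[of A] Let_def by simp
qed

lemma bdiag_carrier [simp]: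
  assumes "A \<in> carrier_mat p p" "C \<in> carrier_mat k k" "B \<in> carrier_mat q q" "m = p + k + q"
  shows "bdiag A C B \<in> carrier_mat m m"
  using assms(1-3) unfolding assms(4) by (intro carrier_matI) (simp_all add: dim_diag_block_mat)

lemma bdiag_entry:
  assumes "A \<in> carrier_mat p p" "C \<in> carrier_mat k k" "B \<in> carrier_mat q q"
    and "i < p + k + q" "j < p + k + q"
  shows "bdiag A C B $$ (i, j) =
    (if i < p \<and> j < p then A $$ (i, j)
     else if p \<le> i \<and> i < p + k \<and> p \<le> j \<and> j < p + k then C $$ (i - p, j - p)
     else if p + k \<le> i \<and> p + k \<le> j then B $$ (i - p - k, j - p - k) else 0)"
  using assms unfolding bdiag_unfold_right[OF assms(1-3)] by auto

lemma bdiag_unfold_left: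
  assumes "A \<in> carrier_mat p p" "C \<in> carrier_mat k k" "B \<in> carrier_mat q q"
  shows "bdiag A C B = four_block_mat (four_block_mat A (0\<^sub>m p k) (0\<^sub>m k p) C)
           (0\<^sub>m (p+k) q) (0\<^sub>m q (p+k)) B"
proof (rule eq_matI)
  fix i j
  assume "i < dim_row (four_block_mat (four_block_mat A (0\<^sub>m p k) (0\<^sub>m k p) C) (0\<^sub>m (p+k) q) (0\<^sub>m q (p+k)) B)"
    "j < dim_col (four_block_mat (four_block_mat A (0\<^sub>m p k) (0\<^sub>m k p) C) (0\<^sub>m (p+k) q) (0\<^sub>m q (p+k)) B)"
  then have ij: "i < p + k + q" "j < p + k + q" using assms by auto
  show "bdiag A C B $$ (i, j) =
      four_block_mat (four_block_mat A (0\<^sub>m p k) (0\<^sub>m k p) C) (0\<^sub>m (p+k) q) (0\<^sub>m q (p+k)) B $$ (i, j)"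
    unfolding bdiag_entry[OF assms ij] using ij assms by (auto simp: not_less)
qed (use assms in \<open>auto simp: dim_diag_block_mat\<close>)

lemma diag2_mult:
  assumes "A \<in> carrier_mat p p" "A' \<in> carrier_mat p p" "B \<in> carrier_mat q q" "B' \<in> carrier_mat q q"
  shows "four_block_mat A (0\<^sub>m p q) (0\<^sub>m q p) B * four_block_mat A' (0\<^sub>m p q) (0\<^sub>m q p) B'
    = four_block_mat (A * A') (0\<^sub>m p q) (0\<^sub>m q p) (B * B')"
  using assms by (subst mult_four_block_mat[of _ p p _ q _ q _ _ p _ q]) auto

lemma bdiag_mult:
  assumes "A \<in> carrier_mat p p" "C \<in> carrier_mat k k" "B \<in> carrier_mat q q"
    and "A' \<in> carrier_mat p p" "C' \<in> carrier_mat k k" "B' \<in> carrier_mat q q"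
  shows "bdiag A C B * bdiag A' C' B' = bdiag (A * A') (C * C') (B * B')"
proof -
  have c: "A * A' \<in> carrier_mat p p" "C * C' \<in> carrier_mat k k" "B * B' \<in> carrier_mat q q"
    using assms by auto
  show ?thesis
    unfolding bdiag_unfold_right[OF assms(1-3)] bdiag_unfold_right[OF assms(4-6)]
      bdiag_unfold_right[OF c]
    using assms by (simp add: diag2_mult)
qed

lemma bdiag_one: "bdiag (1\<^sub>m p) (1\<^sub>m k) (1\<^sub>m q) = 1\<^sub>m (p + k + q)"
  by (rule eq_matI)
    (auto simp: bdiag_entry[OF one_carrier_mat one_carrier_mat one_carrier_mat] dim_diag_block_mat)

lemma transpose_bdiag:
  assumes "A \<in> carrier_mat p p" "C \<in> carrier_mat k k" "B \<in> carrier_mat q q"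
  shows "transpose_mat (bdiag A C B) = bdiag (transpose_mat A) (transpose_mat C) (transpose_mat B)"
proof -
  have c: "transpose_mat A \<in> carrier_mat p p" "transpose_mat C \<in> carrier_mat k k"
    "transpose_mat B \<in> carrier_mat q q"
    using assms by auto
  show ?thesis
    unfolding bdiag_unfold_right[OF assms] bdiag_unfold_right[OF c] using assms
    by (simp add: transpose_four_block_mat[of _ p p _ "k+q" _ "k+q"]
        transpose_four_block_mat[of _ k k _ q _ q])
qed

lemma det_bdiag:
  fixes A :: "'a::idom mat"
  assumes "A \<in> carrier_mat p p" "C \<in> carrier_mat k k" "B \<in> carrier_mat q q"
  shows "det (bdiag A C B) = det A * det C * det B"
  using assms unfolding bdiag_unfold_right[OF assms]
  by (subst det_four_block_mat_upper_right_zero[of _ p _ "k+q"], simp_all)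
    (subst det_four_block_mat_upper_right_zero[of _ k _ q], simp_all)

text \<open>With \<open>m = l-n-1\<close> this passes from the partition \<open>n + 2 + n\<close> used inside \<open>embed\<close> to the partition
  \<open>(l-1) + 2 + (l-1)\<close> of the ambient space.\<close>

lemma bdiag_frame:
  assumes "A \<in> carrier_mat p p" "C \<in> carrier_mat k k" "B \<in> carrier_mat p p"
  shows "bdiag (1\<^sub>m m) (bdiag A C B) (1\<^sub>m m)
    = bdiag (four_block_mat (1\<^sub>m m) (0\<^sub>m m p) (0\<^sub>m p m) A) C
        (four_block_mat B (0\<^sub>m p m) (0\<^sub>m m p) (1\<^sub>m m))"
proof -
  define FB where "FB = (\<lambda>(X::'a mat) Y. four_block_mat X (0\<^sub>m (dim_row X) (dim_col Y))
    (0\<^sub>m (dim_row Y) (dim_col X)) Y)"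
  have three: "bdiag X Y Z = FB X (FB Y Z)" for X Y Z
    by (simp only: diag_block_mat.simps(2)[of X] diag_block_mat.simps(2)[of Y]
        diag_block_mat_singleton Let_def FB_def)
  have assoc: "FB X (FB Y Z) = FB (FB X Y) Z" for X Y Z
    unfolding FB_def by (rule assoc_four_block_mat)
  have "bdiag (1\<^sub>m m) (bdiag A C B) (1\<^sub>m m) = bdiag (FB (1\<^sub>m m) A) C (FB B (1\<^sub>m m))"
    by (simp only: three assoc)
  then show ?thesis using assms by (simp add: FB_def del: diag_block_mat.simps)
qed

lemma bantidiag_carrier [simp]:
  assumes "X \<in> carrier_mat p p" "K \<in> carrier_mat k k" "Y \<in> carrier_mat p p" "m = p + k + p"
  shows "bantidiag p k X K Y \<in> carrier_mat m m"
  using assms(1-3) unfolding assms(4) by (intro carrier_matI) (simp_all add: bantidiag_def)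

lemma bdiag_mult_bantidiag:
  assumes "A \<in> carrier_mat p p" "C \<in> carrier_mat k k" "B \<in> carrier_mat p p"
    and "X \<in> carrier_mat p p" "K \<in> carrier_mat k k" "Y \<in> carrier_mat p p"
  shows "bdiag A C B * bantidiag p k X K Y = bantidiag p k (A * X) (C * K) (B * Y)"
proof -
  have "four_block_mat C (0\<^sub>m k p) (0\<^sub>m p k) B * four_block_mat (0\<^sub>m k p) K Y (0\<^sub>m p k)
      = four_block_mat (0\<^sub>m k p) (C * K) (B * Y) (0\<^sub>m p k)"
    using assms by (subst mult_four_block_mat[of _ k k _ p _ p _ _ p _ k]) auto
  moreover have "four_block_mat C (0\<^sub>m k p) (0\<^sub>m p k) B \<in> carrier_mat (p+k) (p+k)"
      "four_block_mat (0\<^sub>m k p) K Y (0\<^sub>m p k) \<in> carrier_mat (p+k) (p+k)"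
      "four_block_mat (0\<^sub>m k p) (C * K) (B * Y) (0\<^sub>m p k) \<in> carrier_mat (p+k) (p+k)"
    using assms by (auto intro!: carrier_matI)
  ultimately show ?thesis
    unfolding bdiag_unfold_right[OF assms(1-3)] bantidiag_def add.commute[of k p] using assms
    by (subst mult_four_block_mat[of _ p p _ "p+k" _ "p+k" _ _ "p+k" _ p]) (simp_all add: add.commute[of k p])
qed

lemma bantidiag_mult_bdiag:
  assumes "A \<in> carrier_mat p p" "C \<in> carrier_mat k k" "B \<in> carrier_mat p p"
    and "X \<in> carrier_mat p p" "K \<in> carrier_mat k k" "Y \<in> carrier_mat p p"
  shows "bantidiag p k X K Y * bdiag A C B = bantidiag p k (X * B) (K * C) (Y * A)"
proof -
  have "four_block_mat (0\<^sub>m k p) K Y (0\<^sub>m p k) * four_block_mat A (0\<^sub>m p k) (0\<^sub>m k p) C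
      = four_block_mat (0\<^sub>m k p) (K * C) (Y * A) (0\<^sub>m p k)"
    using assms by (subst mult_four_block_mat[of _ k p _ k _ p _ _ p _ k]) auto
  moreover have "four_block_mat A (0\<^sub>m p k) (0\<^sub>m k p) C \<in> carrier_mat (p+k) (p+k)"
      "four_block_mat (0\<^sub>m k p) K Y (0\<^sub>m p k) \<in> carrier_mat (p+k) (p+k)"
      "four_block_mat (0\<^sub>m k p) (K * C) (Y * A) (0\<^sub>m p k) \<in> carrier_mat (p+k) (p+k)"
    using assms by (auto intro!: carrier_matI)
  ultimately show ?thesis
    unfolding bdiag_unfold_left[OF assms(1-3)] bantidiag_def using assms
    by (subst mult_four_block_mat[of _ p "p+k" _ p _ "p+k" _ _ "p+k" _ p]) (simp_all add: add.commute[of k p])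
qed

lemma antidiag_eq_bantidiag:
  "antidiag (p + k + p) = bantidiag p k (antidiag p) (antidiag k) (antidiag p)"
proof (rule eq_matI)
  let ?R = "bantidiag p k (antidiag p) (antidiag k) (antidiag p)"
  fix i j assume "i < dim_row ?R" "j < dim_col ?R"
  then have ij: "i < p + k + p" "j < p + k + p" by (simp_all add: bantidiag_def)
  consider "i < p" "j < p + k" | "i < p" "p + k \<le> j" | "p \<le> i" "p + k \<le> j"
    | "p \<le> i" "i < p + k" "j < p" | "p \<le> i" "i < p + k" "p \<le> j" "j < p + k"
    | "p + k \<le> i" "j < p" | "p + k \<le> i" "p \<le> j" "j < p + k"
    using ij by linarith
  then show "antidiag (p + k + p) $$ (i, j) = ?R $$ (i, j)"
    using ij by cases (simp_all add: bantidiag_def antidiag_def, (simp add: algebra_simps | arith)+)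
qed (simp_all add: bantidiag_def)

lemma bdiag_preserves_form:
  assumes "A \<in> carrier_mat p p" "C \<in> carrier_mat k k" "B \<in> carrier_mat p p" "K \<in> carrier_mat k k"
    and A: "transpose_mat A * antidiag p * B = antidiag p"
  shows "transpose_mat (bdiag A C B) * bantidiag p k (antidiag p) K (antidiag p) * bdiag A C B
    = bantidiag p k (antidiag p) (transpose_mat C * K * C) (antidiag p)"
proof -
  have "transpose_mat (transpose_mat A * antidiag p * B) = transpose_mat B * (antidiag p * A)"
    using assms(1,3) by (simp add: transpose_mult[of _ p p _ p])
  then have "transpose_mat B * antidiag p * A = antidiag p"
    using A assms(1,3) by (simp add: assoc_mult_mat[of _ p p _ p _ p])
  then show ?thesis
    using assms by (simp add: transpose_bdiag bdiag_mult_bantidiag bantidiag_mult_bdiag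
        mult_carrier_mat[of _ p p _ p] mult_carrier_mat[of _ k k _ k])
qed

lemma bdiag_one_preserves_form:
  assumes "C \<in> carrier_mat k k" "K \<in> carrier_mat k k"
  shows "transpose_mat (bdiag (1\<^sub>m p) C (1\<^sub>m p)) * bantidiag p k (antidiag p) K (antidiag p) * bdiag (1\<^sub>m p) C (1\<^sub>m p)
    = bantidiag p k (antidiag p) (transpose_mat C * K * C) (antidiag p)"
  using assms by (intro bdiag_preserves_form) (auto simp: left_mult_one_mat[of _ p p] right_mult_one_mat[of _ p p])

lemma bdiag_in_SO:
  assumes "A \<in> carrier_mat p p" "C \<in> carrier_mat k k" "B \<in> carrier_mat p p" "m = p + k + p"
    and "transpose_mat A * antidiag p * B = antidiag p" "transpose_mat C * antidiag k * C = antidiag k"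
    and "det A * det C * det B = 1"
  shows "bdiag A C B \<in> carrier (SO m)"
  using bdiag_preserves_form[OF assms(1-3) antidiag_carrier assms(5)] assms
  by (simp add: carrier_SO_iff antidiag_eq_bantidiag det_bdiag)

text \<open>Dimensions stay in the forms \<open>2*n+1\<close> and \<open>2*n+2\<close> in which the carrier premises are stated.\<close>

declare One_nat_def [simp del] add_2_eq_Suc [simp del] add_2_eq_Suc' [simp del]

section \<open>The Siegel parabolic of the odd orthogonal group\<close>

lemma det_antidiag_square: "det (antidiag n :: 'a::field mat) * det (antidiag n :: 'a mat) = (1 :: 'a)"
  using det_mult[of "antidiag n :: 'a mat" n "antidiag n"] by (simp add: antidiag_square)

lemma star_carrier [simp]: "a \<in> carrier (GL n) \<Longrightarrow> star n a \<in> carrier_mat n n"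
  using GL_carrier[OF GL_inv(1), of a n]
  by (auto simp: star_def intro!: mult_carrier_mat[of _ n n _ n])

lemma star_entry:
  assumes "a \<in> carrier (GL n)" "i < n" "j < n"
  shows "star n a $$ (i, j) = (inv\<^bsub>GL n\<^esub> a) $$ (n - 1 - j, n - 1 - i)"
proof -
  have b: "inv\<^bsub>GL n\<^esub> a \<in> carrier_mat n n" using assms by (intro GL_carrier GL_inv)
  then have c: "antidiag n * transpose_mat (inv\<^bsub>GL n\<^esub> a) \<in> carrier_mat n n"
    by (intro mult_carrier_mat[of _ n n _ n]) auto
  show ?thesis
    using assms b unfolding star_def antidiag_mult_right_entry[OF c assms(2,3)]
    by (subst antidiag_mult_left_entry[of _ n n]) auto
qed

lemma star_mult:
  assumes "a \<in> carrier (GL n)" "b \<in> carrier (GL n)"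
  shows "star n (a * b) = star n a * star n b"
proof -
  let ?a = "transpose_mat (inv\<^bsub>GL n\<^esub> a)" and ?b = "transpose_mat (inv\<^bsub>GL n\<^esub> b)"
  have i: "inv\<^bsub>GL n\<^esub> a \<in> carrier_mat n n" "inv\<^bsub>GL n\<^esub> b \<in> carrier_mat n n"
    using assms by (auto intro: GL_carrier GL_inv)
  then have c: "?a \<in> carrier_mat n n" "?b \<in> carrier_mat n n" by auto
  have "inv\<^bsub>GL n\<^esub> (a * b) = inv\<^bsub>GL n\<^esub> b * inv\<^bsub>GL n\<^esub> a"
    using group.inv_mult_group[OF group_GL assms] by simp
  then have "transpose_mat (inv\<^bsub>GL n\<^esub> (a * b)) = ?a * ?b"
    using transpose_mult[OF i(2,1)] by simp
  then have "star n (a * b) = antidiag n * (?a * ?b) * antidiag n" by (simp add: star_def)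
  also have "\<dots> = antidiag n * (?a * (1\<^sub>m n * ?b)) * antidiag n" using c by simp
  also have "\<dots> = antidiag n * (?a * ((antidiag n * antidiag n) * ?b)) * antidiag n"
    by (simp only: antidiag_square)
  also have "\<dots> = star n a * star n b"
    using c by (simp add: star_def assoc_mult_mat[of _ n n _ n _ n] mult_carrier_mat[of _ n n _ n])
  finally show ?thesis .
qed

lemma star_one: "star n (1\<^sub>m n) = (1\<^sub>m n :: 'a::field mat)"
proof -
  have "inv\<^bsub>GL n\<^esub> (1\<^sub>m n) = (1\<^sub>m n :: 'a mat)"
    using monoid.inv_one[OF group.is_monoid[OF group_GL], of n] by simp
  then show ?thesis by (simp add: star_def right_mult_one_mat[of _ n n] antidiag_square)
qed

lemma star_in_GL:
  assumes "a \<in> carrier (GL n)"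
  shows "star n a \<in> carrier (GL n)"
proof -
  have "star n a * star n (inv\<^bsub>GL n\<^esub> a) = 1\<^sub>m n" "star n (inv\<^bsub>GL n\<^esub> a) * star n a = 1\<^sub>m n"
    using star_mult[OF assms GL_inv(1)[OF assms]] star_mult[OF GL_inv(1)[OF assms] assms]
    unfolding GL_inv[OF assms] star_one by simp_all
  then show ?thesis
    using star_carrier[OF assms] star_carrier[OF GL_inv(1)[OF assms]] unfolding carrier_GL_iff by blast
qed

lemma inv_star:
  assumes "a \<in> carrier (GL n)"
  shows "inv\<^bsub>GL n\<^esub> (star n a) = star n (inv\<^bsub>GL n\<^esub> a)"
  using star_mult[OF GL_inv(1)[OF assms] assms] GL_inv[OF assms] star_in_GL assms
  by (intro group.inv_equality[OF group_GL]) (auto simp: star_one)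

lemma star_star:
  assumes "a \<in> carrier (GL n)"
  shows "star n (star n a) = a"
proof (rule eq_matI)
  have ac: "a \<in> carrier_mat n n" using assms by (rule GL_carrier)
  fix i j assume "i < dim_row a" "j < dim_col a"
  then have ij: "i < n" "j < n" using ac by auto
  have "star n (star n a) $$ (i, j) = (inv\<^bsub>GL n\<^esub> (inv\<^bsub>GL n\<^esub> a)) $$ (i, j)"
    using ij assms by (simp add: star_entry star_in_GL inv_star GL_inv)
  then show "star n (star n a) $$ (i, j) = a $$ (i, j)"
    using group.inv_inv[OF group_GL assms] by simp
qed (use assms star_carrier[OF star_in_GL[OF assms]] GL_carrier[OF assms] in auto)

lemma U_GL_in_GL: "a \<in> U_GL n \<Longrightarrow> a \<in> carrier (GL n)"
  by (simp add: U_GL_def)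

lemma star_U_GL:
  fixes a :: "'a::{field,finite} mat"
  assumes "a \<in> U_GL n"
  shows "star n a \<in> U_GL n"
proof -
  have a: "a \<in> carrier (GL n)" using assms by (rule U_GL_in_GL)
  have b: "inv\<^bsub>GL n\<^esub> a \<in> upper_unipotent n"
    using subgroup.m_inv_closed[OF subgroup_U_GL assms] by (simp add: U_GL_eq)
  have "star n a \<in> upper_unipotent n"
  proof (rule upper_unipotentI)
    fix i j assume "i < n" "j \<le> i"
    then show "star n a $$ (i, j) = (if i = j then 1 else 0)"
      using upper_unipotent_entry[OF b, of "n - 1 - j" "n - 1 - i"]
      by (auto simp: star_entry[OF a])
  qed (use a in simp)
  then show ?thesis by (simp add: U_GL_eq)
qed

lemma levi_in_SO:
  assumes a: "a \<in> carrier (GL n)"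
  shows "levi n a \<in> carrier (SO (2*n+1))"
  unfolding levi_def
proof (rule bdiag_in_SO)
  let ?b = "inv\<^bsub>GL n\<^esub> a"
  have c: "a \<in> carrier_mat n n" "?b \<in> carrier_mat n n" using a by (auto intro: GL_carrier GL_inv)
  have ba: "transpose_mat a * transpose_mat ?b = 1\<^sub>m n"
    using GL_inv(2)[OF a] transpose_mult[OF c(2,1)] by simp
  have "transpose_mat a * antidiag n * star n a
      = transpose_mat a * (antidiag n * antidiag n) * transpose_mat ?b * antidiag n"
    using c by (simp add: star_def assoc_mult_mat[of _ n n _ n _ n] mult_carrier_mat[of _ n n _ n])
  also have "\<dots> = antidiag n" using c by (simp add: antidiag_square ba)
  finally show "transpose_mat a * antidiag n * star n a = antidiag n" .
  have "det a * det ?b = 1" using det_mult[OF c] GL_inv(3)[OF a] by simp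
  moreover have "det (star n a) = det (antidiag n :: 'a mat) * det ?b * det (antidiag n :: 'a mat)"
    using c by (simp add: star_def det_mult[of _ n] det_transpose mult_carrier_mat[of _ n n _ n])
  ultimately show "det a * det (1\<^sub>m 1) * det (star n a) = 1"
    using det_antidiag_square[of n, where 'a='a] by (simp add: ac_simps) (simp flip: mult.assoc)
qed (use a in \<open>auto simp: GL_carrier\<close>)

lemma levi_mult:
  assumes "a \<in> carrier (GL n)" "b \<in> carrier (GL n)"
  shows "levi n (a * b) = levi n a * levi n b"
  using assms GL_carrier[OF assms(1)] GL_carrier[OF assms(2)]
  by (simp add: levi_def star_mult bdiag_mult[of _ n _ 1 _ n])

lemma levi_one: "levi n (1\<^sub>m n) = 1\<^sub>m (2*n+1)"
proof -
  have "2*n+1 = n + 1 + n" by simp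
  then show ?thesis unfolding levi_def star_one by (simp only: bdiag_one)
qed

lemma levi_entry:
  assumes "a \<in> carrier (GL n)" "i < 2*n+1" "j < 2*n+1"
  shows "levi n a $$ (i, j) = (if i < n \<and> j < n then a $$ (i, j) else if i = n \<and> j = n then 1
     else if n < i \<and> n < j then star n a $$ (i - n - 1, j - n - 1) else 0)"
  unfolding levi_def
  using assms by (subst bdiag_entry[of _ n _ 1 _ n]) (auto simp: GL_carrier)

lemma levi_U_SO:
  fixes a :: "'a::{field,finite} mat"
  assumes a: "a \<in> U_GL n"
  shows "levi n a \<in> U_SO (2*n+1)"
proof -
  have aG: "a \<in> carrier (GL n)" using a by (rule U_GL_in_GL)
  have u: "a \<in> upper_unipotent n" "star n a \<in> upper_unipotent n"
    using a star_U_GL[OF a] by (auto simp: U_GL_eq)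
  have "levi n a \<in> upper_unipotent (2*n+1)"
  proof (rule upper_unipotentI)
    show "levi n a \<in> carrier_mat (2*n+1) (2*n+1)" using levi_in_SO[OF aG] by (rule SO_carrier)
    fix i j assume "i < 2*n+1" "j \<le> i"
    then show "levi n a $$ (i, j) = (if i = j then 1 else 0)"
      using upper_unipotent_entry[OF u(1), of i j]
        upper_unipotent_entry[OF u(2), of "i - n - 1" "j - n - 1"]
      by (auto simp: levi_entry[OF aG])
  qed
  then show ?thesis using levi_in_SO[OF aG] by (simp add: U_SO_def)
qed

definition top_left :: "nat \<Rightarrow> 'a mat \<Rightarrow> 'a mat" where
  "top_left n u = mat n n (\<lambda>ij. u $$ ij)"

lemma top_left_levi: "a \<in> carrier (GL n) \<Longrightarrow> top_left n (levi n a) = a"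
  using GL_carrier[of a n] by (intro eq_matI) (auto simp: top_left_def levi_entry)

lemma top_left_U_GL: "u \<in> U_SO (2*n+1) \<Longrightarrow> top_left n u \<in> U_GL n"
  unfolding U_GL_eq
  by (rule upper_unipotentI) (auto simp: top_left_def U_SO_def upper_unipotent_entry)

text \<open>On upper triangular matrices, passing to a leading block is multiplicative; this is what makes
  \<open>V_rad\<close> the kernel of a homomorphism \<open>U_SO \<rightarrow> U_GL\<close> that is split by \<open>levi\<close>.\<close>

lemma top_left_mult:
  assumes "u \<in> U_SO (2*n+1)" "v \<in> U_SO (2*n+1)"
  shows "top_left n (u * v) = top_left n u * top_left n v"
proof (rule eq_matI)
  have uv: "u \<in> upper_unipotent (2*n+1)" "v \<in> upper_unipotent (2*n+1)"
    using assms by (auto simp: U_SO_def)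
  have t: "top_left n u \<in> upper_unipotent n" "top_left n v \<in> upper_unipotent n"
    using assms top_left_U_GL by (auto simp flip: U_GL_eq)
  fix i j assume "i < dim_row (top_left n u * top_left n v)" "j < dim_col (top_left n u * top_left n v)"
  then have ij: "i < n" "j < n" by (auto simp: top_left_def)
  have "(u * v) $$ (i, j) = (\<Sum>c\<in>{i..j}. u $$ (i, c) * v $$ (c, j))"
    using ij by (intro upper_unipotent_mult_entry[OF uv]) auto
  also have "\<dots> = (top_left n u * top_left n v) $$ (i, j)"
    using ij by (subst upper_unipotent_mult_entry[OF t]) (auto simp: top_left_def intro!: sum.cong)
  finally show "top_left n (u * v) $$ (i, j) = (top_left n u * top_left n v) $$ (i, j)"
    using ij by (simp add: top_left_def)
qed (auto simp: top_left_def)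

text \<open>In the entry \<open>(m-1-i, j)\<close> of \<open>transpose_mat g * antidiag m * g = antidiag m\<close>, a unit column leaves
  a single term.  This is how the shape of the leading block of an element of \<open>V_rad\<close> determines the
  last rows.\<close>

lemma orthogonal_unit_row:
  assumes g: "g \<in> carrier (SO m)" and i: "i < m" and j: "j < m"
    and col: "\<And>c. c < m \<Longrightarrow> g $$ (c, m - 1 - i) = (if c = m - 1 - i then 1 else 0)"
  shows "g $$ (i, j) = (if i = j then 1 else 0)"
proof -
  let ?k = "m - 1 - i"
  have "(transpose_mat g * antidiag m * g) $$ (?k, j) = (\<Sum>c<m. g $$ (c, ?k) * g $$ (m - 1 - c, j))"
    using i j g by (intro orthogonal_entry) (auto simp: SO_carrier)
  also have "\<dots> = g $$ (?k, ?k) * g $$ (m - 1 - ?k, j)"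
    using i col by (intro sum_single) auto
  also have "\<dots> = g $$ (i, j)" using i col[of ?k] by simp
  finally have "g $$ (i, j) = antidiag m $$ (?k, j)" using g by (simp add: carrier_SO_iff)
  then show ?thesis using i j by (auto simp: antidiag_entry)
qed

lemma V_rad_eq: "V_rad n = {u \<in> U_SO (2*n+1). top_left n u = (1\<^sub>m n :: 'a::field mat)}"
proof (intro equalityI subsetI)
  fix u :: "'a mat" assume "u \<in> V_rad n"
  then obtain X y where u: "u \<in> carrier (SO (2*n+1))" "X \<in> carrier_mat n (n+1)" "y \<in> carrier_mat 1 n"
    "u = four_block_mat (1\<^sub>m n) X (0\<^sub>m (n+1) n) (four_block_mat (1\<^sub>m 1) y (0\<^sub>m n 1) (1\<^sub>m n))"
    by (auto simp: V_rad_def)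
  have "u \<in> upper_unipotent (2*n+1)"
  proof (rule upper_unipotentI)
    show "u \<in> carrier_mat (2*n+1) (2*n+1)" using u(1) by (rule SO_carrier)
    fix i j assume "i < 2*n+1" "j \<le> i"
    then show "u $$ (i, j) = (if i = j then 1 else 0)" using u(2,3) unfolding u(4) by auto
  qed
  moreover have "top_left n u = 1\<^sub>m n"
    using u(2,3) unfolding u(4) by (intro eq_matI) (auto simp: top_left_def)
  ultimately show "u \<in> {u \<in> U_SO (2*n+1). top_left n u = 1\<^sub>m n}" using u(1) by (simp add: U_SO_def)
next
  fix u :: "'a mat" assume "u \<in> {u \<in> U_SO (2*n+1). top_left n u = 1\<^sub>m n}"
  then have u: "u \<in> carrier (SO (2*n+1))" "u \<in> upper_unipotent (2*n+1)" "top_left n u = 1\<^sub>m n"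
    by (auto simp: U_SO_def)
  have tl: "u $$ (i, j) = (if i = j then 1 else 0)" if "i < n" "j < n" for i j
    using arg_cong[OF u(3), of "\<lambda>A. A $$ (i, j)"] that by (simp add: top_left_def)
  have col: "u $$ (c, j) = (if c = j then 1 else 0)" if "j < n" "c < 2*n+1" for c j
    using that tl[of c j] upper_unipotent_entry[OF u(2), of c j] by (cases "c < n") auto
  have row: "u $$ (i, j) = (if i = j then 1 else 0)" if "n < i" "i < 2*n+1" "j < 2*n+1" for i j
    using that by (subst orthogonal_unit_row[OF u(1)]) (auto simp: col)
  have "u = four_block_mat (1\<^sub>m n) (mat n (n+1) (\<lambda>(i, j). u $$ (i, j + n)))
      (0\<^sub>m (n+1) n) (four_block_mat (1\<^sub>m 1) (mat 1 n (\<lambda>(i, j). u $$ (n, n + 1 + j))) (0\<^sub>m n 1) (1\<^sub>m n))"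
    (is "u = ?R")
  proof (rule eq_matI)
    fix i j assume "i < dim_row ?R" "j < dim_col ?R"
    then have ij: "i < 2*n+1" "j < 2*n+1" by auto
    consider "j < n" | "n < i" "n \<le> j" | "i < n" "n \<le> j" | "i = n" "j = n" | "i = n" "n < j" by linarith
    then show "u $$ (i, j) = ?R $$ (i, j)"
      using ij by cases (auto simp: col row upper_unipotent_entry[OF u(2)])
  qed (use SO_carrier[OF u(1)] in auto)
  then have "\<exists>X\<in>carrier_mat n (n+1). \<exists>y\<in>carrier_mat 1 n. u = four_block_mat (1\<^sub>m n) X (0\<^sub>m (n+1) n)
      (four_block_mat (1\<^sub>m 1) y (0\<^sub>m n 1) (1\<^sub>m n))"
    by (intro bexI) auto
  then show "u \<in> V_rad n" using u(1) unfolding V_rad_def by blast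
qed

lemma V_rad_U_SO: "v \<in> V_rad n \<Longrightarrow> v \<in> U_SO (2*n+1)"
  by (simp add: V_rad_eq)

lemma V_rad_SO: "v \<in> V_rad n \<Longrightarrow> v \<in> carrier (SO (2*n+1))"
  by (simp add: V_rad_eq U_SO_def)

lemma V_rad_mult: "u \<in> V_rad n \<Longrightarrow> v \<in> V_rad n \<Longrightarrow> u * v \<in> V_rad n"
  by (simp add: V_rad_eq top_left_mult U_SO_mult)

lemma V_rad_one: "1\<^sub>m (2*n+1) \<in> V_rad n"
  by (auto simp: V_rad_eq top_left_def U_SO_def SO_one upper_unipotent_one intro!: eq_matI)

lemma V_rad_inv:
  fixes v :: "'a::{field,finite} mat"
  assumes "v \<in> V_rad n"
  shows "inv\<^bsub>SO (2*n+1)\<^esub> v \<in> V_rad n"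
proof -
  have v: "v \<in> U_SO (2*n+1)" using assms by (rule V_rad_U_SO)
  have w: "inv\<^bsub>SO (2*n+1)\<^esub> v \<in> U_SO (2*n+1)" using subgroup.m_inv_closed[OF subgroup_U_SO v] .
  have "top_left n (v * inv\<^bsub>SO (2*n+1)\<^esub> v) = top_left n (1\<^sub>m (2*n+1))"
    using v SO_inv(3)[of v] by (simp add: U_SO_def)
  then have "1\<^sub>m n * top_left n (inv\<^bsub>SO (2*n+1)\<^esub> v) = 1\<^sub>m n"
    using assms V_rad_one[of n, where 'a='a] top_left_mult[OF v w] by (simp add: V_rad_eq)
  then have "top_left n (inv\<^bsub>SO (2*n+1)\<^esub> v) = 1\<^sub>m n"
    by (subst (asm) left_mult_one_mat[of _ n n]) (auto simp: top_left_def)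
  then show ?thesis using w by (simp add: V_rad_eq)
qed

lemma levi_conj_V_rad:
  fixes a :: "'a::{field,finite} mat"
  assumes a: "a \<in> U_GL n" and b: "b \<in> U_GL n" and ab: "a * b = 1\<^sub>m n" and v: "v \<in> V_rad n"
  shows "levi n a * v * levi n b \<in> V_rad n"
proof -
  have u: "levi n a \<in> U_SO (2*n+1)" "levi n b \<in> U_SO (2*n+1)" "v \<in> U_SO (2*n+1)"
    using a b v by (auto simp: levi_U_SO V_rad_U_SO)
  have "top_left n (levi n a * v * levi n b) = a * 1\<^sub>m n * b"
    using u a b v by (simp add: top_left_mult U_SO_mult top_left_levi U_GL_in_GL V_rad_eq)
  then show ?thesis
    using u a ab by (simp add: V_rad_eq U_SO_mult right_mult_one_mat[of _ n n] GL_carrier U_GL_in_GL)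
qed

lemma U_SO_decomp:
  fixes u :: "'a::{field,finite} mat"
  assumes u: "u \<in> U_SO (2*n+1)"
  obtains v where "v \<in> V_rad n" "u = levi n (top_left n u) * v"
proof
  let ?a = "top_left n u" let ?b = "inv\<^bsub>GL n\<^esub> ?a"
  have a: "?a \<in> U_GL n" using u by (rule top_left_U_GL)
  have b: "?b \<in> U_GL n" using subgroup.m_inv_closed[OF subgroup_U_GL a] .
  have ab: "?a * ?b = 1\<^sub>m n" "?b * ?a = 1\<^sub>m n" using GL_inv[OF U_GL_in_GL[OF a]] by auto
  have l: "levi n ?a \<in> U_SO (2*n+1)" "levi n ?b \<in> U_SO (2*n+1)" using a b by (auto simp: levi_U_SO)
  show "levi n ?b * u \<in> V_rad n"
    using l u ab b by (simp add: V_rad_eq U_SO_mult top_left_mult top_left_levi U_GL_in_GL)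
  have "levi n ?a * (levi n ?b * u) = levi n ?a * levi n ?b * u"
    using l u by (simp add: U_SO_carrier assoc_mult_mat[of _ "2*n+1" "2*n+1" _ "2*n+1" _ "2*n+1"])
  also have "\<dots> = u"
    unfolding levi_mult[OF U_GL_in_GL[OF a] U_GL_in_GL[OF b], symmetric] ab(1) levi_one
    using u by (simp add: left_mult_one_mat[of _ "2*n+1" "2*n+1"] U_SO_carrier)
  finally show "u = levi n ?a * (levi n ?b * u)" by simp
qed

section \<open>The element of the intertwining operator\<close>

lemma w_n_eq: "w_n n = bantidiag n 1 (1\<^sub>m n) ((-1)^n \<cdot>\<^sub>m 1\<^sub>m 1) (1\<^sub>m n)"
  by (simp add: w_n_def bantidiag_def)

lemma w_n_carrier: "w_n n \<in> carrier_mat (2*n+1) (2*n+1)"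
  unfolding w_n_eq by (rule bantidiag_carrier) auto

lemma w_n_entry:
  assumes "i < 2*n+1" "j < 2*n+1"
  shows "w_n n $$ (i, j) = (if i < n then (if j = i + n + 1 then 1 else 0)
     else if i = n then (if j = n then (-1)^n else 0) else (if i = j + n + 1 then 1 else 0))"
proof -
  consider "i < n" "j < n + 1" | "i < n" "n + 1 \<le> j" | "n \<le> i" "n + 1 \<le> j" | "i = n" "j < n + 1"
    | "n < i" "j < n" | "n < i" "j = n" using assms by linarith
  then show ?thesis using assms unfolding w_n_def by cases auto
qed

text \<open>Moving the last \<open>n + 1\<close> rows to the top and then moving back the first of them costs the sign
  \<open>(-1)^(n*(n+1)) * (-1)^n = (-1)^n\<close>, which is also the middle entry of the diagonal matrix
  obtained.\<close>

lemma det_w_n: "det (w_n n :: 'a::field mat) = 1"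
proof -
  let ?N = "2*n+1"
  define A :: "'a mat" where "A = mat ?N ?N (\<lambda>(i, j). w_n n $$
    (if i < n + 1 then i + n else if i < n + (n + 1) then i - (n + 1) else i, j))"
  define B where "B = mat ?N ?N (\<lambda>(i, j). A $$ (if i < n then i + 1 else if i < 1 + n then i - n else i, j))"
  have "det (w_n n :: 'a mat) = (-1) ^ (n * (n + 1)) * det A"
    unfolding A_def by (rule det_swap_initial_rows[OF w_n_carrier]) simp
  also have "det A = (-1) ^ (1 * n) * det B"
    unfolding B_def by (rule det_swap_initial_rows[of A]) (auto simp: A_def)
  also have B: "B = mat_diag ?N (\<lambda>i. if i = n then (-1)^n else 1)"
  proof (rule eq_matI)
    fix i j assume "i < dim_row (mat_diag ?N (\<lambda>i. if i = n then (-1)^n else (1::'a)))"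
      "j < dim_col (mat_diag ?N (\<lambda>i. if i = n then (-1)^n else (1::'a)))"
    then have ij: "i < ?N" "j < ?N" by (auto simp: mat_diag_def)
    consider "i < n" | "i = n" | "n < i" by linarith
    then show "B $$ (i, j) = mat_diag ?N (\<lambda>i. if i = n then (-1)^n else 1) $$ (i, j)"
      using ij by cases (auto simp: B_def A_def mat_diag_def w_n_entry)
  qed (auto simp: B_def mat_diag_def)
  also have "det (mat_diag ?N (\<lambda>i. if i = n then (-1)^n else (1::'a))) = (\<Prod>i<?N. if i = n then (-1)^n else 1)"
    by (subst det_upper_triangular[of _ ?N])
      (auto simp: mat_diag_def prod_list_diag_prod upper_triangular_def lessThan_atLeast0 intro!: prod.cong)
  also have "\<dots> = (-1) ^ n" by (subst prod.delta) auto
  finally show ?thesis by (simp flip: power_add power_mult_distrib)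
qed

lemma w_n_in_SO: "w_n n \<in> carrier (SO (2*n+1))"
proof -
  have "transpose_mat (w_n n) * antidiag (2*n+1) * w_n n = (antidiag (2*n+1) :: 'a mat)"
  proof (rule eq_matI)
    fix i j assume "i < dim_row (antidiag (2*n+1) :: 'a mat)" "j < dim_col (antidiag (2*n+1) :: 'a mat)"
    then have ij: "i < 2*n+1" "j < 2*n+1" by auto
    define k where "k = (if i < n then i + n + 1 else if i = n then n else i - n - 1)"
    have k: "k < 2*n+1" using ij by (auto simp: k_def)
    have col: "w_n n $$ (c, i) = (if c = k then (if i = n then (-1)^n else 1) else 0 :: 'a)"
      if "c < 2*n+1" for c
    proof -
      consider "i < n" | "i = n" | "n < i" by linarith
      then show ?thesis using ij that by cases (auto simp: k_def w_n_entry)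
    qed
    have "(transpose_mat (w_n n) * antidiag (2*n+1) * w_n n) $$ (i, j)
        = (\<Sum>c<2*n+1. w_n n $$ (c, i) * w_n n $$ (2*n+1 - 1 - c, j) :: 'a)"
      using ij by (intro orthogonal_entry w_n_carrier)
    also have "\<dots> = w_n n $$ (k, i) * w_n n $$ (2*n+1 - 1 - k, j)"
      using k by (intro sum_single) (simp_all add: col)
    also have "\<dots> = antidiag (2*n+1) $$ (i, j)"
    proof -
      consider "i < n" | "i = n" | "n < i" by linarith
      then show ?thesis
        using ij by cases (simp_all add: col[OF k], auto simp: k_def w_n_entry antidiag_entry
            simp flip: power_add power_mult_distrib)
    qed
    finally show "(transpose_mat (w_n n) * antidiag (2*n+1) * w_n n) $$ (i, j) = (antidiag (2*n+1) :: 'a mat) $$ (i, j)" .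
  qed (use w_n_carrier[of n, where 'a='a] in auto)
  then show ?thesis by (simp add: carrier_SO_iff w_n_carrier det_w_n)
qed

lemma w_n_levi:
  assumes "a \<in> carrier (GL n)"
  shows "w_n n * levi n a = levi n (star n a) * w_n n"
  using GL_carrier[OF assms] star_carrier[OF assms] unfolding w_n_eq levi_def star_star[OF assms]
  by (simp add: bantidiag_mult_bdiag[of _ n _ 1] bdiag_mult_bantidiag[of _ n _ 1] left_mult_one_mat[of _ n n] right_mult_one_mat[of _ n n])

lemma d_n_in_GL: "d_n n \<in> carrier (GL n :: 'a::field mat monoid)"
proof -
  have "d_n n * d_n n = (1\<^sub>m n :: 'a mat)"
    by (simp add: d_n_def flip: power_mult_distrib)
  then show ?thesis unfolding carrier_GL_iff d_n_def by (meson mat_diag_dim)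
qed

text \<open>Both \<open>star\<close> and conjugation by \<open>d_n\<close> negate the superdiagonal, and \<open>star\<close> also reverses it; so
  together they preserve the character of \<open>U_GL\<close>.\<close>

lemma d_n_star:
  fixes a :: "'a::{field,finite} mat"
  assumes a: "a \<in> U_GL n"
  shows "d_n n * star n a * d_n n \<in> U_GL n"
    and "psi_GL \<psi> n (d_n n * star n a * d_n n) = psi_GL \<psi> n a"
    and "d_n n * star n a = d_n n * star n a * d_n n * d_n n"
proof -
  have aG: "a \<in> carrier (GL n)" using a by (rule U_GL_in_GL)
  have s: "star n a \<in> carrier_mat n n" using aG by simp
  have su: "star n a \<in> upper_unipotent n" using star_U_GL[OF a] by (simp add: U_GL_eq)
  have c: "d_n n * star n a \<in> carrier_mat n n" using s by (simp add: d_n_def mult_carrier_mat[of _ n n _ n])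
  have dd: "d_n n * d_n n = (1\<^sub>m n :: 'a mat)" by (simp add: d_n_def flip: power_mult_distrib)
  show "d_n n * star n a = d_n n * star n a * d_n n * d_n n"
    using assoc_mult_mat[OF c, of "d_n n" n "d_n n" n] dd right_mult_one_mat[OF c] by (simp add: d_n_def)
  have ent: "(d_n n * star n a * d_n n) $$ (i, j) = (-1)^(i+1) * star n a $$ (i, j) * (-1)^(j+1)"
    if "i < n" "j < n" for i j
    using that s unfolding d_n_def mat_diag_mult_left[OF s]
    by (subst mat_diag_mult_right[of _ n n]) auto
  have "d_n n * star n a * d_n n \<in> upper_unipotent n"
  proof (rule upper_unipotentI)
    show "d_n n * star n a * d_n n \<in> carrier_mat n n" using c by (simp add: d_n_def mult_carrier_mat[of _ n n _ n])
    fix i j assume "i < n" "j \<le> i"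
    then show "(d_n n * star n a * d_n n) $$ (i, j) = (if i = j then 1 else 0)"
      using upper_unipotent_entry[OF su, of i j] by (auto simp: ent simp flip: power_mult_distrib)
  qed
  then show "d_n n * star n a * d_n n \<in> U_GL n" by (simp add: U_GL_eq)
  have "(\<Sum>i<n-1. (d_n n * star n a * d_n n) $$ (i, i + 1)) = (\<Sum>i<n-1. a $$ (n - 1 - Suc i, n - 1 - Suc i + 1))"
  proof (rule sum.cong)
    fix i assume "i \<in> {..<n-1}"
    then have i: "i + 1 < n" by auto
    then obtain k where n: "n = i + 2 + k" using le_Suc_ex[of "i + 2" n] by auto
    have e: "n - 1 - (i + 1) = k" "n - 1 - i = k + 1" "n - 1 - Suc i = k" using n by simp_all
    have "star n a $$ (i, i + 1) = (inv\<^bsub>GL n\<^esub> a) $$ (n - 1 - (i + 1), n - 1 - i)"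
      using i by (intro star_entry[OF aG]) auto
    also have "\<dots> = - a $$ (n - 1 - Suc i, n - 1 - Suc i + 1)"
      unfolding e using superdiag_inv[OF a, of k] n by simp
    finally have "star n a $$ (i, i + 1) = - a $$ (n - 1 - Suc i, n - 1 - Suc i + 1)" .
    then show "(d_n n * star n a * d_n n) $$ (i, i + 1) = a $$ (n - 1 - Suc i, n - 1 - Suc i + 1)"
      using i by (cases "even i") (auto simp: ent)
  qed simp
  also have "\<dots> = (\<Sum>i<n-1. a $$ (i, i + 1))"
    by (rule sum.nat_diff_reindex)
  finally show "psi_GL \<psi> n (d_n n * star n a * d_n n) = psi_GL \<psi> n a" by (simp add: psi_GL_def)
qed

section \<open>Two-by-two blocks\<close>

abbreviation mat22 :: "'a \<Rightarrow> 'a \<Rightarrow> 'a \<Rightarrow> 'a \<Rightarrow> 'a mat" where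
  "mat22 a b c d \<equiv> mat_of_rows_list 2 [[a, b], [c, d]]"

lemma mat22_carrier [simp]: "mat22 a b c d \<in> carrier_mat 2 2"
  by (simp add: mat_of_rows_list_def numeral_2_eq_2)

lemma mat22_dim [simp]: "dim_row (mat22 a b c d) = 2" "dim_col (mat22 a b c d) = 2"
  by (simp_all add: mat_of_rows_list_def)

lemma mat22_entry:
  "i < 2 \<Longrightarrow> j < 2 \<Longrightarrow> mat22 a b c d $$ (i, j) = (if i = 0 then if j = 0 then a else b else if j = 0 then c else d)"
  by (auto simp: mat_of_rows_list_def less_2_cases_iff One_nat_def)

lemma lessThan_2: "{..<2::nat} = {0, 1}" "{0..<2::nat} = {0, 1}"
  by auto

lemma mat22_mult:
  "mat22 a b c d * mat22 a' b' c' d' = mat22 (a*a' + b*c') (a*b' + b*d') (c*a' + d*c') (c*b' + d*d')"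
proof (rule eq_matI)
  fix i j assume "i < dim_row (mat22 (a*a' + b*c') (a*b' + b*d') (c*a' + d*c') (c*b' + d*d'))"
    "j < dim_col (mat22 (a*a' + b*c') (a*b' + b*d') (c*a' + d*c') (c*b' + d*d'))"
  then have ij: "i < 2" "j < 2" by auto
  have "(mat22 a b c d * mat22 a' b' c' d') $$ (i, j)
      = (\<Sum>k<2. mat22 a b c d $$ (i, k) * mat22 a' b' c' d' $$ (k, j))"
    using ij by (intro times_mat_entry) auto
  then show "(mat22 a b c d * mat22 a' b' c' d') $$ (i, j)
      = mat22 (a*a' + b*c') (a*b' + b*d') (c*a' + d*c') (c*b' + d*d') $$ (i, j)"
    using ij by (simp add: mat22_entry lessThan_2)
qed auto

lemma mat22_one: "1\<^sub>m 2 = mat22 1 0 0 1"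
  by (rule eq_matI) (auto simp: mat22_entry)

lemma mat22_antidiag: "antidiag 2 = mat22 0 1 1 0"
  by (rule eq_matI) (auto simp: mat22_entry antidiag_entry)

lemma transpose_mat22: "transpose_mat (mat22 a b c d) = mat22 a c b d"
  by (rule eq_matI) (auto simp: mat22_entry)

section \<open>The twisted outer element\<close>

text \<open>
  Multiplying \<open>outer_elt\<close> by a torus element gives an involution \<open>outer_twist\<close> in the full orthogonal
  group that is better adapted to the problem: it normalises \<open>U_SO (2*l)\<close> together with its character,
  and on the embedded \<open>SO (2*n+1)\<close> it induces conjugation by an element of the full orthogonal group
  of the odd space.  In terms of quadratic spaces, the embedded \<open>SO (2*n+1)\<close> fixes an anisotropic
  vector in the middle plane, and \<open>outer_twist\<close> is the reflection that fixes this vector and negates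
  its orthogonal complement in the plane.
\<close>

definition outer_twist :: "nat \<Rightarrow> 'a::field mat" where
  "outer_twist l = bdiag (1\<^sub>m (l-1)) (mat22 0 (-1/2) (-2) 0) (1\<^sub>m (l-1))"

lemma two_mult_eq: "1 \<le> l \<Longrightarrow> 2 * l = (l-1) + 2 + (l-1)" for l :: nat
  by simp

lemma outer_twist_carrier [simp]: "1 \<le> l \<Longrightarrow> outer_twist l \<in> carrier_mat (2*l) (2*l)"
  unfolding outer_twist_def by (rule bdiag_carrier[of _ "l-1" _ 2 _ "l-1"]) auto

lemma outer_twist_square:
  assumes "(2::'a::field) \<noteq> 0" "1 \<le> l"
  shows "outer_twist l * outer_twist l = (1\<^sub>m (2*l) :: 'a mat)"
proof -
  have "outer_twist l * outer_twist l = bdiag (1\<^sub>m (l-1)) (mat22 0 (-1/2) (-2) 0 * mat22 0 (-1/2) (-2) 0) (1\<^sub>m (l-1) :: 'a mat)"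
    unfolding outer_twist_def by (subst bdiag_mult[of _ "l-1" _ 2 _ "l-1"]) auto
  also have "mat22 0 (-1/2) (-2) 0 * mat22 0 (-1/2) (-2) 0 = (1\<^sub>m 2 :: 'a mat)"
    using assms(1) by (simp add: mat22_mult mat22_one)
  finally show ?thesis using assms(2) by (simp only: bdiag_one two_mult_eq[symmetric])
qed

lemma outer_twist_form:
  assumes "(2::'a::field) \<noteq> 0" "1 \<le> l"
  shows "transpose_mat (outer_twist l) * antidiag (2*l) * outer_twist l = (antidiag (2*l) :: 'a mat)"
proof -
  have "transpose_mat (mat22 0 (-1/2) (-2) 0) * antidiag 2 * mat22 0 (-1/2) (-2) 0 = (antidiag 2 :: 'a mat)"
    using assms(1) by (simp add: transpose_mat22 mat22_antidiag mat22_mult)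
  then show ?thesis
    unfolding two_mult_eq[OF assms(2)] outer_twist_def antidiag_eq_bantidiag
      bdiag_one_preserves_form[OF mat22_carrier antidiag_carrier] by (rule arg_cong)
qed

lemma outer_elt_eq: "outer_elt l = bdiag (1\<^sub>m (l-1)) (mat22 0 1 1 0) (1\<^sub>m (l-1))"
  by (simp add: outer_elt_def)

lemma outer_elt_carrier [simp]: "1 \<le> l \<Longrightarrow> outer_elt l \<in> carrier_mat (2*l) (2*l)"
  unfolding outer_elt_eq by (rule bdiag_carrier[of _ "l-1" _ 2 _ "l-1"]) auto

lemma outer_elt_square:
  assumes "1 \<le> l"
  shows "outer_elt l * outer_elt l = (1\<^sub>m (2*l) :: 'a::field mat)"
proof -
  have "outer_elt l * outer_elt l = bdiag (1\<^sub>m (l-1)) (mat22 0 1 1 0 * mat22 0 1 1 0) (1\<^sub>m (l-1) :: 'a mat)"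
    unfolding outer_elt_eq by (subst bdiag_mult[of _ "l-1" _ 2 _ "l-1"]) auto
  also have "mat22 0 1 1 0 * mat22 0 1 1 0 = (1\<^sub>m 2 :: 'a mat)"
    by (simp add: mat22_mult mat22_one)
  finally show ?thesis using assms by (simp only: bdiag_one two_mult_eq[symmetric])
qed

lemma outer_elt_form:
  assumes "1 \<le> l"
  shows "transpose_mat (outer_elt l) * antidiag (2*l) * outer_elt l = (antidiag (2*l) :: 'a::field mat)"
proof -
  have "transpose_mat (mat22 0 1 1 0) * antidiag 2 * mat22 0 1 1 0 = (antidiag 2 :: 'a mat)"
    by (simp add: transpose_mat22 mat22_antidiag mat22_mult)
  then show ?thesis
    unfolding two_mult_eq[OF assms] outer_elt_eq antidiag_eq_bantidiag
      bdiag_one_preserves_form[OF mat22_carrier antidiag_carrier] by (rule arg_cong)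
qed

lemma outer_elt_twist_SO:
  assumes "(2::'a::field) \<noteq> 0" "1 \<le> l"
  shows "outer_elt l * outer_twist l \<in> carrier (SO (2*l) :: 'a mat monoid)"
proof -
  have "outer_elt l * outer_twist l = bdiag (1\<^sub>m (l-1)) (mat22 (-2) 0 0 (-1/2)) (1\<^sub>m (l-1) :: 'a mat)"
    unfolding outer_elt_eq outer_twist_def
    by (subst bdiag_mult[of _ "l-1" _ 2 _ "l-1"]) (auto simp: mat22_mult)
  moreover have "bdiag (1\<^sub>m (l-1)) (mat22 (-2) 0 0 (-1/2)) (1\<^sub>m (l-1) :: 'a mat) \<in> carrier (SO (2*l))"
  proof (rule bdiag_in_SO[of _ "l-1" _ 2])
    show "transpose_mat (mat22 (-2) 0 0 (-1/2)) * antidiag 2 * mat22 (-2) 0 0 (-1/2) = (antidiag 2 :: 'a mat)"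
      using assms(1) by (simp add: transpose_mat22 mat22_antidiag mat22_mult)
    have "det (mat22 (-2) 0 0 (-1/2) :: 'a mat) = 1"
      using assms(1) by (subst det_upper_triangular[of _ 2])
        (auto simp: prod_list_diag_prod upper_triangular_def mat22_entry lessThan_2)
    then show "det (1\<^sub>m (l-1)) * det (mat22 (-2) 0 0 (-1/2)) * det (1\<^sub>m (l-1)) = (1 :: 'a)" by simp
  qed (use assms(2) in \<open>auto simp: left_mult_one_mat[of _ "l-1" "l-1"] right_mult_one_mat[of _ "l-1" "l-1"]\<close>)
  ultimately show ?thesis by simp
qed

lemma outer_twist_commute:
  assumes "A \<in> carrier_mat (l-1) (l-1)" "B \<in> carrier_mat (l-1) (l-1)"
  shows "outer_twist l * bdiag A (1\<^sub>m 2) B = bdiag A (1\<^sub>m 2) B * outer_twist l"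
  using assms unfolding outer_twist_def
  by (simp add: bdiag_mult[of _ "l-1" _ 2 _ "l-1"] left_mult_one_mat[of _ "l-1" "l-1"]
      right_mult_one_mat[of _ "l-1" "l-1"] left_mult_one_mat[of _ 2 2] right_mult_one_mat[of _ 2 2])

lemma outer_twist_entry:
  assumes "1 \<le> l" "i < 2*l" "j < 2*l"
  shows "outer_twist l $$ (i, j) = (if i = l-1 \<and> j = l then -1/2 else if i = l \<and> j = l-1 then -2
     else if i = j \<and> i \<noteq> l-1 \<and> i \<noteq> l then 1 else 0)"
proof -
  have ij: "i < (l-1) + 2 + (l-1)" "j < (l-1) + 2 + (l-1)" using assms by auto
  consider "i < l-1" | "i = l-1" | "i = l" | "l < i" by linarith
  then show ?thesis
    unfolding outer_twist_def
    using assms(1) ij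
    by cases (subst bdiag_entry[of _ "l-1" _ 2 _ "l-1"]; auto simp: mat22_entry)+
qed

lemma outer_twist_mult_left:
  assumes "X \<in> carrier_mat (2*l) (2*l)" "1 \<le> l" "i < 2*l" "j < 2*l"
  shows "(outer_twist l * X) $$ (i, j) =
    (if i = l-1 then -1/2 * X $$ (l, j) else if i = l then -2 * X $$ (l-1, j) else X $$ (i, j))"
proof -
  have "(outer_twist l * X) $$ (i, j) = (\<Sum>c<2*l. outer_twist l $$ (i, c) * X $$ (c, j))"
    using assms by (intro times_mat_entry) auto
  also have "\<dots> = outer_twist l $$ (i, if i = l-1 then l else if i = l then l-1 else i)
      * X $$ (if i = l-1 then l else if i = l then l-1 else i, j)"
    using assms by (intro sum_single) (auto simp: outer_twist_entry)
  finally show ?thesis using assms by (auto simp: outer_twist_entry)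
qed

lemma outer_twist_mult_right:
  assumes "X \<in> carrier_mat (2*l) (2*l)" "1 \<le> l" "i < 2*l" "j < 2*l"
  shows "(X * outer_twist l) $$ (i, j) =
    (if j = l-1 then -2 * X $$ (i, l) else if j = l then -1/2 * X $$ (i, l-1) else X $$ (i, j))"
proof -
  have "(X * outer_twist l) $$ (i, j) = (\<Sum>c<2*l. X $$ (i, c) * outer_twist l $$ (c, j))"
    using assms by (intro times_mat_entry) auto
  also have "\<dots> = X $$ (i, if j = l-1 then l else if j = l then l-1 else j)
      * outer_twist l $$ (if j = l-1 then l else if j = l then l-1 else j, j)"
    using assms by (intro sum_single) (auto simp: outer_twist_entry)
  finally show ?thesis using assms by (auto simp: outer_twist_entry mult.commute)
qed

text \<open>The middle plane carries the form \<open>2 x y\<close>, which has no nontrivial unipotent isometry.\<close>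

lemma U_SO_middle_entry:
  fixes u :: "'a::field mat"
  assumes two: "(2::'a) \<noteq> 0" and l: "1 \<le> l" and u: "u \<in> U_SO (2*l)"
  shows "u $$ (l-1, l) = 0"
proof -
  have uu: "u \<in> upper_unipotent (2*l)" and uS: "u \<in> carrier (SO (2*l))" using u by (auto simp: U_SO_def)
  have "(transpose_mat u * antidiag (2*l) * u) $$ (l, l) = (\<Sum>c<2*l. u $$ (c, l) * u $$ (2*l - 1 - c, l))"
    using uS l by (intro orthogonal_entry) (auto simp: SO_carrier)
  also have "\<dots> = (\<Sum>c\<in>{l-1, l}. u $$ (c, l) * u $$ (2*l - 1 - c, l))"
  proof (rule sum.mono_neutral_right)
    show "\<forall>c\<in>{..<2*l} - {l-1, l}. u $$ (c, l) * u $$ (2*l - 1 - c, l) = 0"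
    proof
      fix c assume c: "c \<in> {..<2*l} - {l-1, l}"
      then consider "l < c" "c < 2*l" | "l < 2*l - 1 - c" "c < 2*l" by force
      then show "u $$ (c, l) * u $$ (2*l - 1 - c, l) = 0"
        using l by cases (auto simp: upper_unipotent_entry[OF uu])
    qed
  qed (use l in auto)
  also have "\<dots> = 2 * u $$ (l-1, l)"
  proof -
    have "2*l - 1 - (l-1) = l" "2*l - 1 - l = l-1" "l - 1 \<noteq> l" using l by auto
    then show ?thesis using l by (simp add: upper_unipotent_entry[OF uu])
  qed
  finally have "2 * u $$ (l-1, l) = antidiag (2*l) $$ (l, l)" using uS by (simp add: carrier_SO_iff)
  then show ?thesis using two l by (simp add: antidiag_entry)
qed

lemma outer_twist_conj_U_SO:
  fixes u :: "'a::field mat"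
  assumes two: "(2::'a) \<noteq> 0" and l: "2 \<le> l" and u: "u \<in> U_SO (2*l)"
  shows "outer_twist l * u * outer_twist l \<in> U_SO (2*l)"
    and "psi_SO \<psi> l (outer_twist l * u * outer_twist l) = psi_SO \<psi> l u"
proof -
  let ?k = "outer_twist l :: 'a mat"
  have l1: "1 \<le> l" using l by simp
  have uc: "u \<in> carrier_mat (2*l) (2*l)" using u by (rule U_SO_carrier)
  have uu: "u \<in> upper_unipotent (2*l)" and uS: "u \<in> carrier (SO (2*l))" using u by (auto simp: U_SO_def)
  have kc: "?k \<in> carrier_mat (2*l) (2*l)" using l1 by simp
  have ku: "?k * u \<in> carrier_mat (2*l) (2*l)" using kc uc by (rule mult_carrier_mat)
  have mid: "u $$ (l-1, l) = 0" using two l1 u by (rule U_SO_middle_entry)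
  note ent = outer_twist_mult_right[OF ku l1] outer_twist_mult_left[OF uc l1]
  have "?k * u * ?k \<in> upper_unipotent (2*l)"
  proof (rule upper_unipotentI)
    show "?k * u * ?k \<in> carrier_mat (2*l) (2*l)" using ku kc by (rule mult_carrier_mat)
    fix i j assume ij: "i < 2*l" "j \<le> i"
    then show "(?k * u * ?k) $$ (i, j) = (if i = j then 1 else 0)"
      using l1 two mid by (auto simp: ent upper_unipotent_entry[OF uu] simp del: index_mult_mat(1))
  qed
  moreover have "?k * u * ?k \<in> carrier (SO (2*l))"
    using uS kc outer_twist_square[OF two l1] outer_twist_form[OF two l1] by (rule conj_involution_SO)
  ultimately show "?k * u * ?k \<in> U_SO (2*l)" by (simp add: U_SO_def)
  have four: "(4::'a) \<noteq> 0" using two by (metis mult_2 mult_eq_0_iff numeral_Bit0)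
  have eight: "(8::'a) \<noteq> 0" using two four mult_eq_0_iff[of "2::'a" 4] by simp
  have "(\<Sum>i<l-2. (?k * u * ?k) $$ (i, i+1)) = (\<Sum>i<l-2. u $$ (i, i+1))"
    by (rule sum.cong) (auto simp: ent simp del: index_mult_mat(1))
  moreover have "(?k * u * ?k) $$ (l-2, l-1) = -2 * u $$ (l-2, l)"
      "(?k * u * ?k) $$ (l-2, l) = -1/2 * u $$ (l-2, l-1)"
    using l by (auto simp: ent simp del: index_mult_mat(1))
  moreover have "1/4 * (-2 * x) - 1/2 * (-1/2 * y) = 1/4 * y - 1/2 * x" for x y :: 'a
    using two four eight by (simp add: field_simps)
  ultimately show "psi_SO \<psi> l (?k * u * ?k) = psi_SO \<psi> l u"
    unfolding psi_SO_def add_diff_eq[symmetric] by (simp only:)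
qed

section \<open>The embedding of the odd orthogonal group\<close>

definition M_inv :: "nat \<Rightarrow> 'a::field mat" where
  "M_inv n = bdiag (1\<^sub>m n) (mat22 (1/4) (1/2) (-1/2) 1) (1\<^sub>m n)"

lemma M_mat_eq: "M_mat n = bdiag (1\<^sub>m n) (mat22 2 (-1) 1 (1/2)) (1\<^sub>m n)"
  by (simp add: M_mat_def)

lemma powers_of_two_nonzero:
  assumes "(2::'a::field) \<noteq> 0"
  shows "(4::'a) \<noteq> 0" "(8::'a) \<noteq> 0"
proof -
  show four: "(4::'a) \<noteq> 0" using mult_eq_0_iff[of "2::'a" 2] assms by simp
  show "(8::'a) \<noteq> 0" using mult_eq_0_iff[of "2::'a" 4] assms four by simp
qed

lemma mat22_eqI: "a = a' \<Longrightarrow> b = b' \<Longrightarrow> c = c' \<Longrightarrow> d = d' \<Longrightarrow> mat22 a b c d = mat22 a' b' c' d'"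
  by simp

lemma two_add: "n + 2 + n = 2*n+2" for n :: nat
  by simp

lemma M_carrier [simp]: "M_mat n \<in> carrier_mat (2*n+2) (2*n+2)" "M_inv n \<in> carrier_mat (2*n+2) (2*n+2)"
  unfolding M_mat_eq M_inv_def by (rule bdiag_carrier[of _ n _ 2 _ n]; simp)+

lemma mat22_M_mult:
  assumes "(2::'a::field) \<noteq> 0"
  shows "mat22 2 (-1) 1 (1/2) * mat22 (1/4) (1/2) (-1/2) 1 = (1\<^sub>m 2 :: 'a mat)"
    and "mat22 (1/4) (1/2) (-1/2) 1 * mat22 2 (-1) 1 (1/2) = (1\<^sub>m 2 :: 'a mat)"
  unfolding mat22_mult mat22_one using assms powers_of_two_nonzero[OF assms]
  by (intro mat22_eqI; simp add: field_simps)+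

lemma M_mult:
  assumes "(2::'a::field) \<noteq> 0"
  shows "M_mat n * M_inv n = (1\<^sub>m (2*n+2) :: 'a mat)" "M_inv n * M_mat n = (1\<^sub>m (2*n+2) :: 'a mat)"
  unfolding M_mat_eq M_inv_def
  by (subst bdiag_mult[of _ n _ 2 _ n], (rule one_carrier_mat mat22_carrier)+,
      simp only: mat22_M_mult[OF assms] left_mult_one_mat[OF one_carrier_mat] bdiag_one two_add)+

lemma inv_M_mat:
  assumes "(2::'a::field) \<noteq> 0"
  shows "inv\<^bsub>GL (2*n+2)\<^esub> (M_mat n) = (M_inv n :: 'a mat)"
proof (rule group.inv_equality[OF group_GL])
  show "M_mat n \<in> carrier (GL (2*n+2) :: 'a mat monoid)" "M_inv n \<in> carrier (GL (2*n+2) :: 'a mat monoid)"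
    using M_mult[OF assms, of n] M_carrier unfolding carrier_GL_iff by blast+
qed (use M_mult[OF assms, of n] in simp)

lemma embed_eq:
  assumes "(2::'a::field) \<noteq> 0"
  shows "embed l n (g :: 'a mat)
    = bdiag (1\<^sub>m (l-n-1)) (M_inv n * insert_one n g * M_mat n) (1\<^sub>m (l-n-1))"
  by (simp add: embed_def inv_M_mat[OF assms])

subsection \<open>Inserting a row and a column\<close>

lemma sum_insert_index:
  fixes f :: "nat \<Rightarrow> 'a::comm_monoid_add"
  assumes "k \<le> m"
  shows "(\<Sum>i<Suc m. f i) = f k + (\<Sum>i<m. f (insert_index k i))"
proof -
  have "(\<Sum>i<Suc m. f i) = f k + (\<Sum>i\<in>{0..<Suc m} - {k}. f i)"
    using assms by (subst sum.remove[of _ k]) (auto simp: lessThan_atLeast0)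
  also have "{0..<Suc m} - {k} = insert_index k ` {0..<m}"
    using assms by (simp add: insert_index_image)
  also have "(\<Sum>i\<in>insert_index k ` {0..<m}. f i) = (\<Sum>i<m. f (insert_index k i))"
    by (subst sum.reindex[OF insert_index_inj_on]) (simp add: lessThan_atLeast0)
  finally show ?thesis .
qed

lemma insert_one_carrier [simp]: "insert_one n g \<in> carrier_mat (2*n+2) (2*n+2)"
  by (simp add: insert_one_def)

lemma insert_one_entry:
  assumes "i < 2*n+2" "j < 2*n+2"
  shows "insert_one n g $$ (i, j) = (if i = n \<or> j = n then if i = j then 1 else 0
     else g $$ (delete_index n i, delete_index n j))"
  using assms by (simp add: insert_one_def)

lemma delete_index_less: "i < 2*n+2 \<Longrightarrow> i \<noteq> n \<Longrightarrow> delete_index n i < 2*n+1"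
  by (auto simp: delete_index_def)

lemma insert_index_less: "i < 2*n+1 \<Longrightarrow> insert_index n i < 2*n+2"
  by (auto simp: insert_index_def)

lemma insert_index_neq: "n \<noteq> insert_index n i"
  using insert_index_exclude[of n i] by metis

lemma insert_one_mult:
  assumes g: "g \<in> carrier_mat (2*n+1) (2*n+1)" and h: "h \<in> carrier_mat (2*n+1) (2*n+1)"
  shows "insert_one n (g * h) = insert_one n g * insert_one n h"
proof (rule eq_matI)
  fix i j assume "i < dim_row (insert_one n g * insert_one n h)" "j < dim_col (insert_one n g * insert_one n h)"
  then have ij: "i < 2*n+2" "j < 2*n+2" by (auto simp: insert_one_def)
  have N: "2*n+2 = Suc (2*n+1)" by simp
  have "(insert_one n g * insert_one n h) $$ (i, j)
      = (\<Sum>c<2*n+2. insert_one n g $$ (i, c) * insert_one n h $$ (c, j))"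
    using ij by (intro times_mat_entry) auto
  also have "\<dots> = insert_one n g $$ (i, n) * insert_one n h $$ (n, j)
      + (\<Sum>c<2*n+1. insert_one n g $$ (i, insert_index n c) * insert_one n h $$ (insert_index n c, j))"
    unfolding N by (rule sum_insert_index) simp
  also have "\<dots> = insert_one n (g * h) $$ (i, j)"
  proof (cases "i = n \<or> j = n")
    case True
    then show ?thesis
      using ij by (auto simp: insert_one_entry insert_index_less insert_index_neq insert_index_neq[symmetric]
          intro!: sum.neutral)
  next
    case False
    then have "insert_one n (g * h) $$ (i, j)
        = (\<Sum>c<2*n+1. g $$ (delete_index n i, c) * h $$ (c, delete_index n j))"
      using ij times_mat_entry[OF g h] by (simp add: insert_one_entry delete_index_less)
    then show ?thesis
      using ij False by (simp add: insert_one_entry insert_index_less insert_index_neq insert_index_neq[symmetric])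
  qed
  finally show "insert_one n (g * h) $$ (i, j) = (insert_one n g * insert_one n h) $$ (i, j)" by simp
qed (auto simp: insert_one_def)

lemma det_insert_one:
  fixes g :: "'a::field mat"
  assumes g: "g \<in> carrier_mat (2*n+1) (2*n+1)"
  shows "det (insert_one n g) = det g"
proof -
  have "det (insert_one n g) = (\<Sum>j<2*n+2. insert_one n g $$ (n, j) * cofactor (insert_one n g) n j)"
    by (rule laplace_expansion_row) auto
  also have "\<dots> = insert_one n g $$ (n, n) * cofactor (insert_one n g) n n"
    by (rule sum_single) (auto simp: insert_one_entry)
  also have "\<dots> = det (mat_delete (insert_one n g) n n)"
    by (simp add: insert_one_entry cofactor_def flip: mult_2)
  also have "mat_delete (insert_one n g) n n = g"
  proof (rule eq_matI)
    fix i j assume "i < dim_row g" "j < dim_col g"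
    then have ij: "i < 2*n+1" "j < 2*n+1" using g by auto
    have "mat_delete (insert_one n g) n n $$ (i, j) = insert_one n g $$ (insert_index n i, insert_index n j)"
      using ij by (intro mat_delete_index[of _ "2*n+1", symmetric]) (auto simp: insert_one_def)
    then show "mat_delete (insert_one n g) n n $$ (i, j) = g $$ (i, j)"
      using ij by (simp add: insert_one_entry insert_index_less insert_index_neq[symmetric])
  qed (use g in \<open>auto simp: mat_delete_dim insert_one_def\<close>)
  finally show ?thesis .
qed

text \<open>In the basis given by \<open>M_mat\<close> the form is the orthogonal sum of the form \<open>antidiag (2*n+1)\<close> and
  a line of discriminant \<open>-1/4\<close>, spanned by the new basis vector.\<close>

definition split_form :: "nat \<Rightarrow> 'a::field mat" where
  "split_form n = bantidiag n 2 (antidiag n) (mat22 (-1/4) 0 0 1) (antidiag n)"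

lemma split_form_carrier [simp]: "split_form n \<in> carrier_mat (2*n+2) (2*n+2)"
  unfolding split_form_def by (rule bantidiag_carrier) auto

lemma split_form_M_mat:
  assumes two: "(2::'a::field) \<noteq> 0"
  shows "transpose_mat (M_mat n) * split_form n * M_mat n = (antidiag (2*n+2) :: 'a mat)"
proof -
  have "transpose_mat (mat22 2 (-1) 1 (1/2)) * mat22 (-1/4) 0 0 1 * mat22 2 (-1) 1 (1/2) = (antidiag 2 :: 'a mat)"
    unfolding transpose_mat22 mat22_antidiag mat22_mult using two powers_of_two_nonzero[OF two]
    by (intro mat22_eqI) (simp_all add: field_simps)
  then show ?thesis
    unfolding split_form_def M_mat_eq two_add[symmetric] antidiag_eq_bantidiag
      bdiag_one_preserves_form[OF mat22_carrier mat22_carrier] by (rule arg_cong)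
qed

lemma split_form_M_inv:
  assumes two: "(2::'a::field) \<noteq> 0"
  shows "transpose_mat (M_inv n) * antidiag (2*n+2) * M_inv n = (split_form n :: 'a mat)"
proof -
  have "transpose_mat (mat22 (1/4) (1/2) (-1/2) 1) * antidiag 2 * mat22 (1/4) (1/2) (-1/2) 1 = (mat22 (-1/4) 0 0 1 :: 'a mat)"
    unfolding transpose_mat22 mat22_antidiag mat22_mult using two powers_of_two_nonzero[OF two]
    by (intro mat22_eqI) (simp_all add: field_simps)
  then show ?thesis
    unfolding split_form_def M_inv_def two_add[symmetric] antidiag_eq_bantidiag
      bdiag_one_preserves_form[OF mat22_carrier antidiag_carrier] by (rule arg_cong)
qed

lemma split_form_entry:
  assumes "i < 2*n+2" "j < 2*n+2"
  shows "split_form n $$ (i, j) = (if i = n \<or> j = n then if i = j then -1/4 else 0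
     else antidiag (2*n+1) $$ (delete_index n i, delete_index n j))"
proof -
  have i: "i < n \<or> i = n \<or> i = n + 1 \<or> n + 1 < i" by auto
  have j: "j < n \<or> j = n \<or> j = n + 1 \<or> n + 1 < j" by auto
  show ?thesis
    unfolding split_form_def bantidiag_def using assms i j
    by (elim disjE) (simp_all add: antidiag_entry delete_index_def mat22_entry, (intro conjI impI; linarith)+)
qed

lemma insert_one_form:
  fixes g :: "'a::field mat"
  assumes g: "g \<in> carrier_mat (2*n+1) (2*n+1)"
    and form: "transpose_mat g * antidiag (2*n+1) * g = antidiag (2*n+1)"
  shows "transpose_mat (insert_one n g) * split_form n * insert_one n g = split_form n"
proof -
  let ?J = "antidiag (2*n+1) :: 'a mat" and ?N = "2*n+2"
  let ?G = "insert_one n g" and ?S = "split_form n :: 'a mat"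
  define S0 where "S0 = insert_one n ?J"
  \<comment> \<open>the form differs from the matrix with inserted entry \<open>1\<close> only in that entry\<close>
  define D where "D = mat_diag ?N (\<lambda>i. if i = n then -1/4 else (1::'a))"
  have D: "D \<in> carrier_mat ?N ?N" by (simp add: D_def)
  have S0: "S0 \<in> carrier_mat ?N ?N" by (simp add: S0_def)
  have S: "?S = D * S0"
    unfolding D_def mat_diag_mult_left[OF S0]
    by (rule eq_matI) (auto simp: split_form_entry S0_def insert_one_entry carrier_matD[OF split_form_carrier])
  have tG: "transpose_mat ?G = insert_one n (transpose_mat g)"
    using g by (intro eq_matI) (auto simp: insert_one_def delete_index_less)
  have comm: "insert_one n (transpose_mat g) * D = D * insert_one n (transpose_mat g)"
    unfolding D_def mat_diag_mult_left[OF insert_one_carrier] mat_diag_mult_right[OF insert_one_carrier]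
    by (rule eq_matI) (auto simp: insert_one_entry)
  have tg: "transpose_mat g \<in> carrier_mat (2*n+1) (2*n+1)" using g by simp
  have "transpose_mat ?G * ?S * ?G = insert_one n (transpose_mat g) * D * (S0 * ?G)"
    unfolding tG S using D S0
    by (simp add: assoc_mult_mat[of _ ?N ?N _ ?N _ ?N] mult_carrier_mat[of _ ?N ?N _ ?N])
  also have "\<dots> = D * (insert_one n (transpose_mat g) * S0 * ?G)"
    unfolding comm using D S0
    by (simp add: assoc_mult_mat[of _ ?N ?N _ ?N _ ?N] mult_carrier_mat[of _ ?N ?N _ ?N])
  also have "insert_one n (transpose_mat g) * S0 * ?G = insert_one n (transpose_mat g * ?J * g)"
    unfolding S0_def using g tg
    by (simp add: insert_one_mult mult_carrier_mat[of _ "2*n+1" "2*n+1" _ "2*n+1"])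
  finally show ?thesis unfolding form S S0_def .
qed

subsection \<open>Properties of the embedding\<close>

lemma embed_size: "n \<le> l - 1 \<Longrightarrow> 1 \<le> l \<Longrightarrow> 2 * l = (l-n-1) + (2*n+2) + (l-n-1)" for l n :: nat
  by simp

lemma M_conj_carrier [simp]: "M_inv n * insert_one n g * M_mat n \<in> carrier_mat (2*n+2) (2*n+2)"
  using mult_carrier_mat[OF mult_carrier_mat[OF M_carrier(2) insert_one_carrier] M_carrier(1)] .

lemma embed_carrier:
  assumes "(2::'a::field) \<noteq> 0" "n \<le> l - 1" "1 \<le> l"
  shows "embed l n (g :: 'a mat) \<in> carrier_mat (2*l) (2*l)"
  unfolding embed_eq[OF assms(1)] using embed_size[OF assms(2,3)]
  by (intro bdiag_carrier[of _ "l-n-1" _ "2*n+2" _ "l-n-1"]) auto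

lemma M_conj_mult:
  fixes g h :: "'a::field mat"
  assumes two: "(2::'a) \<noteq> 0"
    and "g \<in> carrier_mat (2*n+1) (2*n+1)" "h \<in> carrier_mat (2*n+1) (2*n+1)"
  shows "M_inv n * insert_one n (g * h) * M_mat n
    = (M_inv n * insert_one n g * M_mat n) * (M_inv n * insert_one n h * M_mat n)"
proof -
  let ?N = "2*n+2"
  have "(M_inv n * insert_one n g * M_mat n) * (M_inv n * insert_one n h * M_mat n)
      = M_inv n * insert_one n g * ((M_mat n * M_inv n) * (insert_one n h * M_mat n))"
    by (simp add: assoc_mult_mat[of _ ?N ?N _ ?N _ ?N] mult_carrier_mat[of _ ?N ?N _ ?N])
  also have "\<dots> = M_inv n * insert_one n g * (insert_one n h * M_mat n)"
    unfolding M_mult[OF two]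
    by (subst left_mult_one_mat[of _ ?N ?N]) (simp_all add: mult_carrier_mat[of _ ?N ?N _ ?N])
  also have "\<dots> = M_inv n * insert_one n (g * h) * M_mat n"
    unfolding insert_one_mult[OF assms(2,3)]
    by (simp add: assoc_mult_mat[of _ ?N ?N _ ?N _ ?N] mult_carrier_mat[of _ ?N ?N _ ?N])
  finally show ?thesis by simp
qed

lemma embed_mult:
  fixes g h :: "'a::field mat"
  assumes two: "(2::'a) \<noteq> 0"
    and "g \<in> carrier_mat (2*n+1) (2*n+1)" "h \<in> carrier_mat (2*n+1) (2*n+1)"
  shows "embed l n (g * h) = embed l n g * embed l n h"
  unfolding embed_eq[OF two] M_conj_mult[OF assms]
  by (subst bdiag_mult[of _ "l-n-1" _ "2*n+2" _ "l-n-1"]) auto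

lemma embed_in_SO:
  fixes g :: "'a::field mat"
  assumes two: "(2::'a) \<noteq> 0" and n: "n \<le> l - 1" "1 \<le> l" and g: "g \<in> carrier (SO (2*n+1))"
  shows "embed l n g \<in> carrier (SO (2*l))"
  unfolding embed_eq[OF two]
proof (rule bdiag_in_SO)
  let ?N = "2*n+2" and ?Y = "M_inv n * insert_one n g * M_mat n"
  note [simp] = assoc_mult_mat[of _ ?N ?N _ ?N _ ?N] mult_carrier_mat[of _ ?N ?N _ ?N]
  note [simp del] = M_conj_carrier
  show "2 * l = (l-n-1) + ?N + (l-n-1)" using embed_size[OF n] .
  have gc: "g \<in> carrier_mat (2*n+1) (2*n+1)" using g by (rule SO_carrier)
  have "transpose_mat ?Y * antidiag ?N * ?Y
      = transpose_mat (M_mat n) * (transpose_mat (insert_one n g)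
          * (transpose_mat (M_inv n) * antidiag ?N * M_inv n) * insert_one n g) * M_mat n"
    by (simp add: transpose_mult[of _ ?N ?N _ ?N])
  also have "\<dots> = antidiag ?N"
    using g gc by (simp only: split_form_M_inv[OF two] carrier_SO_iff insert_one_form split_form_M_mat[OF two])
  finally show "transpose_mat ?Y * antidiag ?N * ?Y = antidiag ?N" .
  have "det (M_inv n :: 'a mat) * det (M_mat n) = 1"
    using det_mult[of "M_inv n :: 'a mat" ?N "M_mat n"] M_mult(2)[OF two, of n] by simp
  moreover have "det ?Y = det (M_inv n :: 'a mat) * det g * det (M_mat n)"
    using det_mult[OF mult_carrier_mat[OF M_carrier(2) insert_one_carrier] M_carrier(1), of n g]
      det_mult[OF M_carrier(2) insert_one_carrier, of n g] det_insert_one[OF gc] by simp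
  ultimately show "det (1\<^sub>m (l-n-1)) * det ?Y * det (1\<^sub>m (l-n-1)) = 1"
    using g by (simp add: carrier_SO_iff)
qed (auto simp: right_mult_one_mat[of _ "l-n-1" "l-n-1"])

section \<open>The reflection on the odd side\<close>

definition mid_refl :: "nat \<Rightarrow> 'a::field mat" where
  "mid_refl n = mat_diag (2*n+1) (\<lambda>i. if i = n then -1 else 1)"

lemma mid_refl_carrier [simp]: "mid_refl n \<in> carrier_mat (2*n+1) (2*n+1)"
  by (simp add: mid_refl_def)

lemma mid_refl_square: "mid_refl n * mid_refl n = 1\<^sub>m (2*n+1)"
  unfolding mid_refl_def mat_diag_diag by (rule eq_matI) (auto simp: mat_diag_def)

lemma mid_refl_dim [simp]: "dim_row (mid_refl n) = 2*n+1" "dim_col (mid_refl n) = 2*n+1"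
  by (simp_all add: mid_refl_def mat_diag_def)

lemma mid_refl_entry:
  "i < 2*n+1 \<Longrightarrow> j < 2*n+1 \<Longrightarrow> mid_refl n $$ (i, j) = (if i = j then if i = n then -1 else 1 else 0)"
  by (simp add: mid_refl_def mat_diag_def)

lemma mid_refl_conj_entry:
  assumes g: "g \<in> carrier_mat (2*n+1) (2*n+1)" and "i < 2*n+1" "j < 2*n+1"
  shows "(mid_refl n * g * mid_refl n) $$ (i, j) = (if (i = n) = (j = n) then g $$ (i, j) else - g $$ (i, j))"
  using assms unfolding mid_refl_def mat_diag_mult_left[OF g]
  by (subst mat_diag_mult_right[of _ "2*n+1" "2*n+1"]) auto

lemma mid_refl_conj_carrier [simp]:
  "g \<in> carrier_mat (2*n+1) (2*n+1) \<Longrightarrow> mid_refl n * g * mid_refl n \<in> carrier_mat (2*n+1) (2*n+1)"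
  by (simp add: mult_carrier_mat[of _ "2*n+1" "2*n+1" _ "2*n+1"])

lemma mid_refl_conj_conj:
  assumes "g \<in> carrier_mat (2*n+1) (2*n+1)"
  shows "mid_refl n * (mid_refl n * g * mid_refl n) * mid_refl n = g"
  using mid_refl_conj_carrier[OF assms] assms
  by (intro eq_matI) (auto simp: mid_refl_conj_entry simp del: index_mult_mat(1))

lemma mid_refl_conj_mult:
  assumes g: "g \<in> carrier_mat (2*n+1) (2*n+1)" and h: "h \<in> carrier_mat (2*n+1) (2*n+1)"
  shows "mid_refl n * (g * h) * mid_refl n = (mid_refl n * g * mid_refl n) * (mid_refl n * h * mid_refl n)"
proof -
  let ?N = "2*n+1" and ?e = "mid_refl n"
  have "(?e * g * ?e) * (?e * h * ?e) = ?e * g * ((?e * ?e) * (h * ?e))"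
    using g h by (simp add: assoc_mult_mat[of _ ?N ?N _ ?N _ ?N] mult_carrier_mat[of _ ?N ?N _ ?N])
  also have "\<dots> = ?e * g * (h * ?e)"
    unfolding mid_refl_square using h
    by (subst left_mult_one_mat[of _ ?N ?N]) (simp_all add: mult_carrier_mat[of _ ?N ?N _ ?N])
  also have "\<dots> = ?e * (g * h) * ?e"
    using g h by (simp add: assoc_mult_mat[of _ ?N ?N _ ?N _ ?N] mult_carrier_mat[of _ ?N ?N _ ?N])
  finally show ?thesis by simp
qed

lemma transpose_mid_refl: "transpose_mat (mid_refl n) = mid_refl n"
  by (rule eq_matI) (auto simp: mid_refl_def mat_diag_def)

lemma mid_refl_form: "transpose_mat (mid_refl n) * antidiag (2*n+1) * mid_refl n = antidiag (2*n+1)"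
  unfolding transpose_mid_refl
  using mid_refl_conj_carrier[OF antidiag_carrier]
  by (intro eq_matI) (auto simp: mid_refl_conj_entry antidiag_entry simp del: index_mult_mat(1))

lemma mid_refl_conj_SO:
  "g \<in> carrier (SO (2*n+1)) \<Longrightarrow> mid_refl n * g * mid_refl n \<in> carrier (SO (2*n+1))"
  by (rule conj_involution_SO[OF _ mid_refl_carrier mid_refl_square mid_refl_form])

lemma mid_refl_conj_U_SO:
  assumes "u \<in> U_SO (2*n+1)"
  shows "mid_refl n * u * mid_refl n \<in> U_SO (2*n+1)"
proof -
  have u: "u \<in> carrier (SO (2*n+1))" "u \<in> upper_unipotent (2*n+1)" using assms by (auto simp: U_SO_def)
  have "mid_refl n * u * mid_refl n \<in> upper_unipotent (2*n+1)"
    using SO_carrier[OF u(1)] upper_unipotent_entry[OF u(2)]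
    by (intro upper_unipotentI) (auto simp: mid_refl_conj_entry simp del: index_mult_mat(1))
  then show ?thesis using mid_refl_conj_SO[OF u(1)] by (simp add: U_SO_def)
qed

lemma mid_refl_conj_V_rad:
  assumes "v \<in> V_rad n"
  shows "mid_refl n * v * mid_refl n \<in> V_rad n"
proof -
  have v: "v \<in> U_SO (2*n+1)" using assms by (rule V_rad_U_SO)
  have "top_left n (mid_refl n * v * mid_refl n) = top_left n v"
    using U_SO_carrier[OF v]
    by (intro eq_matI) (auto simp: top_left_def mid_refl_conj_entry simp del: index_mult_mat(1))
  then show ?thesis using assms mid_refl_conj_U_SO[OF v] by (simp add: V_rad_eq)
qed

lemma mid_refl_conj_levi:
  assumes "a \<in> carrier (GL n)"
  shows "mid_refl n * levi n a * mid_refl n = levi n a"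
proof -
  have "levi n a \<in> carrier_mat (2*n+1) (2*n+1)" using levi_in_SO[OF assms] by (rule SO_carrier)
  then show ?thesis
    by (intro eq_matI) (auto simp: mid_refl_conj_entry levi_entry[OF assms] simp del: index_mult_mat(1))
qed

lemma mid_refl_conj_w_n: "mid_refl n * w_n n * mid_refl n = w_n n"
  by (rule eq_matI)
    (auto simp: carrier_matD[OF w_n_carrier] mid_refl_conj_entry[OF w_n_carrier] w_n_entry
      simp del: index_mult_mat(1))

lemma four_block_one: "four_block_mat (1\<^sub>m p) (0\<^sub>m p q) (0\<^sub>m q p) (1\<^sub>m q) = 1\<^sub>m (p + q)"
  by (rule eq_matI) auto

text \<open>The formula defining \<open>embed\<close> makes sense on the full orthogonal group of the odd space, and there
  \<open>outer_twist\<close> is the image of a reflection.  Hence conjugation by it is compatible with \<open>embed\<close>.\<close>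

lemma embed_mid_refl:
  assumes two: "(2::'a::field) \<noteq> 0" and n: "n \<le> l - 1" "1 \<le> l"
  shows "embed l n (mid_refl n) = (outer_twist l :: 'a mat)"
proof -
  let ?D = "mat_diag (2*n+2) (\<lambda>i. if i = n + 1 then -1 else 1) :: 'a mat"
  have D: "?D $$ (i, j) = (if i = j then if i = n + 1 then -1 else 1 else 0)"
    if "i < 2*n+2" "j < 2*n+2" for i j using that by (auto simp: mat_diag_def)
  have "insert_one n (mid_refl n) = ?D"
  proof (rule eq_matI)
    fix i j assume "i < dim_row ?D" "j < dim_col ?D"
    then have ij: "i < 2*n+2" "j < 2*n+2" by (auto simp: mat_diag_def)
    have del: "delete_index n i = delete_index n j \<longleftrightarrow> i = j" "delete_index n i = n \<longleftrightarrow> i = n + 1"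
      if "i \<noteq> n" "j \<noteq> n" using that by (auto simp: delete_index_def)
    show "insert_one n (mid_refl n) $$ (i, j) = ?D $$ (i, j)"
    proof (cases "i = n \<or> j = n")
      case False
      then show ?thesis
        using ij del unfolding D[OF ij]
        by (cases "i = j") (simp_all add: insert_one_entry mid_refl_entry delete_index_less)
    qed (use ij in \<open>auto simp: D insert_one_entry\<close>)
  qed (auto simp: insert_one_def mat_diag_def)
  moreover have "bdiag (1\<^sub>m n) (mat22 1 0 0 (-1)) (1\<^sub>m n :: 'a mat) = ?D"
  proof (rule eq_matI)
    fix i j assume "i < dim_row ?D" "j < dim_col ?D"
    then have ij: "i < n + 2 + n" "j < n + 2 + n" by (auto simp: mat_diag_def)
    have Dij: "?D $$ (i, j) = (if i = j then if i = n + 1 then -1 else 1 else 0)"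
      using ij by (intro D) auto
    have "i < n \<or> i = n \<or> i = n + 1 \<or> n + 1 < i" "j < n \<or> j = n \<or> j = n + 1 \<or> n + 1 < j" by auto
    then show "bdiag (1\<^sub>m n) (mat22 1 0 0 (-1)) (1\<^sub>m n) $$ (i, j) = ?D $$ (i, j)"
      unfolding Dij bdiag_entry[OF one_carrier_mat mat22_carrier one_carrier_mat ij] using ij
      by (elim disjE) (simp_all add: mat22_entry, arith)
  qed (auto simp: mat_diag_def dim_diag_block_mat)
  ultimately have ins: "insert_one n (mid_refl n) = bdiag (1\<^sub>m n) (mat22 1 0 0 (-1)) (1\<^sub>m n :: 'a mat)" by simp
  have "mat22 (1/4) (1/2) (-1/2) 1 * mat22 1 0 0 (-1) * mat22 2 (-1) 1 (1/2) = mat22 0 (-1/2) (-2) (0::'a)"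
    unfolding mat22_mult using two powers_of_two_nonzero[OF two]
    by (intro mat22_eqI) (simp_all add: field_simps)
  then have "M_inv n * insert_one n (mid_refl n) * M_mat n = bdiag (1\<^sub>m n) (mat22 0 (-1/2) (-2) 0) (1\<^sub>m n :: 'a mat)"
    unfolding ins M_inv_def M_mat_eq
    by (simp only: bdiag_mult[of _ n _ 2 _ n] one_carrier_mat mat22_carrier mult_carrier_mat[of _ 2 2 _ 2]
        left_mult_one_mat[OF one_carrier_mat])
  then have "embed l n (mid_refl n) = bdiag (1\<^sub>m (l-n-1)) (bdiag (1\<^sub>m n) (mat22 0 (-1/2) (-2) 0) (1\<^sub>m n)) (1\<^sub>m (l-n-1) :: 'a mat)"
    by (simp only: embed_eq[OF two])
  also have "\<dots> = bdiag (1\<^sub>m (l-n-1 + n)) (mat22 0 (-1/2) (-2) 0) (1\<^sub>m (n + (l-n-1)))"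
    by (simp only: bdiag_frame[of _ n _ 2] one_carrier_mat mat22_carrier four_block_one)
  also have "\<dots> = outer_twist l"
  proof -
    have "l-n-1 + n = l-1" "n + (l-n-1) = l-1" using n by auto
    then show ?thesis by (simp only: outer_twist_def)
  qed
  finally show ?thesis .
qed

lemma outer_twist_conj_embed:
  fixes g :: "'a::field mat"
  assumes "(2::'a) \<noteq> 0" "n \<le> l - 1" "1 \<le> l" "g \<in> carrier_mat (2*n+1) (2*n+1)"
  shows "outer_twist l * embed l n g * outer_twist l = embed l n (mid_refl n * g * mid_refl n)"
  using assms
  by (simp add: embed_mult mult_carrier_mat[of _ "2*n+1" "2*n+1" _ "2*n+1"] flip: embed_mid_refl[of n l])

section \<open>The unipotent group moved to the top left corner\<close>

text \<open>
  Conjugation by \<open>w_ln\<close> moves the embedded \<open>GL n\<close> to the leading coordinates.  There its unipotent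
  subgroup lies in \<open>U_SO (2*l)\<close> and the two characters agree.
\<close>

subsection \<open>The permutation\<close>

definition block_swap :: "nat \<Rightarrow> nat \<Rightarrow> 'a::field mat" where
  "block_swap n m = four_block_mat (0\<^sub>m n m) (1\<^sub>m n) (1\<^sub>m m) (0\<^sub>m m n)"

lemma block_swap_carrier [simp]: "p = n + m \<Longrightarrow> block_swap n m \<in> carrier_mat p p"
  by (auto simp: block_swap_def intro!: carrier_matI)

lemma block_swap_entry:
  assumes "i < n + m" "j < n + m"
  shows "block_swap n m $$ (i, j) = (if j = (if i < n then i + m else i - n) then 1 else 0)"
  using assms by (auto simp: block_swap_def)

lemma block_swap_mult: "block_swap n m * block_swap m n = 1\<^sub>m (n + m)"
proof -
  have "block_swap n m * block_swap m n = four_block_mat (1\<^sub>m n) (0\<^sub>m n m) (0\<^sub>m m n) (1\<^sub>m m)"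
    unfolding block_swap_def by (subst mult_four_block_mat[of _ n m _ n _ m _ _ n _ m]) auto
  then show ?thesis by (simp add: four_block_one)
qed

lemma transpose_block_swap: "transpose_mat (block_swap n m) = block_swap m n"
  by (rule eq_matI) (auto simp: block_swap_def)

lemma block_swap_mult_left:
  assumes "X \<in> carrier_mat (n+m) k" "i < n + m" "j < k"
  shows "(block_swap n m * X) $$ (i, j) = X $$ (if i < n then i + m else i - n, j)"
proof -
  have "(block_swap n m * X) $$ (i, j) = (\<Sum>c<n+m. block_swap n m $$ (i, c) * X $$ (c, j))"
    using assms by (intro times_mat_entry) auto
  also have "\<dots> = block_swap n m $$ (i, if i < n then i + m else i - n) * X $$ (if i < n then i + m else i - n, j)"
    using assms by (intro sum_single) (auto simp: block_swap_entry)
  finally show ?thesis using assms by (simp add: block_swap_entry split: if_splits)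
qed

text \<open>A block swap is a cyclic shift, and reversal conjugates it to its inverse.\<close>

lemma block_swap_form:
  "transpose_mat (block_swap n m) * antidiag (n+m) * block_swap m n = antidiag (n+m)"
proof -
  let ?N = "n + m"
  have c: "antidiag ?N * block_swap m n \<in> carrier_mat (m+n) (m+n)"
    using mult_carrier_mat[of "antidiag ?N" ?N ?N "block_swap m n" ?N] by (simp add: add.commute)
  have eq: "transpose_mat (block_swap n m) * antidiag ?N * block_swap m n
      = block_swap m n * (antidiag ?N * block_swap m n)"
    unfolding transpose_block_swap by (intro assoc_mult_mat[of _ ?N ?N _ ?N _ ?N]) auto
  show ?thesis unfolding eq
  proof (rule eq_matI)
    fix i j assume "i < dim_row (antidiag ?N)" "j < dim_col (antidiag ?N)"
    then have ij: "i < m + n" "j < m + n" by auto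
    define k where "k = (if i < m then i + n else i - m)"
    have k: "k < ?N" using ij by (auto simp: k_def)
    have "(block_swap m n * (antidiag ?N * block_swap m n)) $$ (i, j) = (antidiag ?N * block_swap m n) $$ (k, j)"
      unfolding k_def by (rule block_swap_mult_left[OF c ij])
    also have "\<dots> = block_swap m n $$ (?N - 1 - k, j)"
      using k ij by (intro antidiag_mult_left_entry[of _ _ ?N]) auto
    also have "\<dots> = antidiag ?N $$ (i, j)"
      using ij by (cases "i < m") (auto simp: block_swap_entry antidiag_entry k_def)
    finally show "(block_swap m n * (antidiag ?N * block_swap m n)) $$ (i, j) = antidiag ?N $$ (i, j)" .
  qed (auto simp: block_swap_def)
qed

lemma w_ln_eq: "w_ln l n = bdiag (block_swap n (l-n-1)) (1\<^sub>m 2) (block_swap (l-n-1) n)"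
  by (simp add: w_ln_def block_swap_def Let_def)

lemma w_ln_in_SO:
  assumes "n \<le> l - 1" "1 \<le> l"
  shows "w_ln l n \<in> carrier (SO (2*l) :: 'a::field mat monoid)"
  unfolding w_ln_eq
proof (rule bdiag_in_SO)
  let ?m = "l-n-1"
  show "2 * l = (n + ?m) + 2 + (n + ?m)" using assms by auto
  show "transpose_mat (block_swap n ?m) * antidiag (n + ?m) * block_swap ?m n = antidiag (n + ?m)"
    by (rule block_swap_form)
  have "det (block_swap n ?m * block_swap ?m n :: 'a mat) = 1" by (simp add: block_swap_mult)
  then show "det (block_swap n ?m) * det (1\<^sub>m 2) * det (block_swap ?m n) = (1 :: 'a)"
    by (simp add: det_mult[of _ "n + ?m"] add.commute)
qed (auto simp: add.commute right_mult_one_mat[of _ 2 2])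

subsection \<open>The Levi part\<close>

definition corner_levi :: "nat \<Rightarrow> nat \<Rightarrow> 'a::field mat \<Rightarrow> 'a mat" where
  "corner_levi l n a = (let m = l-n-1 in
     bdiag (four_block_mat a (0\<^sub>m n m) (0\<^sub>m m n) (1\<^sub>m m)) (1\<^sub>m 2)
       (four_block_mat (1\<^sub>m m) (0\<^sub>m m n) (0\<^sub>m n m) (star n a)))"

lemma insert_one_levi:
  assumes a: "a \<in> carrier (GL n)"
  shows "insert_one n (levi n a) = bdiag a (1\<^sub>m 2) (star n a)" (is "_ = ?R")
proof (rule eq_matI)
  have c: "a \<in> carrier_mat n n" "star n a \<in> carrier_mat n n" using a by (auto intro: GL_carrier)
  fix i j assume "i < dim_row ?R" "j < dim_col ?R"
  then have ij: "i < n + 2 + n" "j < n + 2 + n" using c by (auto simp: dim_diag_block_mat)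
  have "i < n \<or> i = n \<or> i = n + 1 \<or> (\<exists>k. i = n + 2 + k)" "j < n \<or> j = n \<or> j = n + 1 \<or> (\<exists>k. j = n + 2 + k)"
    by presburger+
  then show "insert_one n (levi n a) $$ (i, j) = ?R $$ (i, j)"
    unfolding bdiag_entry[OF c(1) one_carrier_mat c(2) ij] using ij
    by (elim disjE exE) (simp_all add: insert_one_entry levi_entry[OF a] delete_index_def)
qed (use star_carrier[OF a] GL_carrier[OF a] in \<open>auto simp: insert_one_def dim_diag_block_mat\<close>)

lemma embed_levi:
  fixes a :: "'a::field mat" and l n :: nat
  assumes two: "(2::'a) \<noteq> 0" and a: "a \<in> carrier (GL n)"
  defines "m \<equiv> l-n-1"
  shows "embed l n (levi n a) = bdiag (four_block_mat (1\<^sub>m m) (0\<^sub>m m n) (0\<^sub>m n m) a) (1\<^sub>m 2)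
     (four_block_mat (star n a) (0\<^sub>m n m) (0\<^sub>m m n) (1\<^sub>m m))"
proof -
  have c: "a \<in> carrier_mat n n" "star n a \<in> carrier_mat n n" using a by (auto intro: GL_carrier)
  have "M_inv n * insert_one n (levi n a) * M_mat n = bdiag a (1\<^sub>m 2) (star n a)"
    unfolding insert_one_levi[OF a] M_inv_def M_mat_eq using c
    by (simp only: bdiag_mult[of _ n _ 2 _ n] one_carrier_mat mat22_carrier mult_carrier_mat[of _ 2 2 _ 2]
        left_mult_one_mat[of _ n n] right_mult_one_mat[of _ n n] right_mult_one_mat[OF mat22_carrier] mat22_M_mult[OF two])
  then show ?thesis using c
    by (simp only: embed_eq[OF two] bdiag_frame[of _ n _ 2] one_carrier_mat m_def)
qed

lemma w_ln_embed_levi: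
  fixes a :: "'a::field mat"
  assumes two: "(2::'a) \<noteq> 0" and n: "n \<le> l - 1" "1 \<le> l" and a: "a \<in> carrier (GL n)"
  shows "w_ln l n * embed l n (levi n a) = corner_levi l n a * w_ln l n"
proof -
  let ?m = "l-n-1"
  have c: "a \<in> carrier_mat n n" "star n a \<in> carrier_mat n n" using a by (auto intro: GL_carrier)
  have e1: "block_swap n ?m * four_block_mat (1\<^sub>m ?m) (0\<^sub>m ?m n) (0\<^sub>m n ?m) a
      = four_block_mat a (0\<^sub>m n ?m) (0\<^sub>m ?m n) (1\<^sub>m ?m) * block_swap n ?m"
    unfolding block_swap_def using c
    by (simp add: mult_four_block_mat[of _ n ?m _ n _ ?m _ _ ?m _ n] mult_four_block_mat[of _ n n _ ?m _ ?m _ _ ?m _ n])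
  have e2: "block_swap ?m n * four_block_mat (star n a) (0\<^sub>m n ?m) (0\<^sub>m ?m n) (1\<^sub>m ?m)
      = four_block_mat (1\<^sub>m ?m) (0\<^sub>m ?m n) (0\<^sub>m n ?m) (star n a) * block_swap ?m n"
    unfolding block_swap_def using c
    by (simp add: mult_four_block_mat[of _ ?m n _ ?m _ n _ _ n _ ?m] mult_four_block_mat[of _ ?m ?m _ n _ n _ _ n _ ?m])
  have car: "four_block_mat (1\<^sub>m ?m) (0\<^sub>m ?m n) (0\<^sub>m n ?m) a \<in> carrier_mat (n + ?m) (n + ?m)"
    "four_block_mat a (0\<^sub>m n ?m) (0\<^sub>m ?m n) (1\<^sub>m ?m) \<in> carrier_mat (n + ?m) (n + ?m)"
    "four_block_mat (1\<^sub>m ?m) (0\<^sub>m ?m n) (0\<^sub>m n ?m) (star n a) \<in> carrier_mat (n + ?m) (n + ?m)"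
    "four_block_mat (star n a) (0\<^sub>m n ?m) (0\<^sub>m ?m n) (1\<^sub>m ?m) \<in> carrier_mat (n + ?m) (n + ?m)"
    "block_swap n ?m \<in> carrier_mat (n + ?m) (n + ?m)" "block_swap ?m n \<in> carrier_mat (n + ?m) (n + ?m)"
    using c by (auto intro!: carrier_matI)
  show ?thesis
    unfolding w_ln_eq embed_levi[OF two a] corner_levi_def Let_def
      bdiag_mult[OF car(5) one_carrier_mat car(6) car(1) one_carrier_mat car(4)]
      bdiag_mult[OF car(2) one_carrier_mat car(3) car(5) one_carrier_mat car(6)] e1 e2 ..
qed

lemma diag2_carrier:
  "A \<in> carrier_mat p p \<Longrightarrow> B \<in> carrier_mat q q \<Longrightarrow> k = p + q
    \<Longrightarrow> four_block_mat A (0\<^sub>m p q) (0\<^sub>m q p) B \<in> carrier_mat k k"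
  by (auto intro!: carrier_matI)

lemma corner_levi_SO:
  fixes a :: "'a::field mat"
  assumes two: "(2::'a) \<noteq> 0" and n: "n \<le> l - 1" "1 \<le> l" and a: "a \<in> carrier (GL n)"
  shows "corner_levi l n a \<in> carrier (SO (2*l))"
proof -
  let ?N = "2*l" and ?w = "w_ln l n :: 'a mat" and ?E = "embed l n (levi n a)" and ?T = "corner_levi l n a"
  have w: "?w \<in> carrier (SO ?N)" by (rule w_ln_in_SO[OF n])
  have E: "?E \<in> carrier (SO ?N)" by (rule embed_in_SO[OF two n levi_in_SO[OF a]])
  have c: "a \<in> carrier_mat n n" "star n a \<in> carrier_mat n n" using a by (auto intro: GL_carrier)
  have T: "?T \<in> carrier_mat ?N ?N"
    unfolding corner_levi_def Let_def using n c
    by (intro bdiag_carrier[of _ "l-1" _ 2 _ "l-1"] diag2_carrier) auto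
  have "?T = ?T * (?w * inv\<^bsub>SO ?N\<^esub> ?w)" using T by (simp add: SO_inv(3)[OF w])
  also have "\<dots> = ?T * ?w * inv\<^bsub>SO ?N\<^esub> ?w"
    using T w SO_inv(1)[OF w] by (intro assoc_mult_mat[of _ ?N ?N _ ?N _ ?N, symmetric]) (auto simp: SO_carrier)
  also have "\<dots> = ?w * ?E * inv\<^bsub>SO ?N\<^esub> ?w" by (simp only: w_ln_embed_levi[OF two n a])
  finally show ?thesis using w E SO_inv(1)[OF w] by (simp add: SO_mult)
qed

lemma corner_levi_mult:
  fixes a b :: "'a::field mat"
  assumes n: "n \<le> l - 1" "1 \<le> l" and "a \<in> carrier (GL n)" "b \<in> carrier (GL n)"
  shows "corner_levi l n (a * b) = corner_levi l n a * corner_levi l n b"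
proof -
  let ?m = "l-n-1"
  have c: "a \<in> carrier_mat n n" "star n a \<in> carrier_mat n n" "b \<in> carrier_mat n n" "star n b \<in> carrier_mat n n"
    using assms by (auto intro: GL_carrier)
  have d: "four_block_mat a (0\<^sub>m n ?m) (0\<^sub>m ?m n) (1\<^sub>m ?m) \<in> carrier_mat (l-1) (l-1)"
    "four_block_mat (1\<^sub>m ?m) (0\<^sub>m ?m n) (0\<^sub>m n ?m) (star n a) \<in> carrier_mat (l-1) (l-1)"
    "four_block_mat b (0\<^sub>m n ?m) (0\<^sub>m ?m n) (1\<^sub>m ?m) \<in> carrier_mat (l-1) (l-1)"
    "four_block_mat (1\<^sub>m ?m) (0\<^sub>m ?m n) (0\<^sub>m n ?m) (star n b) \<in> carrier_mat (l-1) (l-1)"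
    using c n by (auto intro!: diag2_carrier)
  show ?thesis
    unfolding corner_levi_def Let_def star_mult[OF assms(3,4)]
      bdiag_mult[OF d(1) one_carrier_mat d(2,3) one_carrier_mat d(4)]
      diag2_mult[OF c(1,3) one_carrier_mat one_carrier_mat] diag2_mult[OF one_carrier_mat one_carrier_mat c(2,4)]
      left_mult_one_mat[OF one_carrier_mat] ..
qed

lemma corner_levi_one:
  assumes n: "n \<le> l - 1" "1 \<le> l"
  shows "corner_levi l n (1\<^sub>m n) = (1\<^sub>m (2*l) :: 'a::field mat)"
proof -
  have "n + (l-n-1) + 2 + (l-n-1+n) = 2 * l" using n by auto
  then show ?thesis by (simp only: corner_levi_def Let_def star_one four_block_one bdiag_one)
qed

lemma corner_levi_entry:
  fixes a :: "'a::field mat"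
  assumes n: "n \<le> l - 1" "1 \<le> l" and a: "a \<in> U_GL n"
    and ij: "i < l-1" "j < 2*l"
  shows "corner_levi l n a $$ (i, j) = (if i < n \<and> j < n then a $$ (i, j) else if i = j then 1 else 0)"
proof -
  let ?m = "l-n-1"
  have aG: "a \<in> carrier (GL n)" using a by (rule U_GL_in_GL)
  have c: "a \<in> carrier_mat n n" "star n a \<in> carrier_mat n n" using aG by (auto intro: GL_carrier)
  have "i < (l-1) + 2 + (l-1)" "j < (l-1) + 2 + (l-1)" using ij n by auto
  then show ?thesis
    unfolding corner_levi_def Let_def using ij n c
    by (subst bdiag_entry[of _ "l-1" _ 2 _ "l-1"])
      (auto simp: diag2_carrier intro!: diag2_carrier)
qed

lemma corner_levi_U_SO:
  fixes a :: "'a::{field,finite} mat"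
  assumes two: "(2::'a) \<noteq> 0" and n: "n \<le> l - 1" "1 \<le> l" and a: "a \<in> U_GL n"
  shows "corner_levi l n a \<in> U_SO (2*l)"
proof -
  let ?m = "l-n-1"
  have aG: "a \<in> carrier (GL n)" using a by (rule U_GL_in_GL)
  have u: "a \<in> upper_unipotent n" "star n a \<in> upper_unipotent n"
    using a star_U_GL[OF a] by (auto simp: U_GL_eq)
  have c: "a \<in> carrier_mat n n" "star n a \<in> carrier_mat n n" using aG by (auto intro: GL_carrier)
  let ?A = "four_block_mat a (0\<^sub>m n ?m) (0\<^sub>m ?m n) (1\<^sub>m ?m)"
  let ?B = "four_block_mat (1\<^sub>m ?m) (0\<^sub>m ?m n) (0\<^sub>m n ?m) (star n a)"
  have AB: "?A \<in> carrier_mat (l-1) (l-1)" "?B \<in> carrier_mat (l-1) (l-1)"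
    using c n by (auto intro!: diag2_carrier)
  have A: "?A $$ (i, j) = (if i = j then 1 else 0)" if "i < l-1" "j \<le> i" for i j
    using that c n upper_unipotent_entry[OF u(1), of i j] by (auto simp: not_less)
  have B: "?B $$ (i, j) = (if i = j then 1 else 0)" if "i < l-1" "j \<le> i" for i j
    using that c n upper_unipotent_entry[OF u(2), of "i - ?m" "j - ?m"] by (auto simp: not_less)
  have T: "corner_levi l n a \<in> carrier (SO (2*l))" by (rule corner_levi_SO[OF two n aG])
  have "corner_levi l n a \<in> upper_unipotent (2*l)"
  proof (rule upper_unipotentI)
    show "corner_levi l n a \<in> carrier_mat (2*l) (2*l)" using T by (rule SO_carrier)
    fix i j assume ij: "i < 2*l" "j \<le> i"
    then have ij': "i < (l-1) + 2 + (l-1)" "j < (l-1) + 2 + (l-1)" using n by auto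
    show "corner_levi l n a $$ (i, j) = (if i = j then 1 else 0)"
      unfolding corner_levi_def Let_def bdiag_entry[OF AB(1) one_carrier_mat AB(2) ij']
      using ij A[of i j] B[of "i - (l-1) - 2" "j - (l-1) - 2"] by auto
  qed
  then show ?thesis using T by (simp add: U_SO_def)
qed

lemma psi_corner_levi:
  fixes a :: "'a::{field,finite} mat"
  assumes n: "1 \<le> n" "n \<le> l - 1" "1 \<le> l" and a: "a \<in> U_GL n"
  shows "psi_SO \<psi> l (corner_levi l n a) = psi_GL \<psi> n a"
proof -
  have l: "2 \<le> l" using n by simp
  note ent = corner_levi_entry[OF n(2,3) a]
  have "(\<Sum>i<l-2. corner_levi l n a $$ (i, i+1)) = (\<Sum>i<n-1. a $$ (i, i+1))"
  proof (rule sum.mono_neutral_cong_right)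
    show "\<forall>i\<in>{..<l-2} - {..<n-1}. corner_levi l n a $$ (i, i+1) = 0" by (auto simp: ent)
    show "\<And>i. i \<in> {..<n-1} \<Longrightarrow> corner_levi l n a $$ (i, i+1) = a $$ (i, i+1)"
      using n by (auto simp: ent)
  qed (use n in auto)
  moreover have "corner_levi l n a $$ (l-2, l-1) = 0" "corner_levi l n a $$ (l-2, l) = 0"
    using n l by (auto simp: ent)
  ultimately show ?thesis by (simp add: psi_SO_def psi_GL_def)
qed

subsection \<open>The subgroup R\<close>

lemma R_ln_bdiag:
  assumes n: "n \<le> l - 1" and r: "r \<in> R_ln l n"
  obtains A B where "A \<in> carrier_mat (l-1) (l-1)" "B \<in> carrier_mat (l-1) (l-1)" "r = bdiag A (1\<^sub>m 2) B"
proof -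
  let ?m = "l-n-1"
  obtain x x' where x: "x \<in> carrier_mat ?m n" "x' \<in> carrier_mat n ?m"
    and r: "r = bdiag (four_block_mat (1\<^sub>m n) (0\<^sub>m n ?m) x (1\<^sub>m ?m)) (1\<^sub>m 2)
          (four_block_mat (1\<^sub>m ?m) (0\<^sub>m ?m n) x' (1\<^sub>m n))"
    using r unfolding R_ln_def Let_def by blast
  show ?thesis
    by (rule that[OF _ _ r]) (use n x in \<open>auto intro!: carrier_matI\<close>)
qed

lemma R_ln_SO: "r \<in> R_ln l n \<Longrightarrow> r \<in> carrier (SO (2*l))"
  by (simp add: R_ln_def Let_def)

lemma corner_levi_conj_R_ln:
  fixes a b :: "'a::field mat"
  assumes two: "(2::'a) \<noteq> 0" and n: "n \<le> l - 1" "1 \<le> l"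
    and a: "a \<in> carrier (GL n)" and b: "b \<in> carrier (GL n)" and ba: "b * a = 1\<^sub>m n" and r: "r \<in> R_ln l n"
  shows "corner_levi l n b * r * corner_levi l n a \<in> R_ln l n"
proof -
  let ?m = "l-n-1"
  obtain x x' where x: "x \<in> carrier_mat ?m n" "x' \<in> carrier_mat n ?m"
    and req: "r = bdiag (four_block_mat (1\<^sub>m n) (0\<^sub>m n ?m) x (1\<^sub>m ?m)) (1\<^sub>m 2)
          (four_block_mat (1\<^sub>m ?m) (0\<^sub>m ?m n) x' (1\<^sub>m n))"
    using r unfolding R_ln_def Let_def by blast
  have c: "a \<in> carrier_mat n n" "star n a \<in> carrier_mat n n" "b \<in> carrier_mat n n" "star n b \<in> carrier_mat n n"
    using a b by (auto intro: GL_carrier)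
  have sba: "star n b * star n a = 1\<^sub>m n" using star_mult[OF b a] by (simp add: ba star_one)
  have xa: "x * a \<in> carrier_mat ?m n" "star n b * x' \<in> carrier_mat n ?m" using x c by auto
  have A: "four_block_mat b (0\<^sub>m n ?m) (0\<^sub>m ?m n) (1\<^sub>m ?m) * four_block_mat (1\<^sub>m n) (0\<^sub>m n ?m) x (1\<^sub>m ?m)
      * four_block_mat a (0\<^sub>m n ?m) (0\<^sub>m ?m n) (1\<^sub>m ?m) = four_block_mat (1\<^sub>m n) (0\<^sub>m n ?m) (x * a) (1\<^sub>m ?m)"
    using x c by (simp add: mult_four_block_mat[of _ n n _ ?m _ ?m _ _ n _ ?m] ba)
  have B: "four_block_mat (1\<^sub>m ?m) (0\<^sub>m ?m n) (0\<^sub>m n ?m) (star n b) * four_block_mat (1\<^sub>m ?m) (0\<^sub>m ?m n) x' (1\<^sub>m n)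
      * four_block_mat (1\<^sub>m ?m) (0\<^sub>m ?m n) (0\<^sub>m n ?m) (star n a) = four_block_mat (1\<^sub>m ?m) (0\<^sub>m ?m n) (star n b * x') (1\<^sub>m n)"
    using x c by (simp add: mult_four_block_mat[of _ ?m ?m _ n _ n _ _ ?m _ n] sba)
  have car: "four_block_mat b (0\<^sub>m n ?m) (0\<^sub>m ?m n) (1\<^sub>m ?m) \<in> carrier_mat (l-1) (l-1)"
    "four_block_mat a (0\<^sub>m n ?m) (0\<^sub>m ?m n) (1\<^sub>m ?m) \<in> carrier_mat (l-1) (l-1)"
    "four_block_mat (1\<^sub>m n) (0\<^sub>m n ?m) x (1\<^sub>m ?m) \<in> carrier_mat (l-1) (l-1)"
    "four_block_mat (1\<^sub>m ?m) (0\<^sub>m ?m n) (0\<^sub>m n ?m) (star n b) \<in> carrier_mat (l-1) (l-1)"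
    "four_block_mat (1\<^sub>m ?m) (0\<^sub>m ?m n) (0\<^sub>m n ?m) (star n a) \<in> carrier_mat (l-1) (l-1)"
    "four_block_mat (1\<^sub>m ?m) (0\<^sub>m ?m n) x' (1\<^sub>m n) \<in> carrier_mat (l-1) (l-1)"
    using x c n by (auto intro!: carrier_matI)
  have "corner_levi l n b * r * corner_levi l n a
      = bdiag (four_block_mat (1\<^sub>m n) (0\<^sub>m n ?m) (x * a) (1\<^sub>m ?m)) (1\<^sub>m 2)
          (four_block_mat (1\<^sub>m ?m) (0\<^sub>m ?m n) (star n b * x') (1\<^sub>m n))"
    unfolding corner_levi_def req Let_def using car mult_carrier_mat[OF car(1,3)] mult_carrier_mat[OF car(4,6)]
    by (simp only: bdiag_mult[of _ "l-1" _ 2 _ "l-1"] one_carrier_mat left_mult_one_mat[OF one_carrier_mat] A B)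
  moreover have "corner_levi l n b * r * corner_levi l n a \<in> carrier (SO (2*l))"
    using corner_levi_SO[OF two n a] corner_levi_SO[OF two n b] R_ln_SO[OF r] by (simp add: SO_mult)
  ultimately show ?thesis using xa unfolding R_ln_def Let_def by blast
qed

subsection \<open>The unipotent radical part\<close>

text \<open>
  The elements of \<open>SO (2*l)\<close> that arise from \<open>V_rad\<close> lie in the unipotent radical of the parabolic
  with Levi subgroup \<open>GL (l-1) \<times> SO 2\<close>.  That shape is stable under conjugation by the Levi subgroup,
  which contains \<open>R_ln\<close> and \<open>w_ln\<close>.  Expressed by the three coordinate projections, which commute
  with the Levi subgroup, stability is formal.
\<close>

definition proj :: "nat \<Rightarrow> nat \<Rightarrow> 'a::field mat" where
  "proj l b = mat_diag (2*l) (\<lambda>i. if (if i < l-1 then 0 else if i < l+1 then 1 else 2) = b then 1 else 0)"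

definition radical_shape :: "nat \<Rightarrow> 'a::field mat \<Rightarrow> bool" where
  "radical_shape l z \<longleftrightarrow> z \<in> carrier_mat (2*l) (2*l) \<and> z * proj l 0 = proj l 0
     \<and> proj l 2 * z = proj l 2 \<and> proj l 1 * z * proj l 1 = proj l 1"

lemma proj_carrier [simp]: "proj l b \<in> carrier_mat (2*l) (2*l)"
  by (simp add: proj_def)

lemma proj_commute:
  assumes "1 \<le> l" "A \<in> carrier_mat (l-1) (l-1)" "C \<in> carrier_mat 2 2" "B \<in> carrier_mat (l-1) (l-1)"
  shows "proj l b * bdiag A C B = bdiag A C B * proj l b"
proof -
  have c: "bdiag A C B \<in> carrier_mat (2*l) (2*l)"
    using assms by (intro bdiag_carrier[of _ "l-1" _ 2 _ "l-1"]) auto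
  show ?thesis
    unfolding proj_def mat_diag_mult_left[OF c] mat_diag_mult_right[OF c]
  proof (rule eq_matI)
    let ?f = "\<lambda>i. if (if i < l-1 then 0 else if i < l+1 then 1 else 2) = b then 1 else (0::'a)"
    fix i j assume "i < dim_row (mat (2*l) (2*l) (\<lambda>(i, j). bdiag A C B $$ (i, j) * ?f j))"
      "j < dim_col (mat (2*l) (2*l) (\<lambda>(i, j). bdiag A C B $$ (i, j) * ?f j))"
    then have ij: "i < 2*l" "j < 2*l" by auto
    then have ij': "i < (l-1) + 2 + (l-1)" "j < (l-1) + 2 + (l-1)" using assms(1) by auto
    obtain q where q: "l = q + 1" using assms(1) by (metis add.commute le_Suc_ex One_nat_def plus_1_eq_Suc)
    have q': "l - 1 = q" "l + 1 = q + 2" using q by auto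
    have "bdiag A C B $$ (i, j) = 0" if "?f i \<noteq> ?f j"
    proof -
      have "(i < q \<and> \<not> j < q) \<or> (\<not> i < q \<and> j < q) \<or> (i < q + 2 \<and> \<not> j < q + 2) \<or> (\<not> i < q + 2 \<and> j < q + 2)"
        using that unfolding q' by (auto split: if_splits)
      then show ?thesis
        unfolding bdiag_entry[OF assms(2-4) ij'] unfolding q' by auto
    qed
    then have "?f i * bdiag A C B $$ (i, j) = bdiag A C B $$ (i, j) * ?f j"
      by (cases "?f i = ?f j") (simp_all only: mult.commute mult_zero_left mult_zero_right if_False simp_thms)
    then show "mat (2*l) (2*l) (\<lambda>(i, j). ?f i * bdiag A C B $$ (i, j)) $$ (i, j)
        = mat (2*l) (2*l) (\<lambda>(i, j). bdiag A C B $$ (i, j) * ?f j) $$ (i, j)"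
      using ij by simp
  qed auto
qed

lemma radical_shape_iff:
  assumes z: "z \<in> carrier_mat (2*l) (2*l)"
  shows "radical_shape l z \<longleftrightarrow> (\<forall>i<2*l. \<forall>j<2*l. j < l-1 \<or> l < i \<or> (l-1 \<le> i \<and> i \<le> l \<and> l-1 \<le> j \<and> j \<le> l)
     \<longrightarrow> z $$ (i, j) = (if i = j then 1 else 0))" (is "_ \<longleftrightarrow> ?R")
proof -
  have cls: "(if i < l-1 then 0 else if i < l+1 then 1 else 2) = (0::nat) \<longleftrightarrow> i < l-1"
    "(if i < l-1 then 0 else if i < l+1 then 1 else 2) = (1::nat) \<longleftrightarrow> l-1 \<le> i \<and> i \<le> l"
    "(if i < l-1 then 0 else if i < l+1 then 1 else 2) = (2::nat) \<longleftrightarrow> l < i" for i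
    by auto
  have L: "proj l b * z = mat (2*l) (2*l) (\<lambda>(i, j). (if (if i < l-1 then 0 else if i < l+1 then 1 else 2) = b then 1 else 0) * z $$ (i, j))" for b
    unfolding proj_def by (rule mat_diag_mult_left[OF z])
  have R: "x * proj l b = mat (2*l) (2*l) (\<lambda>(i, j). x $$ (i, j) * (if (if j < l-1 then 0 else if j < l+1 then 1 else 2) = b then 1 else 0))"
    if "x \<in> carrier_mat (2*l) (2*l)" for x b
    unfolding proj_def by (rule mat_diag_mult_right[OF that])
  have eq: "A = B \<longleftrightarrow> (\<forall>i<2*l. \<forall>j<2*l. A $$ (i, j) = B $$ (i, j))"
    if "A \<in> carrier_mat (2*l) (2*l)" "B \<in> carrier_mat (2*l) (2*l)" for A B :: "'a mat"
    using that by (auto intro!: eq_matI)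
  have p: "proj l b $$ (i, j) = (if i = j then if (if i < l-1 then 0 else if i < l+1 then 1 else 2) = b then 1 else 0 else 0)"
    if "i < 2*l" "j < 2*l" for i j b using that by (simp add: proj_def mat_diag_def)
  have e0: "z * proj l 0 = proj l 0 \<longleftrightarrow> (\<forall>i<2*l. \<forall>j<2*l. j < l-1 \<longrightarrow> z $$ (i, j) = (if i = j then 1 else 0))"
    using z by (subst eq) (auto simp: R p cls)
  have e2: "proj l 2 * z = proj l 2 \<longleftrightarrow> (\<forall>i<2*l. \<forall>j<2*l. l < i \<longrightarrow> z $$ (i, j) = (if i = j then 1 else 0))"
    using z by (subst eq) (auto simp: L p cls)
  have e1: "proj l 1 * z * proj l 1 = proj l 1 \<longleftrightarrow> (\<forall>i<2*l. \<forall>j<2*l. l-1 \<le> i \<and> i \<le> l \<and> l-1 \<le> j \<and> j \<le> l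
      \<longrightarrow> z $$ (i, j) = (if i = j then 1 else 0))"
    unfolding L using z by (subst R, simp, subst eq) (auto simp: p cls)
  show ?thesis unfolding radical_shape_def e0 e1 e2 using z by blast
qed

lemma radical_shape_conj:
  assumes z: "radical_shape l z" and s: "s \<in> carrier_mat (2*l) (2*l)" and t: "t \<in> carrier_mat (2*l) (2*l)"
    and st: "s * t = 1\<^sub>m (2*l)" and ts: "t * s = 1\<^sub>m (2*l)"
    and comm: "\<And>b. proj l b * s = s * proj l b"
  shows "radical_shape l (s * z * t)"
proof -
  let ?N = "2*l"
  note [simp] = assoc_mult_mat[of _ ?N ?N _ ?N _ ?N] mult_carrier_mat[of _ ?N ?N _ ?N]
  have zc: "z \<in> carrier_mat ?N ?N" and z0: "z * proj l 0 = proj l 0" and z2: "proj l 2 * z = proj l 2"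
    and z1: "proj l 1 * z * proj l 1 = proj l 1"
    using z by (auto simp: radical_shape_def)
  have comm': "t * proj l b = proj l b * t" for b
  proof -
    have "t * proj l b = t * (proj l b * (s * t))"
      unfolding st using right_mult_one_mat[OF proj_carrier] by (rule arg_cong[OF sym])
    also have "\<dots> = t * (proj l b * s) * t" using s t by simp
    also have "\<dots> = (t * s) * (proj l b * t)" unfolding comm using s t by simp
    also have "\<dots> = proj l b * t"
      unfolding ts using t by (intro left_mult_one_mat[of _ ?N ?N] mult_carrier_mat[of _ ?N ?N _ ?N]) auto
    finally show ?thesis .
  qed
  have "s * z * t * proj l 0 = s * (z * proj l 0) * t" using s t zc by (simp add: comm')
  also have "\<dots> = s * (t * proj l 0)" unfolding z0 comm' using s t by simp
  also have "\<dots> = (s * t) * proj l 0" using s t by simp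
  also have "\<dots> = proj l 0" unfolding st by (rule left_mult_one_mat[OF proj_carrier])
  finally have 0: "s * z * t * proj l 0 = proj l 0" .
  have "proj l 2 * (s * z * t) = (proj l 2 * s) * z * t" using s t zc by simp
  also have "\<dots> = s * (proj l 2 * z) * t" unfolding comm using s t zc by simp
  also have "\<dots> = (proj l 2 * s) * t" unfolding z2 comm by simp
  also have "\<dots> = proj l 2 * (s * t)" using s t by simp
  also have "\<dots> = proj l 2" unfolding st by (rule right_mult_one_mat[OF proj_carrier])
  finally have 2: "proj l 2 * (s * z * t) = proj l 2" .
  have "proj l 1 * (s * z * t) * proj l 1 = (proj l 1 * s) * z * (t * proj l 1)" using s t zc by simp
  also have "\<dots> = s * (proj l 1 * z * proj l 1) * t" unfolding comm comm' using s t zc by simp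
  also have "\<dots> = (proj l 1 * s) * t" unfolding z1 comm by simp
  also have "\<dots> = proj l 1 * (s * t)" using s t by simp
  also have "\<dots> = proj l 1" unfolding st by (rule right_mult_one_mat[OF proj_carrier])
  finally have 1: "proj l 1 * (s * z * t) * proj l 1 = proj l 1" .
  show ?thesis unfolding radical_shape_def using 0 1 2 s t zc mult_carrier_mat[of _ ?N ?N _ ?N] by blast
qed

lemma radical_shape_U_SO:
  assumes "radical_shape l z" "z \<in> carrier (SO (2*l))"
  shows "z \<in> U_SO (2*l)"
proof -
  have zc: "z \<in> carrier_mat (2*l) (2*l)" using assms(2) by (rule SO_carrier)
  note ent = assms(1)[unfolded radical_shape_iff[OF zc], rule_format]
  have "z \<in> upper_unipotent (2*l)"
  proof (rule upper_unipotentI[OF zc])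
    fix i j assume ij: "i < 2*l" "j \<le> i"
    then show "z $$ (i, j) = (if i = j then 1 else 0)" by (intro ent) auto
  qed
  then show ?thesis using assms(2) by (simp add: U_SO_def)
qed

subsection \<open>The fixed vector\<close>

text \<open>
  The embedded \<open>SO (2*n+1)\<close> fixes the vector with the two middle coordinates \<open>1/4\<close> and \<open>-1/2\<close>.  These
  are the coefficients of the last two terms in the character of \<open>U_SO (2*l)\<close>, which therefore cancel
  on matrices that fix the vector.  To use the block calculus, the vector is written as a square
  matrix with one nonzero column.
\<close>

definition fixed_col :: "nat \<Rightarrow> 'a::field mat" where
  "fixed_col l = bdiag (0\<^sub>m (l-1) (l-1)) (mat22 (1/4) 0 (-1/2) 0) (0\<^sub>m (l-1) (l-1))"

lemma fixed_col_carrier [simp]: "1 \<le> l \<Longrightarrow> fixed_col l \<in> carrier_mat (2*l) (2*l)"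
  unfolding fixed_col_def by (intro bdiag_carrier[of _ "l-1" _ 2 _ "l-1"]) auto

lemma psi_SO_fixed_col:
  assumes l: "2 \<le> l" and z: "z \<in> carrier_mat (2*l) (2*l)" and fx: "z * fixed_col l = fixed_col l"
  shows "psi_SO \<psi> l z = \<psi> (\<Sum>i<l-2. z $$ (i, i+1))"
proof -
  have q: "fixed_col l $$ (c, l-1) = (if c = l-1 then 1/4 else if c = l then -1/2 else 0)"
    if "c < 2*l" for c
  proof -
    have ij: "c < (l-1) + 2 + (l-1)" "l-1 < (l-1) + 2 + (l-1)" using that l by auto
    have "c < l-1 \<or> c = l-1 \<or> c = l \<or> l < c" by auto
    then show ?thesis
      unfolding fixed_col_def bdiag_entry[OF zero_carrier_mat mat22_carrier zero_carrier_mat ij] using l ij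
      by (elim disjE) (simp_all add: mat22_entry)
  qed
  have "(z * fixed_col l) $$ (l-2, l-1) = (\<Sum>c<2*l. z $$ (l-2, c) * fixed_col l $$ (c, l-1))"
    using l by (intro times_mat_entry[OF z fixed_col_carrier]) auto
  also have "\<dots> = (\<Sum>c\<in>{l-1, l}. z $$ (l-2, c) * fixed_col l $$ (c, l-1))"
    using l by (intro sum.mono_neutral_right) (auto simp: q)
  also have "\<dots> = z $$ (l-2, l-1) * (1/4) + z $$ (l-2, l) * (-1/2)"
  proof -
    have "l - 1 \<noteq> l" using l by simp
    then show ?thesis using l by (simp add: q)
  qed
  also have "(z * fixed_col l) $$ (l-2, l-1) = 0" unfolding fx using l by (subst q) auto
  also have "z $$ (l-2, l-1) * (1/4) + z $$ (l-2, l) * (-1/2) = 1/4 * z $$ (l-2, l-1) - 1/2 * z $$ (l-2, l)"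
    by simp
  finally have "1/4 * z $$ (l-2, l-1) - 1/2 * z $$ (l-2, l) = 0" by (rule sym)
  then show ?thesis unfolding psi_SO_def add_diff_eq[symmetric] by (simp only: add_0_right)
qed

lemma bdiag_fixed_col:
  assumes "A \<in> carrier_mat (l-1) (l-1)" "B \<in> carrier_mat (l-1) (l-1)"
  shows "bdiag A (1\<^sub>m 2) B * fixed_col l = fixed_col l"
  using assms unfolding fixed_col_def
  by (simp add: bdiag_mult[of _ "l-1" _ 2 _ "l-1"] right_mult_zero_mat[of _ "l-1" "l-1"] left_mult_one_mat[of _ 2 2])

lemma M_frame:
  assumes "n \<le> l - 1" "1 \<le> l"
  shows "bdiag (1\<^sub>m (l-n-1)) (M_mat n) (1\<^sub>m (l-n-1)) = M_mat (l-1)"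
    and "bdiag (1\<^sub>m (l-n-1)) (M_inv n) (1\<^sub>m (l-n-1)) = M_inv (l-1)"
proof -
  have "l-n-1 + n = l-1" "n + (l-n-1) = l-1" using assms by auto
  then show "bdiag (1\<^sub>m (l-n-1)) (M_mat n) (1\<^sub>m (l-n-1)) = M_mat (l-1)"
    "bdiag (1\<^sub>m (l-n-1)) (M_inv n) (1\<^sub>m (l-n-1)) = M_inv (l-1)"
    unfolding M_mat_eq M_inv_def
    by (simp_all only: bdiag_frame[of _ n _ 2] one_carrier_mat mat22_carrier four_block_one)
qed

definition insert_frame :: "nat \<Rightarrow> nat \<Rightarrow> 'a::field mat \<Rightarrow> 'a mat" where
  "insert_frame l n g = bdiag (1\<^sub>m (l-n-1)) (insert_one n g) (1\<^sub>m (l-n-1))"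

lemma insert_frame_carrier: "n \<le> l - 1 \<Longrightarrow> 1 \<le> l \<Longrightarrow> insert_frame l n g \<in> carrier_mat (2*l) (2*l)"
  unfolding insert_frame_def using embed_size[of n l]
  by (intro bdiag_carrier[of _ "l-n-1" _ "2*n+2" _ "l-n-1"]) auto

lemma embed_eq_insert_frame:
  assumes two: "(2::'a::field) \<noteq> 0" and n: "n \<le> l - 1" "1 \<le> l"
  shows "embed l n (g :: 'a mat) = M_inv (l-1) * insert_frame l n g * M_mat (l-1)"
  unfolding embed_eq[OF two] insert_frame_def M_frame[OF n, symmetric]
  by (simp only: bdiag_mult[of _ "l-n-1" _ "2*n+2" _ "l-n-1"] one_carrier_mat M_carrier insert_one_carrier
      mult_carrier_mat[OF M_carrier(2) insert_one_carrier] left_mult_one_mat[OF one_carrier_mat])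

lemma embed_fixed_col:
  assumes two: "(2::'a::field) \<noteq> 0" and n: "n \<le> l - 1" "1 \<le> l"
  shows "embed l n (g :: 'a mat) * fixed_col l = fixed_col l"
proof -
  let ?N = "2*l"
  \<comment> \<open>in the basis given by \<open>M_mat\<close> the fixed vector is the inserted basis vector\<close>
  let ?P = "bdiag (0\<^sub>m (l-1) (l-1)) (mat22 1 0 0 0) (0\<^sub>m (l-1) (l-1)) :: 'a mat"
  have N: "2*(l-1)+2 = ?N" using n by simp
  have car: "(M_mat (l-1) :: 'a mat) \<in> carrier_mat ?N ?N" "(M_inv (l-1) :: 'a mat) \<in> carrier_mat ?N ?N"
    "insert_frame l n g \<in> carrier_mat ?N ?N" "?P \<in> carrier_mat ?N ?N" "(fixed_col l :: 'a mat) \<in> carrier_mat ?N ?N"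
    using M_carrier[of "l-1"] n insert_frame_carrier[OF n]
    by (auto simp: N intro!: bdiag_carrier[of _ "l-1" _ 2 _ "l-1"])
  have z: "1\<^sub>m (l-1) * 0\<^sub>m (l-1) (l-1) = (0\<^sub>m (l-1) (l-1) :: 'a mat)" by simp
  have 1: "mat22 2 (-1) 1 (1/2) * mat22 (1/4) 0 (-1/2) 0 = mat22 1 0 0 (0::'a)"
    unfolding mat22_mult using two powers_of_two_nonzero[OF two] by (intro mat22_eqI) (simp_all add: field_simps)
  have 2: "mat22 (1/4) (1/2) (-1/2) 1 * mat22 1 0 0 0 = mat22 (1/4) 0 (-1/2) (0::'a)"
    unfolding mat22_mult by (intro mat22_eqI) simp_all
  have MQ: "M_mat (l-1) * fixed_col l = ?P"
    unfolding M_mat_eq fixed_col_def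
      bdiag_mult[OF one_carrier_mat mat22_carrier one_carrier_mat zero_carrier_mat mat22_carrier zero_carrier_mat] z 1 ..
  have MP: "M_inv (l-1) * ?P = fixed_col l"
    unfolding M_inv_def fixed_col_def
      bdiag_mult[OF one_carrier_mat mat22_carrier one_carrier_mat zero_carrier_mat mat22_carrier zero_carrier_mat] z 2 ..
  have GP: "insert_frame l n g * ?P = ?P"
  proof (rule eq_matI)
    have P: "?P $$ (c, j) = (if c = l-1 \<and> j = l-1 then 1 else 0)" if "c < ?N" "j < ?N" for c j
    proof -
      have cj: "c < (l-1) + 2 + (l-1)" "j < (l-1) + 2 + (l-1)" using that n by auto
      have "c < l-1 \<or> c = l-1 \<or> c = l-1+1 \<or> l-1+2 \<le> c" "j < l-1 \<or> j = l-1 \<or> j = l-1+1 \<or> l-1+2 \<le> j"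
        by linarith+
      then show ?thesis
        unfolding bdiag_entry[OF zero_carrier_mat mat22_carrier zero_carrier_mat cj]
        using cj by (elim disjE) (simp_all add: mat22_entry)
    qed
    fix i j assume "i < dim_row ?P" "j < dim_col ?P"
    then have ij: "i < ?N" "j < ?N" using car(4) by auto
    have G: "insert_frame l n g $$ (i, l-1) = (if i = l-1 then 1 else 0)"
    proof -
      have i': "i < (l-n-1) + (2*n+2) + (l-n-1)" "l-1 < (l-n-1) + (2*n+2) + (l-n-1)" using ij n by auto
      have e: "l - 1 - (l-n-1) = n" using n by auto
      show ?thesis
        unfolding insert_frame_def bdiag_entry[OF one_carrier_mat insert_one_carrier one_carrier_mat i'] e
        using n ij by (auto simp: insert_one_entry)
    qed
    have "(insert_frame l n g * ?P) $$ (i, j) = (\<Sum>c<?N. insert_frame l n g $$ (i, c) * ?P $$ (c, j))"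
      by (rule times_mat_entry[OF car(3,4) ij])
    also have "\<dots> = insert_frame l n g $$ (i, l-1) * ?P $$ (l-1, j)"
      using n ij by (intro sum_single) (auto simp: P)
    also have "\<dots> = ?P $$ (i, j)" using n ij by (auto simp: P G)
    finally show "(insert_frame l n g * ?P) $$ (i, j) = ?P $$ (i, j)" .
  qed (use car in auto)
  have "embed l n g * fixed_col l = M_inv (l-1) * (insert_frame l n g * (M_mat (l-1) * fixed_col l))"
    unfolding embed_eq_insert_frame[OF two n] using car
    by (simp add: assoc_mult_mat[of _ ?N ?N _ ?N _ ?N] mult_carrier_mat[of _ ?N ?N _ ?N])
  then show ?thesis unfolding MQ GP MP .
qed

lemma V_rad_entry:
  assumes v: "v \<in> V_rad n" and ij: "i < 2*n+1" "j < 2*n+1" and "j < n \<or> n < i \<or> i = n \<and> j = n"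
  shows "v $$ (i, j) = (if i = j then 1 else 0)"
proof -
  obtain X y where "X \<in> carrier_mat n (n+1)" "y \<in> carrier_mat 1 n"
    and v: "v = four_block_mat (1\<^sub>m n) X (0\<^sub>m (n+1) n) (four_block_mat (1\<^sub>m 1) y (0\<^sub>m n 1) (1\<^sub>m n))"
    using v by (auto simp: V_rad_def)
  then show ?thesis unfolding v using assms(2-) by (elim disjE conjE) auto
qed

lemma insert_one_V_rad_entry:
  assumes v: "v \<in> V_rad n" and ij: "i < 2*n+2" "j < 2*n+2"
    and "j < n \<or> n + 1 < i \<or> (n \<le> i \<and> i \<le> n+1 \<and> n \<le> j \<and> j \<le> n+1)"
  shows "insert_one n v $$ (i, j) = (if i = j then 1 else 0)"
proof (cases "i = n \<or> j = n")
  case True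
  then show ?thesis using ij by (auto simp: insert_one_entry)
next
  case False
  then have "delete_index n j < n \<or> n < delete_index n i \<or> delete_index n i = n \<and> delete_index n j = n"
    using assms(4) by (auto simp: delete_index_def)
  moreover have "delete_index n i = delete_index n j \<longleftrightarrow> i = j" using False by (auto simp: delete_index_def)
  ultimately show ?thesis
    using False ij V_rad_entry[OF v, of "delete_index n i" "delete_index n j"]
    by (simp add: insert_one_entry delete_index_less)
qed

lemma insert_frame_radical_shape:
  assumes n: "n \<le> l - 1" "1 \<le> l" and v: "v \<in> V_rad n"
  shows "radical_shape l (insert_frame l n v)"
  unfolding radical_shape_iff[OF insert_frame_carrier[OF n]]
proof (intro allI impI)
  fix i j assume ij: "i < 2*l" "j < 2*l"
    and c: "j < l-1 \<or> l < i \<or> (l-1 \<le> i \<and> i \<le> l \<and> l-1 \<le> j \<and> j \<le> l)"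
  obtain m where l: "l = m + n + 1" using n by (metis Suc_eq_plus1 add.commute le_Suc_ex le_add_diff_inverse)
  have m: "l - n - 1 = m" using l by simp
  have ij': "i < m + (2*n+2) + m" "j < m + (2*n+2) + m" using ij l by auto
  have ins: "insert_one n v $$ (i - m, j - m) = (if i = j then 1 else 0)"
    if "m \<le> i" "i < m + (2*n+2)" "m \<le> j" "j < m + (2*n+2)"
  proof -
    have "j - m < n \<or> n + 1 < i - m \<or> (n \<le> i - m \<and> i - m \<le> n+1 \<and> n \<le> j - m \<and> j - m \<le> n+1)"
      using c that l by auto
    then have "insert_one n v $$ (i - m, j - m) = (if i - m = j - m then 1 else 0)"
      using that by (intro insert_one_V_rad_entry[OF v]) auto
    then show ?thesis using that by (simp add: eq_diff_iff)
  qed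
  have "i < m \<or> m \<le> i \<and> i < m + (2*n+2) \<or> (\<exists>k. i = m + (2*n+2) + k)"
    "j < m \<or> m \<le> j \<and> j < m + (2*n+2) \<or> (\<exists>k. j = m + (2*n+2) + k)" by presburger+
  then show "insert_frame l n v $$ (i, j) = (if i = j then 1 else 0)"
    unfolding insert_frame_def m bdiag_entry[OF one_carrier_mat insert_one_carrier one_carrier_mat ij']
    using ij' by (elim disjE exE conjE) (simp_all add: ins)
qed

text \<open>In the basis given by \<open>M_mat\<close> the image of \<open>V_rad\<close> visibly has the shape of the radical, and both
  \<open>s\<close> and \<open>M_mat\<close> are block diagonal.  The shape kills the first \<open>l-2\<close> terms of the character and the
  fixed vector kills the rest.\<close>

lemma conj_embed_V_rad:
  fixes s v :: "'a::field mat"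
  assumes two: "(2::'a) \<noteq> 0" and n: "1 \<le> n" "n \<le> l - 1" and v: "v \<in> V_rad n"
    and s: "s \<in> carrier (SO (2*l))" and sAB: "s = bdiag A (1\<^sub>m 2) B"
    and A: "A \<in> carrier_mat (l-1) (l-1)" and B: "B \<in> carrier_mat (l-1) (l-1)" and psi: "\<psi> 0 = 1"
  defines "z \<equiv> s * embed l n v * inv\<^bsub>SO (2*l)\<^esub> s"
  shows "z \<in> U_SO (2*l)" and "psi_SO \<psi> l z = 1"
proof -
  let ?N = "2*l" and ?t = "inv\<^bsub>SO (2*l)\<^esub> s" and ?M = "M_mat (l-1) :: 'a mat" and ?Mi = "M_inv (l-1) :: 'a mat"
  have l: "2 \<le> l" "1 \<le> l" using n by auto
  have N: "2*(l-1)+2 = ?N" using l by simp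
  note t = SO_inv[OF s]
  note [simp] = assoc_mult_mat[of _ ?N ?N _ ?N _ ?N] mult_carrier_mat[of _ ?N ?N _ ?N]
  have car: "s \<in> carrier_mat ?N ?N" "?t \<in> carrier_mat ?N ?N" "?M \<in> carrier_mat ?N ?N" "?Mi \<in> carrier_mat ?N ?N"
    "insert_frame l n v \<in> carrier_mat ?N ?N" "embed l n v \<in> carrier_mat ?N ?N" "(fixed_col l :: 'a mat) \<in> carrier_mat ?N ?N"
    using s t(1) M_carrier[of "l-1"] insert_frame_carrier[OF n(2) l(2)] embed_carrier[OF two n(2) l(2)] l
    by (auto simp: N SO_carrier)
  have MM: "?M * ?Mi = 1\<^sub>m ?N" "?Mi * ?M = 1\<^sub>m ?N" using M_mult[OF two, of "l-1"] by (simp_all only: N)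
  have zSO: "z \<in> carrier (SO ?N)"
    unfolding z_def using s t(1) embed_in_SO[OF two n(2) l(2) V_rad_SO[OF v]] by (simp add: SO_mult)
  have "radical_shape l ((s * ?Mi) * insert_frame l n v * (?M * ?t))"
  proof (rule radical_shape_conj[OF insert_frame_radical_shape[OF n(2) l(2) v]])
    have "(s * ?Mi) * (?M * ?t) = s * ((?Mi * ?M) * ?t)" using car by simp
    then show "(s * ?Mi) * (?M * ?t) = 1\<^sub>m ?N" unfolding MM left_mult_one_mat[OF car(2)] t(3) .
    have "(?M * ?t) * (s * ?Mi) = ?M * ((?t * s) * ?Mi)" using car by simp
    then show "(?M * ?t) * (s * ?Mi) = 1\<^sub>m ?N" unfolding t(2) left_mult_one_mat[OF car(4)] MM .
    fix b
    have 1: "proj l b * s = s * proj l b" unfolding sAB by (rule proj_commute[OF l(2) A _ B]) simp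
    have 2: "proj l b * ?Mi = ?Mi * proj l b" unfolding M_inv_def by (rule proj_commute[OF l(2)]) simp_all
    have "proj l b * (s * ?Mi) = (proj l b * s) * ?Mi" using car by simp
    also have "\<dots> = s * (proj l b * ?Mi)" unfolding 1 using car by simp
    also have "\<dots> = (s * ?Mi) * proj l b" unfolding 2 using car by simp
    finally show "proj l b * (s * ?Mi) = (s * ?Mi) * proj l b" .
  qed (use car in simp_all)
  also have "(s * ?Mi) * insert_frame l n v * (?M * ?t) = z"
    unfolding z_def embed_eq_insert_frame[OF two n(2) l(2)] using car by simp
  finally have shape: "radical_shape l z" .
  then show "z \<in> U_SO ?N" using zSO by (rule radical_shape_U_SO)
  have zc: "z \<in> carrier_mat ?N ?N" using zSO by (rule SO_carrier)
  have sQ: "s * fixed_col l = fixed_col l" unfolding sAB by (rule bdiag_fixed_col[OF A B])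
  have "?t * fixed_col l = ?t * (s * fixed_col l)" by (simp only: sQ)
  also have "\<dots> = (?t * s) * fixed_col l" using car by simp
  also have "\<dots> = fixed_col l" unfolding t(2) by (rule left_mult_one_mat[OF car(7)])
  finally have tQ: "?t * fixed_col l = fixed_col l" .
  have "z * fixed_col l = s * (embed l n v * (?t * fixed_col l))" unfolding z_def using car by simp
  then have "z * fixed_col l = fixed_col l" unfolding tQ embed_fixed_col[OF two n(2) l(2)] sQ .
  then have "psi_SO \<psi> l z = \<psi> (\<Sum>i<l-2. z $$ (i, i+1))" by (rule psi_SO_fixed_col[OF l(1) zc])
  also have "(\<Sum>i<l-2. z $$ (i, i+1)) = 0"
  proof (rule sum.neutral, rule ballI)
    fix i assume "i \<in> {..<l-2}"
    then have "z $$ (i, i+1) = (if i = i+1 then 1 else 0)"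
      by (intro shape[unfolded radical_shape_iff[OF zc], rule_format]) auto
    then show "z $$ (i, i+1) = 0" by simp
  qed
  finally show "psi_SO \<psi> l z = 1" using psi by simp
qed

section \<open>Equivariance of the summands of the zeta sum\<close>

definition zeta_inner :: "nat \<Rightarrow> nat \<Rightarrow> ('a::field mat \<Rightarrow> complex) \<Rightarrow> 'a mat \<Rightarrow> complex" where
  "zeta_inner l n W g = (\<Sum>r\<in>R_ln l n. W (r * w_ln l n * embed l n g * inv\<^bsub>SO (2*l)\<^esub> (w_ln l n)))"

definition W_equivariant :: "('a::field \<Rightarrow> complex) \<Rightarrow> nat \<Rightarrow> ('a mat \<Rightarrow> complex) \<Rightarrow> bool" where
  "W_equivariant \<psi> l W \<longleftrightarrow> (\<forall>u\<in>U_SO (2*l). \<forall>h\<in>carrier (SO (2*l)). W (u * h) = psi_SO \<psi> l u * W h)"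

text \<open>Once the Levi element has been moved to the left past \<open>w_ln\<close>, it has to pass \<open>r\<close>.  It normalises
  \<open>R_ln\<close>, so a change of variable in the inner sum absorbs the conjugation.\<close>

lemma zeta_inner_levi:
  fixes \<psi> :: "'a::{field,finite} \<Rightarrow> complex"
  assumes two: "(2::'a) \<noteq> 0" and n: "1 \<le> n" "n \<le> l - 1" and W: "W_equivariant \<psi> l W"
    and a: "a \<in> U_GL n" and g: "g \<in> carrier (SO (2*n+1))"
  shows "zeta_inner l n W (levi n a * g) = psi_GL \<psi> n a * zeta_inner l n W g"
proof -
  let ?N = "2*l" and ?w = "w_ln l n :: 'a mat" and ?iw = "inv\<^bsub>SO (2*l)\<^esub> (w_ln l n) :: 'a mat"
  let ?b = "inv\<^bsub>GL n\<^esub> a" and ?T = "corner_levi l n"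
  have l: "1 \<le> l" using n by auto
  note [simp] = assoc_mult_mat[of _ ?N ?N _ ?N _ ?N] mult_carrier_mat[of _ ?N ?N _ ?N]
  have aG: "a \<in> carrier (GL n)" using a by (rule U_GL_in_GL)
  have bG: "?b \<in> carrier (GL n)" by (rule GL_inv(1)[OF aG])
  have lev: "levi n a \<in> carrier (SO (2*n+1))" by (rule levi_in_SO[OF aG])
  have w: "?w \<in> carrier (SO ?N)" "?iw \<in> carrier (SO ?N)"
    using w_ln_in_SO[OF n(2) l] SO_inv(1) by auto
  have E: "embed l n g \<in> carrier (SO ?N)" "embed l n (levi n a) \<in> carrier (SO ?N)"
    using embed_in_SO[OF two n(2) l] g lev by auto
  have T: "?T a \<in> carrier (SO ?N)" "?T ?b \<in> carrier (SO ?N)"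
    using corner_levi_SO[OF two n(2) l] aG bG by auto
  have TT: "?T a * ?T ?b = 1\<^sub>m ?N" "?T ?b * ?T a = 1\<^sub>m ?N"
    using corner_levi_mult[OF n(2) l aG bG] corner_levi_mult[OF n(2) l bG aG]
    by (simp_all add: GL_inv[OF aG] corner_levi_one[OF n(2) l])
  have car: "?w \<in> carrier_mat ?N ?N" "?iw \<in> carrier_mat ?N ?N" "embed l n g \<in> carrier_mat ?N ?N"
    "embed l n (levi n a) \<in> carrier_mat ?N ?N" "?T a \<in> carrier_mat ?N ?N" "?T ?b \<in> carrier_mat ?N ?N"
    using w E T by (auto simp: SO_carrier)
  have cancel: "?T a * (?T ?b * X) = X" "?T ?b * (?T a * X) = X" if "X \<in> carrier_mat ?N ?N" for X
  proof -
    have "?T a * (?T ?b * X) = (?T a * ?T ?b) * X" using car that by simp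
    then show "?T a * (?T ?b * X) = X" unfolding TT left_mult_one_mat[OF that] .
    have "?T ?b * (?T a * X) = (?T ?b * ?T a) * X" using car that by simp
    then show "?T ?b * (?T a * X) = X" unfolding TT left_mult_one_mat[OF that] .
  qed
  have cancel': "X * ?T a * ?T ?b = X" "X * ?T ?b * ?T a = X" if "X \<in> carrier_mat ?N ?N" for X
  proof -
    show "X * ?T a * ?T ?b = X"
      unfolding assoc_mult_mat[OF that car(5,6)] TT right_mult_one_mat[OF that] ..
    show "X * ?T ?b * ?T a = X"
      unfolding assoc_mult_mat[OF that car(6,5)] TT right_mult_one_mat[OF that] ..
  qed
  have step: "W (r * ?w * embed l n (levi n a * g) * ?iw)
      = psi_GL \<psi> n a * W ((?T ?b * r * ?T a) * ?w * embed l n g * ?iw)" if r: "r \<in> R_ln l n" for r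
  proof -
    have rS: "r \<in> carrier (SO ?N)" and rc: "r \<in> carrier_mat ?N ?N" using R_ln_SO[OF r] by (auto simp: SO_carrier)
    have "r * ?w * embed l n (levi n a * g) * ?iw = r * (?w * embed l n (levi n a)) * embed l n g * ?iw"
      unfolding embed_mult[OF two SO_carrier[OF lev] SO_carrier[OF g]] using car rc by simp
    also have "\<dots> = r * (?T a * ?w) * embed l n g * ?iw" unfolding w_ln_embed_levi[OF two n(2) l aG] ..
    also have "\<dots> = ?T a * ((?T ?b * r * ?T a) * ?w * embed l n g * ?iw)"
      using car rc cancel(1)[of "r * (?T a * (?w * (embed l n g * ?iw)))"] by simp
    finally have eq: "r * ?w * embed l n (levi n a * g) * ?iw = ?T a * ((?T ?b * r * ?T a) * ?w * embed l n g * ?iw)" .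
    have "(?T ?b * r * ?T a) * ?w * embed l n g * ?iw \<in> carrier (SO ?N)"
      by (intro SO_mult T rS w E)
    then show ?thesis
      unfolding eq using W corner_levi_U_SO[OF two n(2) l a] psi_corner_levi[OF n l a]
      by (simp add: W_equivariant_def del: assoc_mult_mat)
  qed
  have "zeta_inner l n W (levi n a * g)
      = (\<Sum>r\<in>R_ln l n. psi_GL \<psi> n a * W ((?T ?b * r * ?T a) * ?w * embed l n g * ?iw))"
    unfolding zeta_inner_def by (rule sum.cong[OF refl step])
  also have "\<dots> = (\<Sum>r\<in>R_ln l n. psi_GL \<psi> n a * W (r * ?w * embed l n g * ?iw))"
  proof (rule sum.reindex_bij_witness[of _ "\<lambda>r. ?T a * r * ?T ?b" "\<lambda>r. ?T ?b * r * ?T a"])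
    fix r :: "'a mat" assume r: "r \<in> R_ln l n"
    have rc: "r \<in> carrier_mat ?N ?N" using R_ln_SO[OF r] by (rule SO_carrier)
    show "?T a * r * ?T ?b \<in> R_ln l n" "?T ?b * r * ?T a \<in> R_ln l n"
      using corner_levi_conj_R_ln[OF two n(2) l _ _ _ r] aG bG GL_inv[OF aG] by auto
    have "?T a * (?T ?b * r * ?T a) * ?T ?b = (?T a * (?T ?b * r)) * ?T a * ?T ?b" using car rc by simp
    then show "?T a * (?T ?b * r * ?T a) * ?T ?b = r" unfolding cancel(1)[OF rc] cancel'(1)[OF rc] .
    have "?T ?b * (?T a * r * ?T ?b) * ?T a = (?T ?b * (?T a * r)) * ?T ?b * ?T a" using car rc by simp
    then show "?T ?b * (?T a * r * ?T ?b) * ?T a = r" unfolding cancel(2)[OF rc] cancel'(2)[OF rc] .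
  qed simp
  finally show ?thesis by (simp only: zeta_inner_def sum_distrib_left)
qed

text \<open>Each summand is invariant, because conjugation by \<open>r * w_ln\<close>
  carries the image of \<open>v\<close> into the kernel of the character of \<open>U_SO (2*l)\<close>.\<close>

lemma zeta_inner_V_rad:
  fixes \<psi> :: "'a::{field,finite} \<Rightarrow> complex"
  assumes two: "(2::'a) \<noteq> 0" and n: "1 \<le> n" "n \<le> l - 1" and W: "W_equivariant \<psi> l W" and psi: "\<psi> 0 = 1"
    and v: "v \<in> V_rad n" and g: "g \<in> carrier (SO (2*n+1))"
  shows "zeta_inner l n W (v * g) = zeta_inner l n W g"
  unfolding zeta_inner_def
proof (rule sum.cong)
  let ?N = "2*l" and ?w = "w_ln l n :: 'a mat" and ?iw = "inv\<^bsub>SO (2*l)\<^esub> (w_ln l n) :: 'a mat"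
  note [simp] = assoc_mult_mat[of _ ?N ?N _ ?N _ ?N] mult_carrier_mat[of _ ?N ?N _ ?N]
  have l: "1 \<le> l" using n by auto
  have w: "?w \<in> carrier (SO ?N)" "?iw \<in> carrier (SO ?N)" using w_ln_in_SO[OF n(2) l] SO_inv(1) by auto
  have E: "embed l n g \<in> carrier (SO ?N)" "embed l n v \<in> carrier (SO ?N)"
    using embed_in_SO[OF two n(2) l] g V_rad_SO[OF v] by auto
  fix r :: "'a mat" assume r: "r \<in> R_ln l n"
  let ?s = "r * ?w" and ?t = "inv\<^bsub>SO (2*l)\<^esub> (r * ?w)"
  obtain A B where AB: "A \<in> carrier_mat (l-1) (l-1)" "B \<in> carrier_mat (l-1) (l-1)" "r = bdiag A (1\<^sub>m 2) B"
    using R_ln_bdiag[OF n(2) r] by blast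
  have sw: "block_swap n (l-n-1) \<in> carrier_mat (l-1) (l-1)" "block_swap (l-n-1) n \<in> carrier_mat (l-1) (l-1)"
    using n by auto
  have seq: "?s = bdiag (A * block_swap n (l-n-1)) (1\<^sub>m 2) (B * block_swap (l-n-1) n)"
    unfolding AB(3) w_ln_eq bdiag_mult[OF AB(1) one_carrier_mat AB(2) sw(1) one_carrier_mat sw(2)]
      left_mult_one_mat[OF one_carrier_mat] ..
  have s: "?s \<in> carrier (SO ?N)" by (rule SO_mult[OF R_ln_SO[OF r] w(1)])
  note t = SO_inv[OF s]
  have car: "?s \<in> carrier_mat ?N ?N" "?t \<in> carrier_mat ?N ?N" "?iw \<in> carrier_mat ?N ?N"
    "embed l n g \<in> carrier_mat ?N ?N" "embed l n v \<in> carrier_mat ?N ?N"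
    using s t(1) w E by (auto simp: SO_carrier)
  note z = conj_embed_V_rad[where \<psi>=\<psi>, OF two n v s seq mult_carrier_mat[OF AB(1) sw(1)] mult_carrier_mat[OF AB(2) sw(2)] psi]
  have "?s * embed l n (v * g) * ?iw = ?s * (embed l n v * (1\<^sub>m ?N * (embed l n g * ?iw)))"
    unfolding embed_mult[OF two SO_carrier[OF V_rad_SO[OF v]] SO_carrier[OF g]] using car(3-5)
      R_ln_SO[OF r, THEN SO_carrier] w[THEN SO_carrier] by simp
  also have "\<dots> = ?s * (embed l n v * ((?t * ?s) * (embed l n g * ?iw)))" unfolding t(2) ..
  also have "\<dots> = (?s * embed l n v * ?t) * (?s * embed l n g * ?iw)"
    using car R_ln_SO[OF r, THEN SO_carrier] w[THEN SO_carrier] by simp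
  finally have eq: "?s * embed l n (v * g) * ?iw = (?s * embed l n v * ?t) * (?s * embed l n g * ?iw)" .
  have "?s * embed l n g * ?iw \<in> carrier (SO ?N)" by (intro SO_mult s E w)
  then show "W (r * ?w * embed l n (v * g) * ?iw) = W (r * ?w * embed l n g * ?iw)"
    unfolding eq using W z by (simp add: W_equivariant_def del: assoc_mult_mat)
qed simp

lemma zeta_inner_equivariant:
  fixes \<psi> :: "'a::{field,finite} \<Rightarrow> complex"
  assumes two: "(2::'a) \<noteq> 0" and n: "1 \<le> n" "n \<le> l - 1" and W: "W_equivariant \<psi> l W" and psi: "\<psi> 0 = 1"
    and u: "u \<in> U_SO (2*n+1)" and g: "g \<in> carrier (SO (2*n+1))"
  shows "zeta_inner l n W (u * g) = psi_GL \<psi> n (top_left n u) * zeta_inner l n W g"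
proof -
  let ?N = "2*n+1" and ?a = "top_left n u"
  obtain v where v: "v \<in> V_rad n" and uv: "u = levi n ?a * v" using u by (rule U_SO_decomp)
  have a: "?a \<in> U_GL n" using u by (rule top_left_U_GL)
  have vg: "v * g \<in> carrier (SO ?N)" by (rule SO_mult[OF V_rad_SO[OF v] g])
  have "u * g = levi n ?a * (v * g)"
    using V_rad_SO[OF v] g levi_in_SO[OF U_GL_in_GL[OF a]]
    by (subst uv) (simp add: SO_carrier assoc_mult_mat[of _ ?N ?N _ ?N _ ?N])
  then show ?thesis
    using zeta_inner_levi[OF two n W a vg] zeta_inner_V_rad[OF two n W psi v g] by simp
qed

definition f_equivariant :: "('a::field \<Rightarrow> complex) \<Rightarrow> nat \<Rightarrow> ('a mat \<Rightarrow> 'a mat \<Rightarrow> complex) \<Rightarrow> bool" where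
  "f_equivariant \<psi> n f \<longleftrightarrow> (\<forall>u\<in>U_SO (2*n+1). \<forall>g\<in>carrier (SO (2*n+1)).
     f (u * g) (1\<^sub>m n) = inverse (psi_GL \<psi> n (top_left n u)) * f g (1\<^sub>m n))"

text \<open>The two properties of elements of \<open>Ind_whittaker\<close> that matter for zeta sums: equivariance under the
  parabolic in the first argument and under \<open>U_GL\<close> in the second.\<close>

lemma Ind_whittaker_levi:
  assumes \<tau>: "fd_representation (GL n) scale \<tau>" and f: "f \<in> Ind_whittaker n \<tau> \<Lambda>"
    and a: "a \<in> carrier (GL n)" and b: "b \<in> carrier (GL n)" and v: "v \<in> V_rad n" and g: "g \<in> carrier (SO (2*n+1))"
  shows "f (levi n b * v * g) a = f g (a * b)"
proof -
  interpret fd_representation "GL n" scale \<tau> by (rule \<tau>)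
  obtain S k where S: "S \<subseteq> Ind n \<tau>" and f: "f = (\<lambda>g a. \<Sum>\<xi>\<in>S. k \<xi> * f_xi \<tau> \<Lambda> \<xi> g a)"
    using f by (auto simp: Ind_whittaker_def)
  show ?thesis unfolding f
  proof (rule sum.cong[OF refl])
    fix \<xi> assume "\<xi> \<in> S"
    then have "\<xi> (levi n b * v * g) = \<tau> b (\<xi> g)" using S b v g by (auto simp: Ind_def)
    then show "k \<xi> * f_xi \<tau> \<Lambda> \<xi> (levi n b * v * g) a = k \<xi> * f_xi \<tau> \<Lambda> \<xi> g (a * b)"
      using rep_mult[OF a b] by (simp add: f_xi_def)
  qed
qed

lemma Ind_whittaker_U_GL:
  assumes \<tau>: "fd_representation (GL n) scale \<tau>" and f: "f \<in> Ind_whittaker n \<tau> \<Lambda>"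
    and \<Lambda>: "\<Lambda> \<in> Hom_char scale \<tau> (U_GL n) (\<lambda>u. inverse (psi_GL \<psi> n u))"
    and a: "a \<in> carrier (GL n)" and c: "c \<in> U_GL n"
  shows "f g (c * a) = inverse (psi_GL \<psi> n c) * f g a"
proof -
  interpret fd_representation "GL n" scale \<tau> by (rule \<tau>)
  obtain S k where f: "f = (\<lambda>g a. \<Sum>\<xi>\<in>S. k \<xi> * f_xi \<tau> \<Lambda> \<xi> g a)"
    using f by (auto simp: Ind_whittaker_def)
  show ?thesis unfolding f sum_distrib_left
  proof (rule sum.cong[OF refl])
    fix \<xi>
    have "\<tau> (c * a) (\<xi> g) = \<tau> c (\<tau> a (\<xi> g))" using rep_mult[OF U_GL_in_GL[OF c] a] by simp
    moreover have "\<Lambda> (\<tau> c v) = inverse (psi_GL \<psi> n c) * \<Lambda> v" for v using \<Lambda> c by (auto simp: Hom_char_def)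
    ultimately show "k \<xi> * f_xi \<tau> \<Lambda> \<xi> g (c * a) = inverse (psi_GL \<psi> n c) * (k \<xi> * f_xi \<tau> \<Lambda> \<xi> g a)"
      by (simp add: f_xi_def)
  qed
qed

lemma Ind_whittaker_equivariant:
  fixes \<tau> :: "'a::{field,finite} mat \<Rightarrow> 'w::ab_group_add \<Rightarrow> 'w"
  assumes \<tau>: "fd_representation (GL n) scale \<tau>" and f: "f \<in> Ind_whittaker n \<tau> \<Lambda>"
    and \<Lambda>: "\<Lambda> \<in> Hom_char scale \<tau> (U_GL n) (\<lambda>u. inverse (psi_GL \<psi> n u))"
  shows "f_equivariant \<psi> n f"
  unfolding f_equivariant_def
proof (intro ballI)
  fix u g :: "'a mat" assume u: "u \<in> U_SO (2*n+1)" and g: "g \<in> carrier (SO (2*n+1))"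
  obtain v where v: "v \<in> V_rad n" and uv: "u = levi n (top_left n u) * v" using u by (rule U_SO_decomp)
  have a: "top_left n u \<in> U_GL n" using u by (rule top_left_U_GL)
  have aG: "top_left n u \<in> carrier (GL n)" using a by (rule U_GL_in_GL)
  have "f (levi n (top_left n u) * v * g) (1\<^sub>m n) = f g (1\<^sub>m n * top_left n u)"
    by (rule Ind_whittaker_levi[OF \<tau> f GL_one aG v g])
  also have "1\<^sub>m n * top_left n u = top_left n u * 1\<^sub>m n" using GL_carrier[OF aG] by simp
  also have "f g \<dots> = inverse (psi_GL \<psi> n (top_left n u)) * f g (1\<^sub>m n)"
    by (rule Ind_whittaker_U_GL[OF \<tau> f \<Lambda> GL_one a])
  finally show "f (u * g) (1\<^sub>m n) = inverse (psi_GL \<psi> n (top_left n u)) * f g (1\<^sub>m n)"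
    using uv by simp
qed

text \<open>
  The intertwining operator preserves the equivariance: \<open>w_n\<close> conjugates \<open>levi n b\<close> to \<open>levi n (star n b)\<close>,
  and this is undone by the \<open>star\<close> and \<open>d_n\<close> in the second argument.
\<close>

lemma intertwine_equivariant:
  fixes \<tau> :: "'a::{field,finite} mat \<Rightarrow> 'w::ab_group_add \<Rightarrow> 'w"
  assumes \<tau>: "fd_representation (GL n) scale \<tau>" and f: "f \<in> Ind_whittaker n \<tau> \<Lambda>"
    and \<Lambda>: "\<Lambda> \<in> Hom_char scale \<tau> (U_GL n) (\<lambda>u. inverse (psi_GL \<psi> n u))"
  shows "f_equivariant \<psi> n (intertwine n f)"
  unfolding f_equivariant_def
proof (intro ballI)
  let ?N = "2*n+1"
  note [simp] = assoc_mult_mat[of _ ?N ?N _ ?N _ ?N] mult_carrier_mat[of _ ?N ?N _ ?N]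
  fix u h :: "'a mat" assume u: "u \<in> U_SO ?N" and h: "h \<in> carrier (SO ?N)"
  define b where "b = top_left n u"
  define b' where "b' = inv\<^bsub>GL n\<^esub> b"
  obtain v0 where v0: "v0 \<in> V_rad n" and uv: "u = levi n b * v0"
    using u unfolding b_def by (rule U_SO_decomp)
  define v1 where "v1 = inv\<^bsub>SO ?N\<^esub> v0"
  have v1: "v1 \<in> V_rad n" unfolding v1_def by (rule V_rad_inv[OF v0])
  have b: "b \<in> U_GL n" unfolding b_def using u by (rule top_left_U_GL)
  have b': "b' \<in> U_GL n" unfolding b'_def using subgroup.m_inv_closed[OF subgroup_U_GL b] .
  have bG: "b \<in> carrier (GL n)" "b' \<in> carrier (GL n)" using b b' by (auto intro: U_GL_in_GL)
  have bb: "b * b' = 1\<^sub>m n" "b' * b = 1\<^sub>m n" unfolding b'_def using GL_inv[OF bG(1)] by auto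
  let ?L = "levi n b" and ?L' = "levi n b'"
  have LL: "?L * ?L' = 1\<^sub>m ?N" "?L' * ?L = 1\<^sub>m ?N"
    using levi_mult[OF bG] levi_mult[OF bG(2,1)] by (simp_all add: bb levi_one)
  have vv: "v0 * v1 = 1\<^sub>m ?N" "v1 * v0 = 1\<^sub>m ?N" unfolding v1_def using SO_inv[OF V_rad_SO[OF v0]] by auto
  have car: "?L \<in> carrier_mat ?N ?N" "?L' \<in> carrier_mat ?N ?N" "v0 \<in> carrier_mat ?N ?N" "v1 \<in> carrier_mat ?N ?N"
    "h \<in> carrier_mat ?N ?N" "(w_n n :: 'a mat) \<in> carrier_mat ?N ?N" "levi n (star n b) \<in> carrier_mat ?N ?N"
    using levi_in_SO[OF bG(1)] levi_in_SO[OF bG(2)] V_rad_SO[OF v0] V_rad_SO[OF v1] h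
      levi_in_SO[OF star_in_GL[OF bG(1)]] by (auto simp: SO_carrier w_n_carrier)
  have cancel: "?L * (?L' * X) = X" "?L' * (?L * X) = X" if "X \<in> carrier_mat ?N ?N" for X
    unfolding assoc_mult_mat[OF car(1,2) that, symmetric] assoc_mult_mat[OF car(2,1) that, symmetric]
      LL left_mult_one_mat[OF that] by (rule refl)+
  have cancelr: "X * ?L * ?L' = X" "X * ?L' * ?L = X" "X * v0 * v1 = X" "X * v1 * v0 = X"
    if "X \<in> carrier_mat ?N ?N" for X
    unfolding assoc_mult_mat[OF that car(1,2)] assoc_mult_mat[OF that car(2,1)]
      assoc_mult_mat[OF that car(3,4)] assoc_mult_mat[OF that car(4,3)]
      LL vv right_mult_one_mat[OF that] by (rule refl)+
  have d: "d_n n * star n (1\<^sub>m n) = (d_n n :: 'a mat)"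
    by (simp add: star_one right_mult_one_mat[of _ n n] d_n_def)
  have step: "f (w_n n * v * (u * h)) (d_n n) = inverse (psi_GL \<psi> n b) * f (w_n n * (?L' * v * ?L * v0) * h) (d_n n)"
    if v: "v \<in> V_rad n" for v
  proof -
    let ?v = "?L' * v * ?L * v0"
    have vc: "v \<in> carrier_mat ?N ?N" using V_rad_SO[OF v] by (rule SO_carrier)
    have v': "?v \<in> V_rad n" by (rule V_rad_mult[OF levi_conj_V_rad[OF b' b bb(2) v] v0])
    have vc': "?v \<in> carrier_mat ?N ?N" using V_rad_SO[OF v'] by (rule SO_carrier)
    have "?L * ?v = v * ?L * v0" using cancel(1)[of "v * (?L * v0)"] vc car by simp
    then have "w_n n * v * (u * h) = w_n n * (?L * ?v) * h" unfolding uv using vc car by simp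
    also have "\<dots> = (w_n n * ?L) * (?v * h)" using vc' car by simp
    also have "\<dots> = levi n (star n b) * 1\<^sub>m ?N * (w_n n * ?v * h)"
      unfolding w_n_levi[OF bG(1)] right_mult_one_mat[OF car(7)] using vc' car by simp
    finally have eq: "w_n n * v * (u * h) = levi n (star n b) * 1\<^sub>m ?N * (w_n n * ?v * h)" .
    have g: "w_n n * ?v * h \<in> carrier (SO ?N)" by (intro SO_mult w_n_in_SO V_rad_SO v' h)
    have "f (w_n n * v * (u * h)) (d_n n) = f (w_n n * ?v * h) (d_n n * star n b)"
      unfolding eq by (rule Ind_whittaker_levi[OF \<tau> f d_n_in_GL star_in_GL[OF bG(1)] V_rad_one g])
    also have "\<dots> = f (w_n n * ?v * h) (d_n n * star n b * d_n n * d_n n)" by (subst d_n_star(3)[OF b]) (rule refl)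
    also have "\<dots> = inverse (psi_GL \<psi> n (d_n n * star n b * d_n n)) * f (w_n n * ?v * h) (d_n n)"
      by (rule Ind_whittaker_U_GL[OF \<tau> f \<Lambda> d_n_in_GL d_n_star(1)[OF b]])
    finally show ?thesis unfolding d_n_star(2)[OF b] .
  qed
  have "intertwine n f (u * h) (1\<^sub>m n)
      = (\<Sum>v\<in>V_rad n. inverse (psi_GL \<psi> n b) * f (w_n n * (?L' * v * ?L * v0) * h) (d_n n))"
    unfolding intertwine_def d by (rule sum.cong[OF refl step])
  also have "\<dots> = (\<Sum>v\<in>V_rad n. inverse (psi_GL \<psi> n b) * f (w_n n * v * h) (d_n n))"
  proof (rule sum.reindex_bij_witness[of _ "\<lambda>v. ?L * (v * v1) * ?L'" "\<lambda>v. ?L' * v * ?L * v0"])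
    fix v :: "'a mat" assume v: "v \<in> V_rad n"
    have vc: "v \<in> carrier_mat ?N ?N" using V_rad_SO[OF v] by (rule SO_carrier)
    show "?L' * v * ?L * v0 \<in> V_rad n" by (rule V_rad_mult[OF levi_conj_V_rad[OF b' b bb(2) v] v0])
    show "?L * (v * v1) * ?L' \<in> V_rad n" by (rule levi_conj_V_rad[OF b b' bb(1) V_rad_mult[OF v v1]])
    have "?L * (?L' * v * ?L * v0 * v1) * ?L' = ?L * (?L' * v * ?L) * ?L'"
      using vc car by (subst cancelr(3)) simp_all
    also have "\<dots> = ?L * (?L' * (v * ?L)) * ?L'" using vc car by simp
    also have "\<dots> = v" using vc car by (subst cancel(1), simp) (rule cancelr(1)[OF vc])
    finally show "?L * (?L' * v * ?L * v0 * v1) * ?L' = v" .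
    have "?L' * (?L * (v * v1) * ?L') * ?L * v0 = (?L' * (?L * (v * v1 * ?L'))) * ?L * v0" using vc car by simp
    also have "\<dots> = v * v1 * ?L' * ?L * v0" using vc car by (subst cancel(2)) simp_all
    also have "\<dots> = v" using vc car by (subst cancelr(2), simp) (rule cancelr(4)[OF vc])
    finally show "?L' * (?L * (v * v1) * ?L') * ?L * v0 = v" .
  qed simp
  finally show "intertwine n f (u * h) (1\<^sub>m n) = inverse (psi_GL \<psi> n (top_left n u)) * intertwine n f h (1\<^sub>m n)"
    unfolding intertwine_def d b_def sum_distrib_left .
qed

section \<open>Conjugation by the reflection on the induced space\<close>

text \<open>Conjugation by \<open>mid_refl\<close>, extended by the identity to matrices of other sizes in order to be
  an involution on the whole type: functions in \<open>Ind\<close> are functions on the whole type, and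
  precomposition must be injective on them.\<close>

definition refl_conj :: "nat \<Rightarrow> 'a::field mat \<Rightarrow> 'a mat" where
  "refl_conj n g = (if g \<in> carrier_mat (2*n+1) (2*n+1) then mid_refl n * g * mid_refl n else g)"

lemma refl_conj_refl_conj [simp]: "refl_conj n (refl_conj n g) = g"
  by (auto simp: refl_conj_def mid_refl_conj_conj)

lemma refl_conj_SO: "g \<in> carrier (SO (2*n+1)) \<Longrightarrow> refl_conj n g \<in> carrier (SO (2*n+1))"
  by (simp add: refl_conj_def SO_carrier mid_refl_conj_SO)

lemma refl_conj_V_rad: "v \<in> V_rad n \<Longrightarrow> refl_conj n v \<in> V_rad n"
  by (simp add: refl_conj_def SO_carrier[OF V_rad_SO] mid_refl_conj_V_rad)

lemma refl_conj_U_SO: "u \<in> U_SO (2*n+1) \<Longrightarrow> refl_conj n u \<in> U_SO (2*n+1)"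
  by (simp add: refl_conj_def U_SO_carrier mid_refl_conj_U_SO)

lemma refl_conj_mult:
  "g \<in> carrier (SO (2*n+1)) \<Longrightarrow> h \<in> carrier (SO (2*n+1)) \<Longrightarrow> refl_conj n (g * h) = refl_conj n g * refl_conj n h"
  using SO_carrier[of g "2*n+1"] SO_carrier[of h "2*n+1"]
  by (simp add: refl_conj_def mid_refl_conj_mult mult_carrier_mat[of _ "2*n+1" "2*n+1" _ "2*n+1"])

lemma refl_conj_levi: "a \<in> carrier (GL n) \<Longrightarrow> refl_conj n (levi n a) = levi n a"
  by (simp add: refl_conj_def mid_refl_conj_levi)

lemma refl_conj_w_n: "refl_conj n (w_n n) = w_n n"
  by (simp add: refl_conj_def mid_refl_conj_w_n)

lemma Ind_refl_conj:
  assumes "\<xi> \<in> Ind n \<tau>"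
  shows "(\<lambda>g. \<xi> (refl_conj n g)) \<in> Ind n \<tau>"
  unfolding Ind_def
proof (clarify)
  fix a u g :: "'a mat" assume a: "a \<in> carrier (GL n)" and u: "u \<in> V_rad n" and g: "g \<in> carrier (SO (2*n+1))"
  have "refl_conj n (levi n a * u * g) = levi n a * refl_conj n u * refl_conj n g"
    using levi_in_SO[OF a] V_rad_SO[OF u] g by (simp add: refl_conj_mult SO_mult refl_conj_levi[OF a])
  then show "\<xi> (refl_conj n (levi n a * u * g)) = \<tau> a (\<xi> (refl_conj n g))"
    using assms a refl_conj_V_rad[OF u] refl_conj_SO[OF g] by (simp add: Ind_def)
qed

lemma Ind_whittaker_refl_conj:
  assumes "f \<in> Ind_whittaker n \<tau> \<Lambda>"
  shows "(\<lambda>g. f (refl_conj n g)) \<in> Ind_whittaker n \<tau> \<Lambda>"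
proof -
  obtain S k where S: "finite S" "S \<subseteq> Ind n \<tau>" and f: "f = (\<lambda>g a. \<Sum>\<xi>\<in>S. k \<xi> * f_xi \<tau> \<Lambda> \<xi> g a)"
    using assms by (auto simp: Ind_whittaker_def)
  let ?c = "\<lambda>\<xi> g. \<xi> (refl_conj n g)"
  have cc: "?c (?c \<xi>) = \<xi>" for \<xi> :: "'a mat \<Rightarrow> 'b" by simp
  have "(\<Sum>\<xi>\<in>S. k \<xi> * f_xi \<tau> \<Lambda> \<xi> (refl_conj n g) a) = (\<Sum>\<xi>\<in>?c ` S. k (?c \<xi>) * f_xi \<tau> \<Lambda> \<xi> g a)" for g a
    by (rule sum.reindex_bij_witness[of _ ?c ?c]) (auto simp: f_xi_def cc)
  then have eq: "(\<lambda>g. f (refl_conj n g)) = (\<lambda>g a. \<Sum>\<xi>\<in>?c ` S. k (?c \<xi>) * f_xi \<tau> \<Lambda> \<xi> g a)" by (simp add: f)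
  have fin: "finite (?c ` S)" "?c ` S \<subseteq> Ind n \<tau>" using S Ind_refl_conj by auto
  show ?thesis unfolding Ind_whittaker_def
    by (rule CollectI, rule exI[of _ "?c ` S"], rule exI[of _ "\<lambda>\<xi>. k (?c \<xi>)"], intro conjI eq fin)
qed

lemma intertwine_refl_conj:
  assumes "h \<in> carrier (SO (2*n+1))"
  shows "intertwine n (\<lambda>g. f (refl_conj n g)) h = intertwine n f (refl_conj n h)"
proof
  fix a
  have "(\<Sum>u\<in>V_rad n. f (refl_conj n (w_n n * u * h)) (d_n n * star n a))
      = (\<Sum>u\<in>V_rad n. f (w_n n * u * refl_conj n h) (d_n n * star n a))"
    using assms by (intro sum.reindex_bij_witness[of _ "refl_conj n" "refl_conj n"])
      (auto simp: refl_conj_V_rad refl_conj_mult w_n_in_SO V_rad_SO SO_mult refl_conj_w_n)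
  then show "intertwine n (\<lambda>g. f (refl_conj n g)) h a = intertwine n f (refl_conj n h) a"
    by (simp add: intertwine_def)
qed

section \<open>Conjugation of zeta sums\<close>

lemma zeta_eq_inner:
  "zeta l n W f = (\<Sum>C \<in> rcosets\<^bsub>SO (2*n+1)\<^esub> (U_SO (2*n+1)).
     zeta_inner l n W (SOME g. g \<in> C) * f (SOME g. g \<in> C) (1\<^sub>m n))"
  by (simp add: zeta_def zeta_inner_def Let_def)

lemma additive_character_nonzero: "additive_character \<psi> \<Longrightarrow> \<psi> x \<noteq> 0"
  unfolding additive_character_def by (metis add.right_inverse mult_zero_left zero_neq_one)

text \<open>
  Conjugation by \<open>mid_refl\<close> permutes the cosets of \<open>U_SO\<close>, but does not respect the chosen
  representatives; invariance of the summand makes the choice irrelevant.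
\<close>

lemma sum_rcosets_refl_conj:
  fixes H :: "'a::{field,finite} mat \<Rightarrow> complex"
  assumes inv: "\<And>u g. u \<in> U_SO (2*n+1) \<Longrightarrow> g \<in> carrier (SO (2*n+1)) \<Longrightarrow> H (u * g) = H g"
  shows "(\<Sum>C \<in> rcosets\<^bsub>SO (2*n+1)\<^esub> (U_SO (2*n+1)). H (refl_conj n (SOME g. g \<in> C)))
       = (\<Sum>C \<in> rcosets\<^bsub>SO (2*n+1)\<^esub> (U_SO (2*n+1)). H (SOME g. g \<in> C))"
proof -
  let ?G = "SO (2*n+1) :: 'a mat monoid" and ?U = "U_SO (2*n+1) :: 'a mat set"
  let ?c = "\<lambda>C. refl_conj n ` C"
  have coset: "(?U #>\<^bsub>?G\<^esub> x) = (\<lambda>u. u * x) ` ?U" for x by (auto simp: r_coset_def)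
  have conj: "?c (?U #>\<^bsub>?G\<^esub> x) = ?U #>\<^bsub>?G\<^esub> refl_conj n x" if x: "x \<in> carrier ?G" for x
  proof -
    have "refl_conj n ` ?U = ?U"
      using refl_conj_U_SO by (force intro!: image_eqI[of _ _ "refl_conj n _"])
    moreover have "refl_conj n ` (\<lambda>u. u * x) ` ?U = (\<lambda>u. u * refl_conj n x) ` refl_conj n ` ?U"
      unfolding image_image using x by (intro image_cong) (auto simp: refl_conj_mult U_SO_def)
    ultimately show ?thesis by (simp add: coset)
  qed
  have cc: "?c (?c C) = C" for C :: "'a mat set" by (simp add: image_image)
  have closed: "?c C \<in> rcosets\<^bsub>?G\<^esub> ?U" if "C \<in> rcosets\<^bsub>?G\<^esub> ?U" for C
    using that conj refl_conj_SO by (fastforce simp: RCOSETS_def)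
  have rep: "H (refl_conj n (SOME g. g \<in> C)) = H (SOME g. g \<in> ?c C)" if C: "C \<in> rcosets\<^bsub>?G\<^esub> ?U" for C
  proof -
    obtain x where x: "x \<in> carrier ?G" and Cx: "C = ?U #>\<^bsub>?G\<^esub> x" using C by (auto simp: RCOSETS_def)
    have const: "H y = H (refl_conj n x)" if "y \<in> ?c C" for y
    proof -
      have "y \<in> ?U #>\<^bsub>?G\<^esub> refl_conj n x" using that by (simp add: Cx conj[OF x])
      then have "y \<in> (\<lambda>u. u * refl_conj n x) ` ?U" by (simp only: coset)
      then show ?thesis using inv refl_conj_SO[OF x] by auto
    qed
    have "x \<in> C" unfolding Cx coset
      using subgroup.one_closed[OF subgroup_U_SO] SO_carrier[OF x]
      by (intro image_eqI[of _ _ "1\<^sub>m (2*n+1)"]) (auto simp: left_mult_one_mat)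
    then have "(SOME g. g \<in> C) \<in> C" "(SOME g. g \<in> ?c C) \<in> ?c C" by (auto intro: someI)
    then show ?thesis using const by auto
  qed
  show ?thesis
    by (rule sum.reindex_bij_witness[of _ ?c ?c]) (auto simp: cc closed rep)
qed

lemma rcoset_rep_in_SO:
  fixes C :: "'a::{field,finite} mat set"
  assumes "C \<in> rcosets\<^bsub>SO (2*n+1)\<^esub> (U_SO (2*n+1))"
  shows "(SOME g. g \<in> C) \<in> carrier (SO (2*n+1))"
proof -
  obtain x where x: "x \<in> carrier (SO (2*n+1))" and C: "C = (\<Union>u\<in>U_SO (2*n+1). {u * x})"
    using assms by (auto simp: RCOSETS_def r_coset_def)
  have "C \<noteq> {}" using C subgroup.one_closed[OF subgroup_U_SO[of "2*n+1", where 'a='a]] by blast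
  then have "(SOME g. g \<in> C) \<in> C" by (simp add: some_in_eq)
  then show ?thesis using x by (auto simp: C U_SO_def SO_mult)
qed

lemma zeta_cong:
  fixes W :: "'a::{field,finite} mat \<Rightarrow> complex"
  assumes "\<And>g. g \<in> carrier (SO (2*n+1)) \<Longrightarrow> f g = f' g"
  shows "zeta l n W f = zeta l n W f'"
  unfolding zeta_eq_inner by (rule sum.cong) (auto simp: assms rcoset_rep_in_SO)

text \<open>In each argument \<open>r * w_ln * embed g * w_ln\<^sup>-\<^sup>1\<close> of \<open>W\<close>, the reflection commutes with all factors but
  \<open>embed g\<close>, where it turns \<open>g\<close> into \<open>refl_conj n g\<close>; substituting for \<open>g\<close> moves it to \<open>f\<close>.\<close>

lemma zeta_twist:
  fixes \<psi> :: "'a::{field,finite} \<Rightarrow> complex"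
  assumes two: "(2::'a) \<noteq> 0" and n: "1 \<le> n" "n \<le> l - 1" and psi: "additive_character \<psi>"
    and W: "W_equivariant \<psi> l W"
    and W': "\<And>g. g \<in> carrier (SO (2*l)) \<Longrightarrow> W' g = W (outer_twist l * g * outer_twist l)"
    and f: "f_equivariant \<psi> n (\<lambda>g. f (refl_conj n g))"
  shows "zeta l n W' f = zeta l n W (\<lambda>g. f (refl_conj n g))"
proof -
  let ?N = "2*l" and ?k = "outer_twist l :: 'a mat" and ?w = "w_ln l n :: 'a mat"
  let ?iw = "inv\<^bsub>SO (2*l)\<^esub> (w_ln l n) :: 'a mat"
  have l: "1 \<le> l" using n by auto
  note [simp] = assoc_mult_mat[of _ ?N ?N _ ?N _ ?N] mult_carrier_mat[of _ ?N ?N _ ?N]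
  have w: "?w \<in> carrier (SO ?N)" "?iw \<in> carrier (SO ?N)" using w_ln_in_SO[OF n(2) l] SO_inv(1) by auto
  have k: "?k \<in> carrier_mat ?N ?N" using l by simp
  have kk: "?k * ?k = 1\<^sub>m ?N" by (rule outer_twist_square[OF two l])
  have bs: "block_swap n (l-n-1) \<in> carrier_mat (l-1) (l-1)" "block_swap (l-n-1) n \<in> carrier_mat (l-1) (l-1)"
    using n by auto
  have kw: "?k * ?w = ?w * ?k" unfolding w_ln_eq by (rule outer_twist_commute[OF bs])
  have wc: "?w \<in> carrier_mat ?N ?N" "?iw \<in> carrier_mat ?N ?N" using w by (auto simp: SO_carrier)
  have iww: "?iw * ?w = 1\<^sub>m ?N" "?w * ?iw = 1\<^sub>m ?N" using SO_inv[OF w(1)] by auto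
  have kiw: "?iw * ?k = ?k * ?iw"
  proof -
    have "?iw * ?k = ?iw * ?k * (?w * ?iw)" unfolding iww using k wc by (simp add: right_mult_one_mat[of _ ?N ?N])
    also have "\<dots> = ?iw * (?k * ?w) * ?iw" using k wc by simp
    also have "\<dots> = (?iw * ?w) * (?k * ?iw)" unfolding kw using k wc by simp
    also have "\<dots> = ?k * ?iw" unfolding iww using k wc by (intro left_mult_one_mat[of _ ?N ?N]) simp
    finally show ?thesis .
  qed
  have inner: "zeta_inner l n W' g = zeta_inner l n W (refl_conj n g)" if g: "g \<in> carrier (SO (2*n+1))" for g
    unfolding zeta_inner_def
  proof (rule sum.cong)
    fix r :: "'a mat" assume r: "r \<in> R_ln l n"
    have E: "embed l n g \<in> carrier (SO ?N)" by (rule embed_in_SO[OF two n(2) l g])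
    have rS: "r \<in> carrier (SO ?N)" by (rule R_ln_SO[OF r])
    have car: "r \<in> carrier_mat ?N ?N" "embed l n g \<in> carrier_mat ?N ?N" using rS E by (auto simp: SO_carrier)
    obtain A B where AB: "A \<in> carrier_mat (l-1) (l-1)" "B \<in> carrier_mat (l-1) (l-1)" "r = bdiag A (1\<^sub>m 2) B"
      using R_ln_bdiag[OF n(2) r] by blast
    have kr: "?k * r = r * ?k" unfolding AB(3) by (rule outer_twist_commute[OF AB(1,2)])
    have "?k * (r * ?w * embed l n g * ?iw) * ?k = (?k * r) * ?w * embed l n g * (?iw * ?k)"
      using k wc car by simp
    also have "\<dots> = r * (?k * ?w) * embed l n g * (?k * ?iw)" unfolding kr kiw using k wc car by simp
    also have "\<dots> = r * ?w * (?k * embed l n g * ?k) * ?iw" unfolding kw using k wc car by simp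
    also have "?k * embed l n g * ?k = embed l n (refl_conj n g)"
      using outer_twist_conj_embed[OF two n(2) l SO_carrier[OF g]] SO_carrier[OF g] by (simp add: refl_conj_def)
    finally show "W' (r * ?w * embed l n g * ?iw) = W (r * ?w * embed l n (refl_conj n g) * ?iw)"
      using W'[of "r * ?w * embed l n g * ?iw"] rS w E by (simp add: SO_mult del: assoc_mult_mat)
  qed simp
  define H where "H g = zeta_inner l n W g * f (refl_conj n g) (1\<^sub>m n)" for g
  have H: "H (u * g) = H g" if "u \<in> U_SO (2*n+1)" "g \<in> carrier (SO (2*n+1))" for u g
  proof -
    have "psi_GL \<psi> n (top_left n u) \<noteq> 0"
      unfolding psi_GL_def by (rule additive_character_nonzero[OF psi])
    moreover have "\<psi> 0 = 1" using psi by (simp add: additive_character_def)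
    ultimately show ?thesis
      using zeta_inner_equivariant[OF two n W _ that] f that by (simp add: H_def f_equivariant_def)
  qed
  have "zeta l n W' f = (\<Sum>C \<in> rcosets\<^bsub>SO (2*n+1)\<^esub> (U_SO (2*n+1)). H (refl_conj n (SOME g. g \<in> C)))"
    unfolding zeta_eq_inner by (rule sum.cong) (auto simp: H_def inner rcoset_rep_in_SO)
  also have "\<dots> = (\<Sum>C \<in> rcosets\<^bsub>SO (2*n+1)\<^esub> (U_SO (2*n+1)). H (SOME g. g \<in> C))"
    by (rule sum_rcosets_refl_conj[OF H])
  finally show ?thesis by (simp add: zeta_eq_inner H_def)
qed

section \<open>Transport of Whittaker functionals\<close>

text \<open>The element \<open>outer_twist l * outer_elt l\<close> of the torus carries Whittaker functionals of \<open>\<pi>\<close> to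
  Whittaker functionals of the conjugate representation.\<close>

context
  fixes \<psi> :: "'a::{field,finite} \<Rightarrow> complex" and l :: nat
    and scale :: "complex \<Rightarrow> 'v::ab_group_add \<Rightarrow> 'v" and \<pi> :: "'a mat \<Rightarrow> 'v \<Rightarrow> 'v"
  assumes two: "(2::'a) \<noteq> 0" and l: "2 \<le> l"
    and rep: "fd_representation (SO (2*l)) scale \<pi>"
begin

interpretation fd_representation "SO (2*l)" scale \<pi> by (rule rep)

lemma outer_elements:
  defines "c \<equiv> outer_elt l" and "k \<equiv> (outer_twist l :: 'a mat)"
  shows "c * k \<in> carrier (SO (2*l))" "k * c \<in> carrier (SO (2*l))"
    and "(k * c) * (c * k) = 1\<^sub>m (2*l)" "(c * k) * (k * c) = 1\<^sub>m (2*l)"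
    and "x \<in> carrier_mat (2*l) (2*l) \<Longrightarrow> (c * k) * x = (c * (k * x * k) * c) * (c * k)"
    and "x \<in> carrier_mat (2*l) (2*l) \<Longrightarrow> (k * c) * (c * x * c) = (k * x * k) * (k * c)"
proof -
  let ?N = "2*l"
  have l1: "1 \<le> l" using l by simp
  note [simp] = assoc_mult_mat[of _ ?N ?N _ ?N _ ?N] mult_carrier_mat[of _ ?N ?N _ ?N]
  have car: "c \<in> carrier_mat ?N ?N" "k \<in> carrier_mat ?N ?N" unfolding c_def k_def using l1 by simp_all
  have cc: "c * c = 1\<^sub>m ?N" and kk: "k * k = 1\<^sub>m ?N"
    unfolding c_def k_def by (rule outer_elt_square[OF l1], rule outer_twist_square[OF two l1])
  have C: "c * (c * x) = x" and K: "k * (k * x) = x" if "x \<in> carrier_mat ?N ?N" for x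
    unfolding assoc_mult_mat[OF car(1,1) that, symmetric] assoc_mult_mat[OF car(2,2) that, symmetric]
      cc kk left_mult_one_mat[OF that] by (rule refl)+
  show ck: "c * k \<in> carrier (SO ?N)" unfolding c_def k_def by (rule outer_elt_twist_SO[OF two l1])
  show 1: "(k * c) * (c * k) = 1\<^sub>m ?N" using car kk by (simp add: C)
  show "(c * k) * (k * c) = 1\<^sub>m ?N" using car cc by (simp add: K)
  have "inv\<^bsub>SO ?N\<^esub> (c * k) = 1\<^sub>m ?N * inv\<^bsub>SO ?N\<^esub> (c * k)"
    using SO_inv(1)[OF ck] by (simp add: SO_carrier left_mult_one_mat[of _ ?N ?N])
  also have "\<dots> = (k * c) * ((c * k) * inv\<^bsub>SO ?N\<^esub> (c * k))"
    unfolding 1[symmetric] using car SO_carrier[OF SO_inv(1)[OF ck]] by simp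
  also have "\<dots> = k * c" unfolding SO_inv(3)[OF ck] using car by (simp add: right_mult_one_mat[of _ ?N ?N])
  finally show "k * c \<in> carrier (SO ?N)" using SO_inv(1)[OF ck] by simp
  show "(c * k) * x = (c * (k * x * k) * c) * (c * k)" if "x \<in> carrier_mat ?N ?N"
    using car that kk by (simp add: C right_mult_one_mat[of _ ?N ?N])
  show "(k * c) * (c * x * c) = (k * x * k) * (k * c)" if "x \<in> carrier_mat ?N ?N"
    using car that by (simp add: C K)
qed

lemma outer_conj_SO: "g \<in> carrier (SO (2*l)) \<Longrightarrow> outer_elt l * g * outer_elt l \<in> carrier (SO (2*l) :: 'a mat monoid)"
  using l by (intro conj_involution_SO outer_elt_square outer_elt_form) auto

lemma twist_cancel:
  "\<pi> (outer_twist l * outer_elt l) (\<pi> (outer_elt l * outer_twist l) v) = v"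
  "\<pi> (outer_elt l * outer_twist l) (\<pi> (outer_twist l * outer_elt l) v) = v"
  using outer_elements rep_mult rep_one by (metis mult_SO one_SO)+

lemma Hom_from_outer_conj:
  assumes "\<Gamma> \<in> Hom_char scale (outer_conj l \<pi>) (U_SO (2*l)) (psi_SO \<psi> l)"
  shows "(\<lambda>v. \<Gamma> (\<pi> (outer_elt l * outer_twist l) v)) \<in> Hom_char scale \<pi> (U_SO (2*l)) (psi_SO \<psi> l)"
proof -
  let ?s = "outer_elt l * outer_twist l :: 'a mat"
  have "\<Gamma> (\<pi> ?s (\<pi> u v)) = psi_SO \<psi> l u * \<Gamma> (\<pi> ?s v)" if u: "u \<in> U_SO (2*l)" for u v
  proof -
    have uS: "u \<in> carrier (SO (2*l))" using u by (simp add: U_SO_def)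
    have ku: "outer_twist l * u * outer_twist l \<in> U_SO (2*l)"
      and psi: "psi_SO \<psi> l (outer_twist l * u * outer_twist l) = psi_SO \<psi> l u"
      by (rule outer_twist_conj_U_SO[OF two l u])+
    have kS: "outer_twist l * u * outer_twist l \<in> carrier (SO (2*l))" using ku by (simp add: U_SO_def)
    have "\<pi> ?s (\<pi> u v) = \<pi> (?s * u) v" using rep_mult[OF outer_elements(1) uS] by simp
    also have "\<dots> = outer_conj l \<pi> (outer_twist l * u * outer_twist l) (\<pi> ?s v)"
      unfolding outer_elements(5)[OF U_SO_carrier[OF u]] outer_conj_def
      using rep_mult[OF outer_conj_SO[OF kS] outer_elements(1)] by simp
    finally show ?thesis using assms ku psi by (simp add: Hom_char_def)
  qed
  moreover have "Vector_Spaces.linear scale (*) (\<lambda>v. \<Gamma> (\<pi> ?s v))"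
    using Vector_Spaces.linear_compose[OF rep_linear[OF outer_elements(1)], of "(*)" \<Gamma>] assms
    by (simp add: Hom_char_def o_def)
  ultimately show ?thesis by (simp add: Hom_char_def)
qed

lemma Hom_to_outer_conj:
  assumes "\<Gamma> \<in> Hom_char scale \<pi> (U_SO (2*l)) (psi_SO \<psi> l)"
  shows "(\<lambda>v. \<Gamma> (\<pi> (outer_twist l * outer_elt l) v))
    \<in> Hom_char scale (outer_conj l \<pi>) (U_SO (2*l)) (psi_SO \<psi> l)"
proof -
  let ?t = "outer_twist l * outer_elt l :: 'a mat"
  have "\<Gamma> (\<pi> ?t (outer_conj l \<pi> u v)) = psi_SO \<psi> l u * \<Gamma> (\<pi> ?t v)" if u: "u \<in> U_SO (2*l)" for u v
  proof -
    have uS: "u \<in> carrier (SO (2*l))" using u by (simp add: U_SO_def)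
    have ku: "outer_twist l * u * outer_twist l \<in> U_SO (2*l)"
      and psi: "psi_SO \<psi> l (outer_twist l * u * outer_twist l) = psi_SO \<psi> l u"
      by (rule outer_twist_conj_U_SO[OF two l u])+
    have kS: "outer_twist l * u * outer_twist l \<in> carrier (SO (2*l))" using ku by (simp add: U_SO_def)
    have "\<pi> ?t (outer_conj l \<pi> u v) = \<pi> (?t * (outer_elt l * u * outer_elt l)) v"
      unfolding outer_conj_def using rep_mult[OF outer_elements(2) outer_conj_SO[OF uS]] by simp
    also have "\<dots> = \<pi> (outer_twist l * u * outer_twist l) (\<pi> ?t v)"
      unfolding outer_elements(6)[OF U_SO_carrier[OF u]] using rep_mult[OF kS outer_elements(2)] by simp
    finally show ?thesis using assms ku psi by (simp add: Hom_char_def)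
  qed
  moreover have "Vector_Spaces.linear scale (*) (\<lambda>v. \<Gamma> (\<pi> ?t v))"
    using Vector_Spaces.linear_compose[OF rep_linear[OF outer_elements(2)], of "(*)" \<Gamma>] assms
    by (simp add: Hom_char_def o_def)
  ultimately show ?thesis by (simp add: Hom_char_def)
qed

lemma whittaker_equivariant:
  assumes "\<Gamma> \<in> Hom_char scale \<pi> (U_SO (2*l)) (psi_SO \<psi> l)"
  shows "W_equivariant \<psi> l (\<lambda>g. \<Gamma> (\<pi> g v))"
  using assms rep_mult by (auto simp: W_equivariant_def Hom_char_def U_SO_def)

lemma zeta_outer_conj:
  fixes \<tau> :: "'a mat \<Rightarrow> 'w::ab_group_add \<Rightarrow> 'w"
  assumes psi: "additive_character \<psi>" and n: "1 \<le> n" "n \<le> l - 1"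
    and \<tau>: "fd_representation (GL n) scale\<^sub>\<tau> \<tau>"
    and \<Lambda>: "\<Lambda> \<in> Hom_char scale\<^sub>\<tau> \<tau> (U_GL n) (\<lambda>u. inverse (psi_GL \<psi> n u))"
    and \<Gamma>: "\<Gamma> \<in> Hom_char scale \<pi> (U_SO (2*l)) (psi_SO \<psi> l)"
    and f: "f \<in> Ind_whittaker n \<tau> \<Lambda>"
  defines "t \<equiv> \<pi> (outer_twist l * outer_elt l)"
  shows "zeta l n (\<lambda>g. \<Gamma> (t (outer_conj l \<pi> g v))) f
      = zeta l n (\<lambda>g. \<Gamma> (\<pi> g (t v))) (\<lambda>g. f (refl_conj n g))"
    and "zeta l n (\<lambda>g. \<Gamma> (t (outer_conj l \<pi> g v))) (intertwine n f)
      = zeta l n (\<lambda>g. \<Gamma> (\<pi> g (t v))) (intertwine n (\<lambda>g. f (refl_conj n g)))"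
proof -
  have l1: "1 \<le> l" using l by simp
  have W: "W_equivariant \<psi> l (\<lambda>g. \<Gamma> (\<pi> g (t v)))" by (rule whittaker_equivariant[OF \<Gamma>])
  have W': "\<Gamma> (t (outer_conj l \<pi> g v)) = \<Gamma> (\<pi> (outer_twist l * g * outer_twist l) (t v))"
    if g: "g \<in> carrier (SO (2*l))" for g
  proof -
    have kS: "outer_twist l * g * outer_twist l \<in> carrier (SO (2*l))"
      using g outer_twist_carrier[OF l1] outer_twist_square[OF two l1] outer_twist_form[OF two l1]
      by (rule conj_involution_SO)
    have "t (outer_conj l \<pi> g v) = \<pi> ((outer_twist l * outer_elt l) * (outer_elt l * g * outer_elt l)) v"
      unfolding outer_conj_def t_def using rep_mult[OF outer_elements(2) outer_conj_SO[OF g]] by simp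
    also have "\<dots> = \<pi> (outer_twist l * g * outer_twist l) (t v)"
      unfolding outer_elements(6)[OF SO_carrier[OF g]] t_def using rep_mult[OF kS outer_elements(2)] by simp
    finally show ?thesis by simp
  qed
  have f': "(\<lambda>g. f (refl_conj n g)) \<in> Ind_whittaker n \<tau> \<Lambda>" by (rule Ind_whittaker_refl_conj[OF f])
  show "zeta l n (\<lambda>g. \<Gamma> (t (outer_conj l \<pi> g v))) f
      = zeta l n (\<lambda>g. \<Gamma> (\<pi> g (t v))) (\<lambda>g. f (refl_conj n g))"
    by (rule zeta_twist[OF two n psi W W' Ind_whittaker_equivariant[OF \<tau> f' \<Lambda>]])
  have Mf: "f_equivariant \<psi> n (\<lambda>g. intertwine n f (refl_conj n g))"
    using intertwine_equivariant[OF \<tau> f' \<Lambda>]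
    by (simp add: f_equivariant_def intertwine_refl_conj SO_mult U_SO_def)
  have "zeta l n (\<lambda>g. \<Gamma> (t (outer_conj l \<pi> g v))) (intertwine n f)
      = zeta l n (\<lambda>g. \<Gamma> (\<pi> g (t v))) (\<lambda>g. intertwine n f (refl_conj n g))"
    by (rule zeta_twist[OF two n psi W W' Mf])
  also have "\<dots> = zeta l n (\<lambda>g. \<Gamma> (\<pi> g (t v))) (intertwine n (\<lambda>g. f (refl_conj n g)))"
    by (rule zeta_cong) (simp add: intertwine_refl_conj)
  finally show "zeta l n (\<lambda>g. \<Gamma> (t (outer_conj l \<pi> g v))) (intertwine n f)
      = zeta l n (\<lambda>g. \<Gamma> (\<pi> g (t v))) (intertwine n (\<lambda>g. f (refl_conj n g)))" .
qed

text \<open>The functional equations for the two representations are the same family of identities, indexed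
  differently: \<open>(W', f)\<close> on one side corresponds to \<open>(W, f \<circ> refl_conj n)\<close> on the other, where \<open>W'\<close> is
  \<open>W\<close> composed with conjugation by \<open>outer_twist\<close>.\<close>

lemma is_gamma_outer_conj:
  fixes \<tau> :: "'a mat \<Rightarrow> 'w::ab_group_add \<Rightarrow> 'w"
  assumes psi: "additive_character \<psi>" and n: "1 \<le> n" "n \<le> l - 1"
    and \<tau>: "fd_representation (GL n) scale\<^sub>\<tau> \<tau>"
  shows "is_gamma \<psi> l n scale (outer_conj l \<pi>) scale\<^sub>\<tau> \<tau> \<gamma> \<longleftrightarrow> is_gamma \<psi> l n scale \<pi> scale\<^sub>\<tau> \<tau> \<gamma>"
proof
  let ?s = "\<pi> (outer_elt l * outer_twist l)" and ?t = "\<pi> (outer_twist l * outer_elt l)"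
  assume gam: "is_gamma \<psi> l n scale \<pi> scale\<^sub>\<tau> \<tau> \<gamma>"
  show "is_gamma \<psi> l n scale (outer_conj l \<pi>) scale\<^sub>\<tau> \<tau> \<gamma>"
    unfolding is_gamma_def
  proof (intro ballI impI)
    fix \<Gamma>' \<Lambda> W f
    assume \<Gamma>': "\<Gamma>' \<in> Hom_char scale (outer_conj l \<pi>) (U_SO (2*l)) (psi_SO \<psi> l)"
      and \<Lambda>: "\<Lambda> \<in> Hom_char scale\<^sub>\<tau> \<tau> (U_GL n) (\<lambda>u. inverse (psi_GL \<psi> n u))"
      and nz: "\<Gamma>' \<noteq> (\<lambda>_. 0)" "\<Lambda> \<noteq> (\<lambda>_. 0)"
      and W: "W \<in> whittaker (outer_conj l \<pi>) \<Gamma>'" and f: "f \<in> Ind_whittaker n \<tau> \<Lambda>"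
    define \<Gamma> where "\<Gamma> = (\<lambda>v. \<Gamma>' (?s v))"
    have \<Gamma>: "\<Gamma> \<in> Hom_char scale \<pi> (U_SO (2*l)) (psi_SO \<psi> l)"
      unfolding \<Gamma>_def by (rule Hom_from_outer_conj[OF \<Gamma>'])
    have \<Gamma>t: "\<Gamma> (?t v) = \<Gamma>' v" for v by (simp add: \<Gamma>_def twist_cancel)
    then have "\<Gamma> \<noteq> (\<lambda>_. 0)" using nz(1) by (metis (full_types) ext)
    obtain v where W: "W = (\<lambda>g. \<Gamma> (?t (outer_conj l \<pi> g v)))"
      using W by (auto simp: whittaker_def \<Gamma>t)
    have "(\<lambda>g. \<Gamma> (\<pi> g (?t v))) \<in> whittaker \<pi> \<Gamma>" by (auto simp: whittaker_def)
    then show "\<gamma> * zeta l n W f = zeta l n W (intertwine n f)"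
      unfolding W zeta_outer_conj[OF psi n \<tau> \<Lambda> \<Gamma> f]
      using gam \<Gamma> \<Lambda> \<open>\<Gamma> \<noteq> _\<close> nz(2) Ind_whittaker_refl_conj[OF f] by (simp add: is_gamma_def)
  qed
next
  let ?s = "\<pi> (outer_elt l * outer_twist l)" and ?t = "\<pi> (outer_twist l * outer_elt l)"
  assume gam: "is_gamma \<psi> l n scale (outer_conj l \<pi>) scale\<^sub>\<tau> \<tau> \<gamma>"
  show "is_gamma \<psi> l n scale \<pi> scale\<^sub>\<tau> \<tau> \<gamma>"
    unfolding is_gamma_def
  proof (intro ballI impI)
    fix \<Gamma> \<Lambda> W f
    assume \<Gamma>: "\<Gamma> \<in> Hom_char scale \<pi> (U_SO (2*l)) (psi_SO \<psi> l)"
      and \<Lambda>: "\<Lambda> \<in> Hom_char scale\<^sub>\<tau> \<tau> (U_GL n) (\<lambda>u. inverse (psi_GL \<psi> n u))"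
      and nz: "\<Gamma> \<noteq> (\<lambda>_. 0)" "\<Lambda> \<noteq> (\<lambda>_. 0)"
      and W: "W \<in> whittaker \<pi> \<Gamma>" and f: "f \<in> Ind_whittaker n \<tau> \<Lambda>"
    define \<Gamma>' where "\<Gamma>' = (\<lambda>v. \<Gamma> (?t v))"
    have \<Gamma>': "\<Gamma>' \<in> Hom_char scale (outer_conj l \<pi>) (U_SO (2*l)) (psi_SO \<psi> l)"
      unfolding \<Gamma>'_def by (rule Hom_to_outer_conj[OF \<Gamma>])
    have "\<Gamma>' (?s v) = \<Gamma> v" for v by (simp add: \<Gamma>'_def twist_cancel)
    then have "\<Gamma>' \<noteq> (\<lambda>_. 0)" using nz(1) by (metis (full_types) ext)
    obtain v0 where W: "W = (\<lambda>g. \<Gamma> (\<pi> g v0))" using W by (auto simp: whittaker_def)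
    define v where "v = ?s v0"
    have W: "W = (\<lambda>g. \<Gamma> (\<pi> g (?t v)))" by (simp add: W v_def twist_cancel)
    let ?f = "\<lambda>g. f (refl_conj n g)"
    have f': "?f \<in> Ind_whittaker n \<tau> \<Lambda>" by (rule Ind_whittaker_refl_conj[OF f])
    have "(\<lambda>g. \<Gamma> (?t (outer_conj l \<pi> g v))) \<in> whittaker (outer_conj l \<pi>) \<Gamma>'"
      by (auto simp: whittaker_def \<Gamma>'_def)
    then have "\<gamma> * zeta l n (\<lambda>g. \<Gamma> (?t (outer_conj l \<pi> g v))) ?f
        = zeta l n (\<lambda>g. \<Gamma> (?t (outer_conj l \<pi> g v))) (intertwine n ?f)"
      using gam \<Gamma>' \<Lambda> \<open>\<Gamma>' \<noteq> _\<close> nz(2) f' by (simp add: is_gamma_def)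
    then show "\<gamma> * zeta l n W f = zeta l n W (intertwine n f)"
      unfolding W zeta_outer_conj[OF psi n \<tau> \<Lambda> \<Gamma> f'] by simp
  qed
qed

end

text \<open>Translation by \<open>1\<close> permutes the field, so its cardinality vanishes in it.\<close>

lemma two_nonzero_if_odd_card:
  assumes "odd (card (UNIV :: 'a::{field,finite} set))"
  shows "(2::'a) \<noteq> 0"
proof
  assume two: "(2::'a) = 0"
  let ?q = "card (UNIV :: 'a set)"
  have "(\<Sum>x\<in>UNIV. x + (1::'a)) = (\<Sum>x\<in>UNIV. x)"
    by (rule sum.reindex_bij_witness[of _ "\<lambda>x. x - 1" "\<lambda>x. x + 1"]) auto
  then have "of_nat ?q = (0::'a)" by (simp add: sum.distrib)
  moreover obtain m where "?q = 2 * m + 1" using assms by (auto elim: oddE)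
  ultimately show False using two by simp
qed

theorem corollary6p4:
  fixes p r l n :: nat
    and \<psi> :: "'a::{field,finite} \<Rightarrow> complex"
    and scale\<^sub>\<pi> :: "complex \<Rightarrow> 'v::ab_group_add \<Rightarrow> 'v" and \<pi> :: "'a mat \<Rightarrow> 'v \<Rightarrow> 'v"
    and scale\<^sub>\<tau> :: "complex \<Rightarrow> 'w::ab_group_add \<Rightarrow> 'w" and \<tau> :: "'a mat \<Rightarrow> 'w \<Rightarrow> 'w"
  assumes "prime p" and "odd p" and "card (UNIV :: 'a set) = p ^ r"
    and "additive_character \<psi>" and "\<exists>x. \<psi> x \<noteq> 1"
    and "0 < l"
    and "irreducible_representation (SO (2*l)) scale\<^sub>\<pi> \<pi>"
    and "cuspidal (2*l) \<pi>"
    and "generic_SO \<psi> l scale\<^sub>\<pi> \<pi>"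
    and "1 \<le> n" and "n \<le> l - 1"
    and "irreducible_representation (GL n) scale\<^sub>\<tau> \<tau>"
    and "generic_GL \<psi> n scale\<^sub>\<tau> \<tau>"
  shows "gamma \<psi> l n scale\<^sub>\<pi> \<pi> scale\<^sub>\<tau> \<tau>
       = gamma \<psi> l n scale\<^sub>\<pi> (outer_conj l \<pi>) scale\<^sub>\<tau> \<tau>"
proof -
  have two: "(2::'a) \<noteq> 0" using assms(2,3) by (intro two_nonzero_if_odd_card) simp
  have l: "2 \<le> l" using assms(10,11) by simp
  have "fd_representation (SO (2*l)) scale\<^sub>\<pi> \<pi>" "fd_representation (GL n) scale\<^sub>\<tau> \<tau>"
    using assms(7,12) by (simp_all add: irreducible_representation_def)
  then have "is_gamma \<psi> l n scale\<^sub>\<pi> (outer_conj l \<pi>) scale\<^sub>\<tau> \<tau> \<gamma> = is_gamma \<psi> l n scale\<^sub>\<pi> \<pi> scale\<^sub>\<tau> \<tau> \<gamma>" for \<gamma>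
    using is_gamma_outer_conj[OF two l _ assms(4,10,11)] by blast
  then show ?thesis by (simp add: gamma_def)
qed

end
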